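(* Let $p$ be a prime, let $\delta\in(0,24/(p-1)]$ and let $N\in\mathbb{N}$. For each integer $n\ge 1$ we have \begin{align*} c_p^{(\delta)}(n)&=\frac{2\pi \delta^{1/2}}{\sqrt{\frac{24n}{p-1}-\delta}} \sum_{1\le k\le N }A_{pk}^{(\delta)}(n)\,I_1\Bigg(\frac{(p-1)\pi}{6pk} \sqrt{\delta\bigg(\frac{24n}{p-1}-\delta\bigg)}\Bigg) +e^{\frac{(24n-(p-1)\delta)\pi }{6p^2N^2}}E_{p,N}^{(\delta)}(n), \end{align*} where \begin{equation*} A_k^{(\delta)}(n)=\frac{1}{k}\sum_{\substack{0\le h<k\\ \gcd(h,k)=1}} \Big(\omega_{h,k}^{-1}\omega_{h,\frac{k}{p}}\Big)^{\delta} e^{-\frac{2\pi i hn}{k}}, \end{equation*} and the error term $E_{p,N}^{(\delta)}(n)$ satisfies \begin{align*} \Big|E_{p,N}^{(\delta)}(n)\Big|&\le\frac{(p-1)e^{\frac{(p-1)\pi\delta}{12}} } {p^2}\Big(\pi\sqrt{2}-2+ 2f\big(e^{-6\pi }\big)^{\delta}f\big(e^{-2\pi}\big)^{\delta}\Big) + \frac{ 2(p-1)\, e^{-\frac{\pi(p-1)\delta}{12p}}} {p^{1-\delta/2}}f\Big(e^{-\frac{2\pi }{p}}\Big)^{\delta} f\big(e^{-2\pi}\big)^{\delta}. \end{align*}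
   Context: For $0<|q|<1$ let $f(q)=\prod_{n\ge1}\frac{1}{1-q^n}$ and, for a prime $p$, $G_p(q)=f(q^p)/f(q)=\prod_{n\ge1}\frac{1-q^n}{1-q^{pn}}$. For real $\delta>0$, $G_p(q)^\delta$ denotes the power series in $q$ with constant term $1$ (i.e. $\exp(\delta\log G_p(q))$ with the branch of the logarithm vanishing at $q=0$), and the Borwein coefficients $c_p^{(\delta)}(n)$ are defined by $G_p(q)^{\delta}=\sum_{n\ge0}c_p^{(\delta)}(n)q^n$. The Dedekind sum is $s(h,k)=\sum_{1\le j<k}\big(\frac{j}{k}-\lfloor\frac{j}{k}\rfloor-\frac12\big)\big(\frac{jh}{k}-\lfloor\frac{jh}{k}\rfloor-\frac12\big)$ and $\omega_{h,k}=e^{\pi i s(h,k)}$. Complex powers are $z^{a}:=e^{a\log z}$ with the principal logarithm ($\arg z\in[-\pi,\pi)$). $I_1(z)=\sum_{n\ge0}\frac{1}{n!(n+1)!}(z/2)^{2n+1}$ is the modified Bessel function of the first kind.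
   Formalization: The δ-th power of ω_{h,k}^{-1}ω_{h,k/p} is read as exp(πiδ(s(h,k/p)−s(h,k))), since with the principal power the claim fails (p=29, δ=1/2, n=3000, N=10); for n=1, δ=24/(p−1) the main term 0/0 is read as its limit; N≥1. *)

theory Defs
  imports "HOL-Complex_Analysis.Complex_Analysis" "HOL-Computational_Algebra.Primes"
begin

definition partition_gf :: "'a::real_normed_field \<Rightarrow> 'a" where
  "partition_gf q = (\<Prod>n. 1 / (1 - q ^ (n + 1)))"

definition borwein_G :: "nat \<Rightarrow> complex \<Rightarrow> complex" where
  "borwein_G p q = partition_gf (q ^ p) / partition_gf q"

text \<open>The branch of log G on the open unit disc that vanishes at 0. It exists because G has
  no zeros there, and on the disc it is unique.\<close>

definition borwein_log_G :: "nat \<Rightarrow> complex \<Rightarrow> complex" where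
  "borwein_log_G p = (SOME L. L holomorphic_on ball 0 1 \<and> L 0 = 0 \<and>
     (\<forall>q\<in>ball 0 1. exp (L q) = borwein_G p q))"

definition borwein_coeff :: "nat \<Rightarrow> real \<Rightarrow> nat \<Rightarrow> complex" where
  "borwein_coeff p \<delta> n =
     fps_nth (fps_expansion (\<lambda>q. exp (of_real \<delta> * borwein_log_G p q)) 0) n"

definition dedekind_sum :: "nat \<Rightarrow> nat \<Rightarrow> real" where
  "dedekind_sum h k = (\<Sum>j\<in>{1..<k}.
     (real j / real k - of_int \<lfloor>real j / real k\<rfloor> - 1/2) *
     (real (j * h) / real k - of_int \<lfloor>real (j * h) / real k\<rfloor> - 1/2))"

definition log_omega :: "nat \<Rightarrow> nat \<Rightarrow> complex" where
  "log_omega h k = \<i> * of_real (pi * dedekind_sum h k)"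

definition omega :: "nat \<Rightarrow> nat \<Rightarrow> complex" where
  "omega h k = exp (log_omega h k)"

text \<open>The power $(\omega_{h,k}^{-1}\omega_{h,k/p})^\delta$ (used for $p \mid k$), where the
  logarithm of $\omega_{h,k} = e^{\pi i s(h,k)}$ is $\pi i s(h,k)$. This is the value that the
  transformation formula of log f gives for $G_p^\delta$. It is the principal power when
  $|s(h,k/p) - s(h,k)| < 1$ (see below), but not in general: the differences of Dedekind sums
  are unbounded. With the principal power instead, the theorem fails for non-integral
  $\delta$: numerically, for p = 29, $\delta$ = 1/2, n = 3000, N = 10 the error (including its
  exponential factor) is about 82000, while its bound is about 127.\<close>

definition omega_ratio_power :: "real \<Rightarrow> nat \<Rightarrow> nat \<Rightarrow> nat \<Rightarrow> complex" where
  "omega_ratio_power \<delta> p h k = exp (of_real \<delta> * (- log_omega h k + log_omega h (k div p)))"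

lemma omega_ratio_power_1: "omega_ratio_power 1 p h k = inverse (omega h k) * omega h (k div p)"
  by (simp add: omega_ratio_power_def omega_def exp_add exp_minus exp_diff field_simps)

lemma omega_ratio_power_eq_principal:
  assumes "\<bar>dedekind_sum h (k div p) - dedekind_sum h k\<bar> < 1"
  shows "omega_ratio_power \<delta> p h k =
           (inverse (omega h k) * omega h (k div p)) powr of_real \<delta>"
proof -
  define z where "z = - log_omega h k + log_omega h (k div p)"
  define x where "x = dedekind_sum h (k div p) - dedekind_sum h k"
  have im: "Im z = pi * x"
    by (simp add: z_def log_omega_def x_def algebra_simps)
  have "- 1 < x" "x < 1"
    using assms by (auto simp: x_def abs_less_iff)
  then have "pi * - 1 < pi * x" "pi * x < pi * 1"
    by (intro mult_strict_left_mono; simp)+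
  then have "Ln (exp z) = z"
    unfolding im[symmetric] by (intro Ln_exp) linarith+
  moreover have "inverse (omega h k) * omega h (k div p) = exp z"
    by (simp add: z_def omega_def exp_add exp_minus exp_diff field_simps)
  ultimately show ?thesis
    by (simp add: powr_def omega_ratio_power_def z_def)
qed

definition borwein_A :: "nat \<Rightarrow> real \<Rightarrow> nat \<Rightarrow> nat \<Rightarrow> complex" where
  "borwein_A p \<delta> k n = 1 / of_nat k *
     (\<Sum>h | h < k \<and> gcd h k = 1.
        omega_ratio_power \<delta> p h k * exp (- (2 * of_real pi * \<i> * of_nat h * of_nat n / of_nat k)))"

definition bessel_I1 :: "real \<Rightarrow> real" where
  "bessel_I1 z = (\<Sum>n. 1 / (fact n * fact (n + 1)) * (z / 2) ^ (2 * n + 1))"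

text \<open>If n = 1 and $\delta = 24/(p-1)$, then $24n/(p-1) - \delta = 0$ and the main term has the form
  0/0. It is then understood as its limit, which \<open>main_term_tendsto\<close> identifies.\<close>

definition main_term :: "nat \<Rightarrow> real \<Rightarrow> nat \<Rightarrow> nat \<Rightarrow> complex" where
  "main_term p \<delta> N n =
     (if 24 * real n / (real p - 1) - \<delta> = 0
      then (\<Sum>k = 1..N. borwein_A p \<delta> (p * k) n *
             of_real ((real p - 1) * pi\<^sup>2 * \<delta> / (6 * real p * real k)))
      else of_real (2 * pi * sqrt \<delta> / sqrt (24 * real n / (real p - 1) - \<delta>)) *
           (\<Sum>k = 1..N. borwein_A p \<delta> (p * k) n *
             of_real (bessel_I1 ((real p - 1) * pi / (6 * real p * real k) *
               sqrt (\<delta> * (24 * real n / (real p - 1) - \<delta>))))))"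

lemma bessel_I1_factor:
  "bessel_I1 z = z / 2 * (\<Sum>n. 1 / (fact n * fact (n + 1)) * ((z / 2)\<^sup>2) ^ n)"
  and bessel_I1_factor_isCont:
  "isCont (\<lambda>w::real. \<Sum>n. 1 / (fact n * fact (n + 1)) * w ^ n) w"
proof -
  have sm: "summable (\<lambda>n. 1 / (fact n * fact (n + 1)) * w ^ n)" for w :: real
  proof (rule summable_comparison_test')
    show "summable (\<lambda>n. inverse (fact n) * \<bar>w\<bar> ^ n)"
      using summable_exp[of "\<bar>w\<bar>"] by simp
    show "norm (1 / (fact n * fact (n + 1)) * w ^ n) \<le> inverse (fact n) * \<bar>w\<bar> ^ n" for n
    proof -
      have "(fact n :: real) * 1 \<le> fact n * fact (n + 1)"
        by (intro mult_left_mono fact_ge_1) auto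
      then have "1 / (fact n * fact (n + 1)) \<le> (1 / fact n :: real)"
        by (intro divide_left_mono) auto
      from mult_right_mono[OF this, of "\<bar>w\<bar> ^ n"] show ?thesis
        by (simp add: abs_mult power_abs inverse_eq_divide)
    qed
  qed
  show "bessel_I1 z = z / 2 * (\<Sum>n. 1 / (fact n * fact (n + 1)) * ((z / 2)\<^sup>2) ^ n)"
    unfolding bessel_I1_def suminf_mult[OF sm, symmetric]
    by (rule suminf_cong) (simp add: power_mult power_add)
  show "isCont (\<lambda>w::real. \<Sum>n. 1 / (fact n * fact (n + 1)) * w ^ n) w"
    by (rule isCont_powser_converges_everywhere[OF sm])
qed

lemma main_term_tendsto:
  assumes "p > 1" and "n \<ge> 1"
  defines "\<delta>\<^sub>0 \<equiv> 24 * real n / (real p - 1)"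
  shows "((\<lambda>\<delta>. main_term p \<delta> N n) \<longlongrightarrow> main_term p \<delta>\<^sub>0 N n) (at_left \<delta>\<^sub>0)"
proof -
  define B :: "real \<Rightarrow> real" where "B = (\<lambda>w. \<Sum>n. 1 / (fact n * fact (n + 1)) * w ^ n)"
  define c where "c k = (real p - 1) * pi / (6 * real p * real k)" for k
  define g where "g \<delta> = (\<Sum>k = 1..N. borwein_A p \<delta> (p * k) n *
      of_real (pi * c k * \<delta> * B ((c k * sqrt (\<delta> * (\<delta>\<^sub>0 - \<delta>)) / 2)\<^sup>2)))" for \<delta>
  have pos: "\<delta>\<^sub>0 > 0"
    using assms by (simp add: \<delta>\<^sub>0_def)
  have B0: "B 0 = 1"
    unfolding B_def by (subst powser_zero) auto
  have eq: "main_term p \<delta> N n = g \<delta>" if "0 < \<delta>" "\<delta> < \<delta>\<^sub>0" for \<delta>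
  proof -
    define X where "X = \<delta>\<^sub>0 - \<delta>"
    have X: "X > 0" "sqrt X \<noteq> 0" using that by (auto simp: X_def)
    have ker: "2 * pi * sqrt \<delta> / sqrt X * bessel_I1 (c k * sqrt (\<delta> * X))
        = pi * c k * \<delta> * B ((c k * sqrt (\<delta> * X) / 2)\<^sup>2)" for k
    proof -
      define b where "b = B ((c k * sqrt (\<delta> * X) / 2)\<^sup>2)"
      have "bessel_I1 (c k * sqrt (\<delta> * X)) = c k * (sqrt \<delta> * sqrt X) / 2 * b"
        by (simp only: b_def B_def bessel_I1_factor real_sqrt_mult)
      moreover have "2 * pi * s / r * (a * (s * r) / 2 * b) = pi * a * (s * s) * b"
        if "r \<noteq> 0" for s r a :: real
        using that by (simp add: field_simps)
      ultimately have "2 * pi * sqrt \<delta> / sqrt X * bessel_I1 (c k * sqrt (\<delta> * X))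
          = pi * c k * (sqrt \<delta> * sqrt \<delta>) * b"
        using X(2) by metis
      then show ?thesis
        using that by (simp add: b_def)
    qed
    have "main_term p \<delta> N n = of_real (2 * pi * sqrt \<delta> / sqrt X) *
        (\<Sum>k = 1..N. borwein_A p \<delta> (p * k) n * of_real (bessel_I1 (c k * sqrt (\<delta> * X))))"
      using that X by (simp add: main_term_def X_def \<delta>\<^sub>0_def c_def)
    also have "\<dots> = (\<Sum>k = 1..N. borwein_A p \<delta> (p * k) n *
        of_real (2 * pi * sqrt \<delta> / sqrt X * bessel_I1 (c k * sqrt (\<delta> * X))))"
      by (simp add: sum_distrib_left mult_ac)
    also have "\<dots> = g \<delta>"
      by (simp only: g_def X_def[symmetric] ker)
    finally show ?thesis .
  qed
  have g0: "g \<delta>\<^sub>0 = main_term p \<delta>\<^sub>0 N n"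
    unfolding g_def main_term_def \<delta>\<^sub>0_def[symmetric]
    by (simp add: B0 c_def power2_eq_square mult_ac)
  have cB: "isCont B w" for w
    unfolding B_def by (rule bessel_I1_factor_isCont)
  have cA: "isCont (\<lambda>\<delta>. borwein_A p \<delta> k n) \<delta>" for k \<delta>
    unfolding borwein_A_def omega_ratio_power_def by (intro continuous_intros)
  have "isCont g \<delta>\<^sub>0"
    unfolding g_def
    by (intro continuous_intros cA isCont_o2[OF _ cB]) auto
  then have "(g \<longlongrightarrow> g \<delta>\<^sub>0) (at_left \<delta>\<^sub>0)"
    by (simp add: isCont_def filterlim_at_split)
  moreover have "eventually (\<lambda>\<delta>. g \<delta> = main_term p \<delta> N n) (at_left \<delta>\<^sub>0)"
    using eventually_at_left_real[OF pos] by eventually_elim (simp add: eq)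
  ultimately show ?thesis
    unfolding g0 by (rule Lim_transform_eventually)
qed

end

theory Submission
  imports Defs "HOL-Number_Theory.Cong"
begin

text \<open>The coefficient is the integral of $G_p(e^{2\pi i\tau})^\delta e^{-2\pi i n\tau}$ over a segment of length
  one in the upper half-plane. The path is deformed to the polygon through the points where Ford
  circles of adjacent Farey fractions of order $pN$ touch; the edge below $h/k$ is a chord of the Ford
  circle at $h/k$. Near $h/k$ the transformation formula of $\log f$ applies with
  $\tau = h/k + iz/k^2$. If $p \nmid k$, the integrand is bounded, and only the length of the edge matters.
  If $p \mid k$, it is a number of modulus 1 times $e^{a/z+bz}(1 + (G_p^\delta - 1))$: the first part is moved to
  the line $\mathrm{Re}(1/z) = 1$ and yields the Bessel function up to the two missing arcs; the second
  part is bounded on the edge, where $\mathrm{Re}(1/z) \ge 1$ and $a \le 2\pi$ make it largest at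
  $\mathrm{Re}(1/z) = 1$. A single edge can be longer than $2/(kpN)$, but the edges below denominators $k$ and
  $pN - k$ together are short enough to give the constants of the theorem.

  The transformation formula is obtained from Iseki's functional equation, which is proved by a
  residue computation over growing rectangles, with a limit for the Dedekind eta function itself, by
  summing over residue classes modulo $k$ and continuing analytically from the positive real axis.\<close>

section \<open>The logarithm of the partition generating function\<close>

text \<open>The order is \<open>p * N\<close> for two reasons. The denominators divisible by p are
  then exactly p, 2p, ..., Np, the terms of the main sum; and the reflection of k to
  \<open>p * N - k\<close> preserves divisibility by p, so that the pairing of edges works inside
  each of the two classes of denominators.

  As \<delta> is real, the transformation law is needed for logarithms; its exponentiated form would
  lose the branch. It is applied to q^p and to q, and the two half logarithms cancel if p divides k
  and differ by (ln p) / 2 otherwise, whence \<open>real p powr (\<delta> / 2)\<close>.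

  The bound on \<delta> enters as a \<le> 2 pi, where 2 pi is the decay rate of G_p - 1 in Re(1/z),
  and as nonnegativity of 24 n - (p - 1) \<delta>, which makes the heights of the end points control
  the exponential on an edge.

  In the first error term, pi sqrt 2 comes from the two missing arcs, each at most (pi / 2) sqrt 2 k
  / M, and -2 is the 1 subtracted from the power of G_p, doubled by the average chord. Treating log
  G_p as one series costs f(e^(-2 pi))^\<delta> only; the factor f(e^(-6 pi))^\<delta>, which is at
  least 1, joins at the very end.\<close>

lemma holomorphic_on_suminf:
  fixes f :: "nat \<Rightarrow> complex \<Rightarrow> complex"
  assumes "open S" and "\<And>n. f n holomorphic_on S"
    and "\<And>x. x \<in> S \<Longrightarrow> \<exists>d>0. cball x d \<subseteq> S \<and>
           (\<exists>M. summable M \<and> (\<forall>n. \<forall>z\<in>cball x d. norm (f n z) \<le> M n))"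
  shows "(\<lambda>z. \<Sum>n. f n z) holomorphic_on S"
proof (rule holomorphic_uniform_sequence[OF assms(1)])
  show "(\<lambda>z. \<Sum>i<n. f i z) holomorphic_on S" for n
    by (intro holomorphic_intros assms)
  fix x assume "x \<in> S"
  from assms(3)[OF this] obtain d M where d: "d > 0" "cball x d \<subseteq> S" and M: "summable M"
    "\<And>n z. z \<in> cball x d \<Longrightarrow> norm (f n z) \<le> M n" by blast
  have "uniform_limit (cball x d) (\<lambda>n z. \<Sum>i<n. f i z) (\<lambda>z. \<Sum>i. f i z) sequentially"
    by (rule Weierstrass_m_test) (use M in auto)
  with d show "\<exists>d>0. cball x d \<subseteq> S \<and>
      uniform_limit (cball x d) (\<lambda>n z. \<Sum>i<n. f i z) (\<lambda>z. \<Sum>i. f i z) sequentially" by blast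
qed

lemma neg_ln_one_minus_le:
  fixes x :: real assumes "0 \<le> x" "x < 1"
  shows "- ln (1 - x) \<le> x / (1 - x)"
proof -
  have "ln (inverse (1 - x)) \<le> inverse (1 - x) - 1"
    using assms by (intro ln_le_minus_one) auto
  moreover have "inverse (1 - x) - 1 = x / (1 - x)" using assms by (simp add: field_simps)
  moreover have "ln (inverse (1 - x)) = - ln (1 - x)" by (rule ln_inverse)
  ultimately show ?thesis by simp
qed

text \<open>The Taylor coefficients of -log(1 - w) are nonnegative, so the triangle inequality,
  applied term by term, gives the value of the series at \<open>norm w\<close>.\<close>

lemma norm_Ln_one_minus_le:
  fixes w :: complex assumes "norm w < 1"
  shows "norm (Ln (1 - w)) \<le> - ln (1 - norm w)"
proof -
  have c: "(\<lambda>n. - (w ^ n) / of_nat n) sums ln (1 - w)"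
    using Ln_series'[of "- w"] assms by simp
  have r: "(\<lambda>n. - (norm w ^ n) / of_nat n) sums ln (1 - norm w)"
    using ln_series'[of "- norm w"] assms by simp
  from sums_minus[OF r] have r': "(\<lambda>n. norm w ^ n / of_nat n) sums - ln (1 - norm w)" by simp
  have "norm (\<Sum>n. - (w ^ n) / of_nat n) \<le> (\<Sum>n. norm w ^ n / real n)"
    by (rule norm_suminf_le) (use r' in \<open>auto simp: norm_divide norm_power sums_iff\<close>)
  then show ?thesis using c r' by (simp add: sums_iff)
qed

lemma norm_Ln_one_minus_le':
  fixes w :: complex assumes "norm w \<le> r" "r < 1"
  shows "norm (Ln (1 - w)) \<le> norm w / (1 - r)"
proof -
  have "norm (Ln (1 - w)) \<le> norm w / (1 - norm w)"
    using norm_Ln_one_minus_le[of w] neg_ln_one_minus_le[of "norm w"] assms by simp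
  also have "\<dots> \<le> norm w / (1 - r)"
    using assms by (intro divide_left_mono) auto
  finally show ?thesis .
qed

text \<open>The principal branch is the right one in every term: 1 - q^(n+1) stays in the right
  half-plane for q in the unit disc. Thus this is the logarithm of f that is holomorphic there and
  vanishes at 0.\<close>

definition logf :: "complex \<Rightarrow> complex" where
  "logf q = (\<Sum>n. - Ln (1 - q ^ (n + 1)))"

text \<open>The real logarithm of f on [0, 1), kept separate because it is the majorant for
  \<open>logf\<close> and \<open>logG\<close> and the form in which powers of f occur in the
  bounds.\<close>

definition lnf :: "real \<Rightarrow> real" where
  "lnf x = (\<Sum>n. - ln (1 - x ^ (n + 1)))"

lemma power_Suc_le_base: "0 \<le> x \<Longrightarrow> x < 1 \<Longrightarrow> x ^ (n + 1) \<le> (x::real)"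
  using mult_left_le[of "x ^ n" x] power_le_one[of x n] by simp

lemma lnf_term_bounds:
  fixes x :: real assumes "0 \<le> x" "x < 1"
  shows "0 \<le> - ln (1 - x ^ (n + 1))" "- ln (1 - x ^ (n + 1)) \<le> x ^ n * (x / (1 - x))"
proof -
  have p: "0 \<le> x ^ (n + 1)" "x ^ (n + 1) \<le> x"
    using assms power_Suc_le_base[OF assms] by auto
  then show "0 \<le> - ln (1 - x ^ (n + 1))" using assms by auto
  have "- ln (1 - x ^ (n + 1)) \<le> x ^ (n + 1) / (1 - x ^ (n + 1))"
    using p assms by (intro neg_ln_one_minus_le) linarith+
  also have "\<dots> \<le> x ^ (n + 1) / (1 - x)"
    by (rule divide_left_mono) (use p assms in auto)
  finally show "- ln (1 - x ^ (n + 1)) \<le> x ^ n * (x / (1 - x))" by (simp add: mult_ac)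
qed

lemma summable_lnf:
  fixes x :: real assumes "0 \<le> x" "x < 1"
  shows "summable (\<lambda>n. - ln (1 - x ^ (n + 1)))"
proof (rule summable_comparison_test')
  show "summable (\<lambda>n. x ^ n * (x / (1 - x)))"
    using assms by (intro summable_mult2 summable_geometric) auto
  show "norm (- ln (1 - x ^ (n + 1))) \<le> x ^ n * (x / (1 - x))" for n
    using lnf_term_bounds[OF assms, of n] by simp
qed

lemma lnf_nonneg: "0 \<le> x \<Longrightarrow> x < 1 \<Longrightarrow> 0 \<le> lnf x"
  unfolding lnf_def by (intro suminf_nonneg summable_lnf lnf_term_bounds)

lemma lnf_mono:
  fixes x y :: real assumes "0 \<le> x" "x \<le> y" "y < 1"
  shows "lnf x \<le> lnf y"
  unfolding lnf_def
proof (intro suminf_le summable_lnf)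
  fix n
  have "x ^ (n + 1) \<le> y ^ (n + 1)" "y ^ (n + 1) \<le> y"
    using assms power_Suc_le_base[of y n] by (auto intro!: power_mono mult_mono)
  then show "- ln (1 - x ^ (n + 1)) \<le> - ln (1 - y ^ (n + 1))" using assms by simp
qed (use assms in auto)

text \<open>The function -ln(1 - x) is convex and vanishes at 0, so shrinking its argument by t
  shrinks its value at least by t; the powers of t beyond the first only help. This is what turns a
  smaller nome into a linear factor in \<open>tail_decay\<close>.\<close>

lemma lnf_scale:
  fixes x :: real assumes "0 \<le> t" "t \<le> 1" "0 \<le> x" "x < 1"
  shows "lnf (t * x) \<le> t * lnf x"
proof -
  have tx: "0 \<le> t * x" "t * x < 1"
    using assms mult_left_le_one_le[of x t] by (auto simp: mult.commute)
  have "lnf (t * x) \<le> (\<Sum>n. t * - ln (1 - x ^ (n + 1)))"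
    unfolding lnf_def
  proof (intro suminf_le summable_lnf tx summable_mult)
    fix n
    define y where "y = x ^ (n + 1)"
    have y: "0 \<le> y" "y < 1"
      using assms power_Suc_le_base[of x n] by (auto simp: y_def simp del: power_Suc)
    have "(t * x) ^ (n + 1) \<le> t * y"
      unfolding y_def power_mult_distrib using assms power_decreasing[of 1 "n + 1" t]
      by (intro mult_right_mono) auto
    moreover have ty: "t * y \<le> y" using assms y mult_left_le_one_le[of y t] by (simp add: mult.commute)
    moreover have "- ln (1 - t * y) \<le> t * - ln (1 - y)"
    proof -
      have "(1 - t) * ln 1 + t * ln (1 - y) \<le> ln ((1 - t) *\<^sub>R 1 + t *\<^sub>R (1 - y))"
        using concave_onD[OF ln_concave, of t 1 "1 - y"] assms y by simp
      moreover have "(1 - t) *\<^sub>R 1 + t *\<^sub>R (1 - y) = 1 - t * y" by (simp add: algebra_simps)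
      ultimately show ?thesis by (simp only: ln_one mult_zero_right add_0 mult_minus_right)
    qed
    ultimately show "- ln (1 - (t * x) ^ (n + 1)) \<le> t * - ln (1 - x ^ (n + 1))"
      unfolding y_def[symmetric] using y
      by (intro order_trans[OF _ \<open>- ln (1 - t * y) \<le> t * - ln (1 - y)\<close>]) auto
  qed (use assms in auto)
  also have "\<dots> = t * lnf x"
    unfolding lnf_def by (intro suminf_mult summable_lnf assms)
  finally show ?thesis .
qed

lemma logf_term_bound:
  fixes q :: complex assumes "norm q \<le> x" "x < 1"
  shows "norm (Ln (1 - q ^ (n + 1))) \<le> - ln (1 - x ^ (n + 1))"
proof -
  have x: "0 \<le> x" using assms(1) norm_ge_zero[of q] by linarith
  have le: "norm (q ^ (n + 1)) \<le> x ^ (n + 1)" "x ^ (n + 1) \<le> x"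
    using assms(1) x power_Suc_le_base[OF x assms(2)] power_mono[of "norm q" x "n + 1"]
    by (auto simp: norm_power norm_mult)
  have "norm (Ln (1 - q ^ (n + 1))) \<le> - ln (1 - norm (q ^ (n + 1)))"
    using le assms(2) by (intro norm_Ln_one_minus_le) linarith
  also have "\<dots> \<le> - ln (1 - x ^ (n + 1))" using le assms(2) by simp
  finally show ?thesis .
qed

lemma summable_logf:
  fixes q :: complex assumes "norm q < 1"
  shows "summable (\<lambda>n. - Ln (1 - q ^ (n + 1)))"
  by (rule summable_comparison_test'[OF summable_lnf[of "norm q"]])
     (use assms logf_term_bound[of q "norm q"] in auto)

lemma norm_logf_le:
  fixes q :: complex assumes "norm q < 1"
  shows "norm (logf q) \<le> lnf (norm q)"
  unfolding logf_def lnf_def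
  by (rule norm_suminf_le[OF _ summable_lnf]) (use assms logf_term_bound[of q "norm q"] in auto)

lemma one_minus_power_nonpos:
  fixes q :: complex assumes "norm q < 1"
  shows "1 - q ^ (n + 1) \<notin> \<real>\<^sub>\<le>\<^sub>0"
proof
  assume "1 - q ^ (n + 1) \<in> \<real>\<^sub>\<le>\<^sub>0"
  then have "1 \<le> Re (q ^ (n + 1))" by (auto simp: complex_nonpos_Reals_iff)
  also have "\<dots> \<le> norm q ^ (n + 1)" by (metis complex_Re_le_cmod norm_power)
  also have "\<dots> \<le> norm q" using assms by (intro power_Suc_le_base) auto
  finally show False using assms by simp
qed

lemma holomorphic_logf: "logf holomorphic_on ball 0 1"
  unfolding logf_def
proof (rule holomorphic_on_suminf)
  show "(\<lambda>q. - Ln (1 - q ^ (n + 1))) holomorphic_on ball 0 1" for n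
    by (intro holomorphic_intros) (use one_minus_power_nonpos in auto)
  fix q :: complex assume q: "q \<in> ball 0 1"
  define d where "d = (1 - norm q) / 2"
  have d: "d > 0" "norm q + d < 1" using q by (auto simp: d_def field_simps)
  have le: "norm z \<le> norm q + d" if "z \<in> cball q d" for z
    using that norm_triangle_ineq[of q "z - q"] by (simp add: dist_norm norm_minus_commute)
  show "\<exists>d>0. cball q d \<subseteq> ball 0 1 \<and> (\<exists>M. summable M \<and>
          (\<forall>n. \<forall>z\<in>cball q d. norm (- Ln (1 - z ^ (n + 1))) \<le> M n))"
  proof (intro exI conjI allI ballI)
    show "summable (\<lambda>n. - ln (1 - (norm q + d) ^ (n + 1)))"
      using d by (intro summable_lnf) auto
    show "norm (- Ln (1 - z ^ (n + 1))) \<le> - ln (1 - (norm q + d) ^ (n + 1))"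
      if "z \<in> cball q d" for z n
      using logf_term_bound[OF le[OF that] d(2), of n] by simp
    show "cball q d \<subseteq> ball 0 1" using le d by fastforce
  qed (use d in auto)
qed auto

lemma exp_logf:
  fixes q :: complex assumes "norm q < 1"
  shows "exp (logf q) = partition_gf q"
proof -
  have "exp (- Ln (1 - q ^ (n + 1))) = 1 / (1 - q ^ (n + 1))" for n
    using one_minus_power_nonpos[OF assms, of n]
    by (subst exp_minus, subst exp_Ln) (auto simp: field_simps)
  then show ?thesis
    unfolding logf_def partition_gf_def prodinf_exp[OF summable_logf[OF assms], symmetric] by simp
qed

lemma exp_lnf:
  fixes x :: real assumes "0 \<le> x" "x < 1"
  shows "exp (lnf x) = partition_gf x"
proof -
  have "exp (- ln (1 - x ^ (n + 1))) = 1 / (1 - x ^ (n + 1))" for n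
    using power_Suc_le_base[OF assms, of n] assms
    by (subst exp_minus, subst exp_ln) (auto simp: field_simps)
  then show ?thesis
    unfolding lnf_def partition_gf_def prodinf_exp[OF summable_lnf[OF assms], symmetric] by simp
qed

lemma partition_gf_powr:
  assumes "0 \<le> x" "x < (1::real)"
  shows "partition_gf x powr d = exp (d * lnf x)"
  by (simp add: exp_lnf[OF assms, symmetric] powr_def)

definition logG :: "nat \<Rightarrow> complex \<Rightarrow> complex" where
  "logG p q = logf (q ^ p) - logf q"

lemma norm_power_less_1: "norm q < 1 \<Longrightarrow> p > 0 \<Longrightarrow> norm (q ^ p :: complex) < 1"
  by (simp add: norm_power power_less_one_iff)

text \<open>The terms of \<open>logf (q ^ p)\<close> are the terms of \<open>logf q\<close> whose index is divisible by \<open>p\<close>, so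
  they cancel.\<close>

lemma norm_logG_le:
  fixes q :: complex assumes "norm q < 1" "p > 0"
  shows "norm (logG p q) \<le> lnf (norm q)"
proof -
  define f where "f = (\<lambda>n. - Ln (1 - q ^ (n + 1)))"
  \<comment> \<open>The term with index n belongs to the exponent n + 1, so \<open>g n\<close> is
    the index of the exponent p(n + 1). In \<open>f' n - f n\<close> the terms with index in
    \<open>range g\<close> vanish and the others are \<open>- f n\<close>, which gives a bound by
    one copy of \<open>lnf\<close> instead of two.\<close>
  define g where "g = (\<lambda>n. p * (n + 1) - 1)"
  define f' where "f' = (\<lambda>n. if n \<in> range g then f n else 0)"
  have sm: "strict_mono g"
    unfolding strict_mono_Suc_iff g_def using assms by auto
  have fg: "- Ln (1 - (q ^ p) ^ (n + 1)) = f' (g n)" for n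
  proof -
    have "g n + 1 = p * (n + 1)" using assms by (simp add: g_def)
    then show ?thesis unfolding f'_def f_def power_mult[symmetric] by (simp del: power_Suc)
  qed
  have "(\<lambda>n. f' (g n)) sums logf (q ^ p)"
    using summable_logf[OF norm_power_less_1[OF assms]] unfolding fg logf_def by (simp add: summable_sums)
  then have "f' sums logf (q ^ p)"
    by (subst (asm) sums_mono_reindex[OF sm]) (auto simp: f'_def)
  moreover have "f sums logf q"
    using summable_logf[OF assms(1)] unfolding f_def logf_def by (simp add: summable_sums)
  ultimately have *: "(\<lambda>n. f' n - f n) sums logG p q"
    unfolding logG_def by (rule sums_diff)
  have "norm (\<Sum>n. f' n - f n) \<le> lnf (norm q)"
    unfolding lnf_def
  proof (rule norm_suminf_le[OF _ summable_lnf])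
    fix n
    have "norm (f n) \<le> - ln (1 - norm q ^ (n + 1))"
      unfolding f_def norm_minus_cancel by (rule logf_term_bound) (use assms in auto)
    then show "norm (f' n - f n) \<le> - ln (1 - norm q ^ (n + 1))"
      using lnf_term_bounds[of "norm q" n] assms by (simp add: f'_def)
  qed (use assms in auto)
  then show ?thesis using * by (simp add: sums_iff)
qed

lemma holomorphic_logG: "p > 0 \<Longrightarrow> logG p holomorphic_on ball 0 1"
  unfolding logG_def
  by (intro holomorphic_intros holomorphic_on_compose_gen[OF _ holomorphic_logf, unfolded o_def]
        holomorphic_logf) (auto simp: norm_power_less_1)

lemma logf_0 [simp]: "logf 0 = 0"
  by (simp add: logf_def)

lemma exp_logG:
  fixes q :: complex assumes "norm q < 1" "p > 0"
  shows "exp (logG p q) = borwein_G p q"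
  unfolding logG_def borwein_G_def exp_diff
  using assms by (simp add: exp_logf norm_power_less_1)

text \<open>Two branches of the logarithm differ by a continuous function with values in 2 pi i
  times the integers. Distinct values are at least 2 pi > 1 apart, so it is constant on the
  connected disc, and it vanishes at 0. This replaces the choice operator by an explicit
  series.\<close>

lemma borwein_log_G_eq:
  assumes "p > 0" "norm q < 1"
  shows "borwein_log_G p q = logG p q"
proof -
  define P where "P L \<longleftrightarrow> L holomorphic_on ball 0 1 \<and> L 0 = 0 \<and>
     (\<forall>q\<in>ball 0 1. exp (L q) = borwein_G p q)" for L
  have "P (logG p)"
    using assms by (auto simp: P_def holomorphic_logG exp_logG) (simp add: logG_def zero_power)
  moreover from this have "P (borwein_log_G p)"
    using someI[of P "logG p"] unfolding borwein_log_G_def P_def by blast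
  ultimately have P: "P (logG p)" "P (borwein_log_G p)" by auto
  define D where "D = (\<lambda>q. borwein_log_G p q - logG p q)"
  have cont: "continuous_on (ball 0 1) D"
    unfolding D_def using P by (intro continuous_intros holomorphic_on_imp_continuous_on) (auto simp: P_def)
  have val: "\<exists>n::int. D q = complex_of_real (2 * of_int n * pi) * \<i>" if "q \<in> ball 0 1" for q
  proof -
    have "exp (borwein_log_G p q) = exp (logG p q)" using P that by (auto simp: P_def)
    then show ?thesis unfolding exp_eq D_def by auto
  qed
  have "D constant_on ball 0 1"
  proof (rule continuous_discrete_range_constant[OF _ cont])
    show "connected (ball 0 1 :: complex set)" by simp
    fix x :: complex assume x: "x \<in> ball 0 1"
    show "\<exists>e>0. \<forall>y. y \<in> ball 0 1 \<and> D y \<noteq> D x \<longrightarrow> e \<le> cmod (D y - D x)"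
    proof (intro exI[of _ 1] conjI allI impI)
      fix y assume y: "y \<in> ball 0 1 \<and> D y \<noteq> D x"
      obtain m n :: int where mn: "D x = complex_of_real (2 * of_int m * pi) * \<i>"
        "D y = complex_of_real (2 * of_int n * pi) * \<i>" using val x y by metis
      have "D y - D x = complex_of_real (2 * pi * of_int (n - m)) * \<i>"
        unfolding mn by (simp add: algebra_simps)
      then have "cmod (D y - D x) = 2 * pi * \<bar>of_int (n - m)\<bar>"
        by (simp only: norm_mult norm_of_real) (simp add: abs_mult)
      moreover have "n \<noteq> m" using y mn by auto
      then have "1 \<le> \<bar>real_of_int (n - m)\<bar>" by linarith
      then have "2 * 1 * 1 \<le> 2 * pi * \<bar>real_of_int (n - m)\<bar>"
        using pi_gt3 by (intro mult_mono) auto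
      ultimately show "1 \<le> cmod (D y - D x)" by simp
    qed simp
  qed
  then have "D q = D 0" using assms by (auto simp: constant_on_def)
  then show ?thesis using P by (simp add: D_def P_def)
qed

section \<open>Iseki's functional equation\<close>

lemma contour_integral_rectpath:
  assumes "continuous_on (path_image (rectpath a1 a3)) f"
  defines "a2 \<equiv> Complex (Re a3) (Im a1)" and "a4 \<equiv> Complex (Re a1) (Im a3)"
  shows "contour_integral (rectpath a1 a3) f =
      contour_integral (linepath a1 a2) f + contour_integral (linepath a2 a3) f
      + contour_integral (linepath a3 a4) f + contour_integral (linepath a4 a1) f" (is ?th1)
    and "f contour_integrable_on linepath a1 a2" (is ?th2)
    and "f contour_integrable_on linepath a2 a3" (is ?th3)
    and "f contour_integrable_on linepath a3 a4" (is ?th4)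
    and "f contour_integrable_on linepath a4 a1" (is ?th5)
proof -
  have "path_image (rectpath a1 a3) = closed_segment a1 a2 \<union> closed_segment a2 a3
      \<union> closed_segment a3 a4 \<union> closed_segment a4 a1"
    by (simp add: rectpath_def Let_def path_image_join a2_def a4_def Un_assoc)
  with assms(1) show i: ?th2 ?th3 ?th4 ?th5
    by (auto intro!: contour_integrable_continuous_linepath elim: continuous_on_subset)
  then show ?th1
    by (simp add: rectpath_def Let_def a2_def[symmetric] a4_def[symmetric] add_ac)
qed

text \<open>$u\,\kappa_a(u) = -\sum_n B_n(a) u^n / n!$, so residues produce Bernoulli polynomials.\<close>

definition kap :: "real \<Rightarrow> complex \<Rightarrow> complex" where
  "kap a u = exp (of_real a * u) / (1 - exp u)"

text \<open>The hypothesis on \<open>exp u\<close> says that Im u is an odd multiple of pi. There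
  the denominator is 1 + e^(Re u) without any cancellation, and it dominates e^(a Re u) for a
  between 0 and 1.\<close>

lemma norm_kap_le_1:
  assumes "0 \<le> a" "a \<le> 1" "exp u = - of_real (exp (Re u))"
  shows "norm (kap a u) \<le> 1"
proof -
  have "norm (1 - exp u) = 1 + exp (Re u)"
    unfolding assms(3) using norm_of_real[of "1 + exp (Re u)", where ?'a = complex] by simp
  moreover have "exp (a * Re u) \<le> 1 + exp (Re u)"
  proof (cases "Re u \<ge> 0")
    case True
    then have "a * Re u \<le> Re u" using assms mult_right_mono[of a 1 "Re u"] by simp
    then have "exp (a * Re u) \<le> exp (Re u)" by simp
    then show ?thesis by linarith
  next
    case False
    then have "a * Re u \<le> 0" using assms by (simp add: mult_nonneg_nonpos)
    then have "exp (a * Re u) \<le> 1" by simp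
    then show ?thesis using exp_gt_zero[of "Re u"] by linarith
  qed
  ultimately show ?thesis
    by (simp add: kap_def norm_divide add_pos_pos)
qed

text \<open>\<open>kap a\<close> decays like e^(-(1-a) Re u) to the right and like e^(-a |Re u|) to
  the left; c is a common lower bound of the two rates.\<close>

lemma norm_kap_le:
  assumes "c \<le> a" "c \<le> 1 - a" "0 < R" "R \<le> \<bar>Re u\<bar>" "0 < c"
  shows "norm (kap a u) \<le> exp (- c * R) / (1 - exp (- R))"
proof (cases "Re u \<ge> 0")
  case True
  then have R: "R \<le> Re u" using assms by simp
  have "norm (kap a u) = exp (a * Re u) / norm (1 - exp u)"
    by (simp add: kap_def norm_divide)
  also have "\<dots> \<le> exp (a * Re u) / (exp (Re u) * (1 - exp (- R)))"
  proof (rule divide_left_mono)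
    have "exp (Re u) - 1 \<le> norm (1 - exp u)"
      using norm_triangle_ineq2[of "exp u" 1] by (simp add: norm_minus_commute)
    moreover have "1 \<le> exp (Re u) * exp (- R)"
      using R by (simp add: exp_add[symmetric] del: exp_minus)
    ultimately show "exp (Re u) * (1 - exp (- R)) \<le> norm (1 - exp u)"
      by (simp add: algebra_simps)
    have "1 < exp (Re u)" using R assms by simp
    then show "0 < norm (1 - exp u) * (exp (Re u) * (1 - exp (- R)))"
      using \<open>exp (Re u) - 1 \<le> _\<close> assms by (intro mult_pos_pos) auto
  qed simp
  also have "\<dots> = exp ((a - 1) * Re u) / (1 - exp (- R))"
    by (simp add: field_simps exp_add[symmetric] exp_diff[symmetric] del: exp_minus)
       (simp add: exp_diff exp_minus field_simps)
  also have "\<dots> \<le> exp (- c * R) / (1 - exp (- R))"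
  proof (rule divide_right_mono)
    have "c * R \<le> (1 - a) * Re u" using assms R by (intro mult_mono) auto
    then show "exp ((a - 1) * Re u) \<le> exp (- c * R)" by (simp add: algebra_simps)
  qed (use assms in auto)
  finally show ?thesis .
next
  case False
  then have R: "Re u \<le> - R" using assms by simp
  have "norm (kap a u) = exp (a * Re u) / norm (1 - exp u)"
    by (simp add: kap_def norm_divide)
  also have "\<dots> \<le> exp (- c * R) / (1 - exp (- R))"
  proof (rule frac_le)
    have "c * R \<le> a * (- Re u)" using assms R by (intro mult_mono) auto
    then show "exp (a * Re u) \<le> exp (- c * R)" by simp
    have "1 - exp (Re u) \<le> norm (1 - exp u)"
      using norm_triangle_ineq2[of 1 "exp u"] by simp
    moreover have "exp (Re u) \<le> exp (- R)" using R by simp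
    ultimately show "1 - exp (- R) \<le> norm (1 - exp u)" by linarith
  qed (use assms in auto)
  finally show ?thesis .
qed

section \<open>Bernoulli polynomials and the residues of Iseki's kernel\<close>

definition B2 :: "real \<Rightarrow> real" where "B2 t = t\<^sup>2 - t + 1/6"

text \<open>A is the expansion of x e^(acx) / (e^(cx) - 1), whose coefficients are B_n(a) c^(n-1) /
  n!. Shifting the denominator by one makes it invertible, and the coefficients follow one after the
  other from A S = e^(acx). \<open>B2\<close> is the second Bernoulli polynomial.\<close>

lemma bernoulli_fps_coeffs:
  fixes c :: complex and a :: real
  assumes "c \<noteq> 0"
  defines "S \<equiv> fps_shift 1 (fps_exp c - 1)"
  defines "A \<equiv> fps_exp (of_real a * c) / S"
  shows "fps_nth A 0 = 1 / c" "fps_nth A 1 = of_real (a - 1/2)" "fps_nth A 2 = of_real (B2 a) * c / 2"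
proof -
  have S: "fps_nth S 0 = c" "fps_nth S 1 = c\<^sup>2 / 2" "fps_nth S 2 = c ^ 3 / 6"
    by (simp_all add: S_def numeral_2_eq_2 fact_reduce eval_nat_numeral)
  have AS: "A * S = fps_exp (of_real a * c)"
    unfolding A_def using S(1) assms(1)
    by (simp add: fps_divide_unit mult.assoc inverse_mult_eq_1)
  have 0: "fps_nth A 0 * c = 1"
    using arg_cong[OF AS, of "\<lambda>F. fps_nth F 0"] S by simp
  then show A0: "fps_nth A 0 = 1 / c" using assms by (simp add: field_simps)
  have 1: "fps_nth A 0 * (c\<^sup>2 / 2) + fps_nth A 1 * c = of_real a * c"
    using arg_cong[OF AS, of "\<lambda>F. fps_nth F 1"]
    by (simp add: fps_mult_nth S(1) S(2)[unfolded One_nat_def])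
  then have "fps_nth A 1 * c = (of_real a - 1 / 2) * c"
    unfolding A0 using assms by (simp add: field_simps power2_eq_square)
  then show A1: "fps_nth A 1 = of_real (a - 1/2)" using assms by simp
  have 2: "fps_nth A 0 * (c ^ 3 / 6) + fps_nth A 1 * (c\<^sup>2 / 2) + fps_nth A 2 * c = (of_real a * c)\<^sup>2 / 2"
    using arg_cong[OF AS, of "\<lambda>F. fps_nth F 2"]
    by (simp add: fps_mult_nth numeral_2_eq_2 atLeast0_atMost_Suc S(1)
          S(2)[unfolded One_nat_def] S(3)[unfolded numeral_2_eq_2])
       (simp add: add_ac)
  have "fps_nth A 2 * c = (of_real (B2 a) * c / 2) * c"
  proof -
    have "fps_nth A 2 * c = (of_real a * c)\<^sup>2 / 2 - 1 / c * (c ^ 3 / 6) - of_real (a - 1/2) * (c\<^sup>2 / 2)"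
      using 2 unfolding A0 A1 by (simp add: eq_diff_eq add_ac)
    also have "\<dots> = (of_real (B2 a) * c / 2) * c"
      using assms(1) by (simp add: B2_def field_simps power2_eq_square power3_eq_cube)
    finally show ?thesis .
  qed
  then show "fps_nth A 2 = of_real (B2 a) * c / 2" using assms by simp
qed

text \<open>The pole has order three: one from each factor and one from 1/x. After multiplication by
  x^3 the function is the product of two Bernoulli generating functions (the two signs in 1 - e^u
  cancel), and the residue is the coefficient of x^2.\<close>

lemma residue_kap_kap_0:
  assumes "c \<noteq> 0" "d \<noteq> 0"
  shows "residue (\<lambda>x. kap a (c * x) * kap b (d * x) / x) 0 =
    (d / c) * of_real (B2 b) / 2 + of_real ((a - 1/2) * (b - 1/2)) + (c / d) * of_real (B2 a) / 2"
proof -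
  define S where "S c = fps_shift 1 (fps_exp c - 1 :: complex fps)" for c
  define s where "s c = (\<lambda>x::complex. if x = 0 then c else (exp (c * x) - 1) / x ^ 1)" for c
  define A where "A a c = fps_exp (complex_of_real a * c) / S c" for a c
  have S: "s c has_fps_expansion S c" if "c \<noteq> 0" for c
    unfolding s_def S_def using that
    by (intro has_fps_expansion_shift fps_expansion_intros) (auto intro!: subdegree_geI dest: arg_cong[of _ _ "\<lambda>F. fps_nth F 1"])
  have A: "(\<lambda>x. exp (of_real a * c * x) / s c x) has_fps_expansion A a c" if "c \<noteq> 0" for a c
    unfolding A_def using that
    by (intro fps_expansion_intros S) (auto simp: S_def)
  let ?g = "\<lambda>x. (exp (of_real a * c * x) / s c x) * (exp (of_real b * d * x) / s d x)"
  have "?g has_fps_expansion A a c * A b d"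
    by (intro fps_expansion_intros A assms)
  from residue_fps_expansion_over_power_at_0[OF this, of 2]
  have "residue (\<lambda>x. ?g x / x ^ 3) 0 = fps_nth (A a c * A b d) 2" by simp
  also have "\<dots> = fps_nth (A a c) 0 * fps_nth (A b d) 2 + fps_nth (A a c) 1 * fps_nth (A b d) 1
      + fps_nth (A a c) 2 * fps_nth (A b d) 0"
    by (simp add: fps_mult_nth numeral_2_eq_2 atLeast0_atMost_Suc)
  also have "\<dots> = (d / c) * of_real (B2 b) / 2 + of_real ((a - 1/2) * (b - 1/2)) + (c / d) * of_real (B2 a) / 2"
    unfolding A_def S_def bernoulli_fps_coeffs[OF assms(1)] bernoulli_fps_coeffs[OF assms(2)]
    by (simp add: mult_ac)
  also have "residue (\<lambda>x. ?g x / x ^ 3) 0 = residue (\<lambda>x. kap a (c * x) * kap b (d * x) / x) 0"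
  proof (rule residue_cong)
    have "(E1 / ((X - 1) / x)) * (E2 / ((Y - 1) / x)) / x ^ 3 = E1 / (1 - X) * (E2 / (1 - Y)) / x"
      if "x \<noteq> 0" for E1 E2 X Y x :: complex
    proof (cases "X = 1 \<or> Y = 1")
      case False
      then have "X - 1 \<noteq> 0" "Y - 1 \<noteq> 0" "1 - X \<noteq> 0" "1 - Y \<noteq> 0" by auto
      with that show ?thesis by (simp add: divide_simps power3_eq_cube) (simp add: algebra_simps)
    qed auto
    then have "?g x / x ^ 3 = kap a (c * x) * kap b (d * x) / x" if "x \<noteq> 0" for x
      using that by (simp only: s_def kap_def if_False power_one_right mult.assoc)
    then show "\<forall>\<^sub>F x in at 0. ?g x / x ^ 3 = kap a (c * x) * kap b (d * x) / x"
      by (intro eventually_at_filter[THEN iffD2] always_eventually) auto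
  qed auto
  finally show ?thesis .
qed

lemma residue_over_exp:
  assumes "f analytic_on {z}" "exp (c * z) = 1" "c \<noteq> 0" "f z \<noteq> 0"
  shows "residue (\<lambda>x. f x / (1 - exp (c * x))) z = - f z / c"
proof -
  obtain r where r: "r > 0" "f holomorphic_on ball z r"
    using assms(1) by (auto simp: analytic_on_def)
  have "residue (\<lambda>x. f x / (1 - exp (c * x))) z = f z / (- c)"
  proof (rule residue_simple_pole_deriv[OF r(2), of "\<lambda>x. 1 - exp (c * x)"])
    show "((\<lambda>x. 1 - exp (c * x)) has_field_derivative - c) (at z)"
      by (rule derivative_eq_intros refl | simp add: assms)+
  qed (use assms r in \<open>auto intro!: holomorphic_intros\<close>)
  then show ?thesis by simp
qed

text \<open>Away from 0 only one of the two factors is singular, with a simple pole. The lemma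
  serves both families of poles of the kernel; at the integers the two factors are swapped before it
  is applied.\<close>

lemma residue_kap_kap_nonzero:
  assumes "exp (c * z) = 1" "exp (d * z) \<noteq> 1" "c \<noteq> 0" "z \<noteq> 0"
  shows "residue (\<lambda>x. kap a (c * x) * kap b (d * x) / x) z =
     - (exp (of_real a * c * z) * kap b (d * z) / (c * z))"
proof -
  let ?f = "\<lambda>x. exp (of_real a * c * x) * kap b (d * x) / x"
  have "residue (\<lambda>x. ?f x / (1 - exp (c * x))) z = - ?f z / c"
    using assms by (intro residue_over_exp) (auto simp: kap_def intro!: analytic_intros)
  then show ?thesis by (simp add: kap_def mult_ac)
qed

abbreviation tpi :: complex where
  "tpi \<equiv> of_real (2 * pi) * \<i>"

text \<open>The kernel below has residues that are, up to sign, such terms at the integers and, with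
  the roles of \<open>a\<close> and \<open>b\<close> exchanged, at the multiples of \<open>\<i> / y\<close>.\<close>

definition iseki_term :: "real \<Rightarrow> real \<Rightarrow> real \<Rightarrow> complex \<Rightarrow> complex" where
  "iseki_term a b y m = exp (tpi * of_real b * m) * kap a (of_real (- 2 * pi * y) * m) / m"

definition iseki_kernel :: "real \<Rightarrow> real \<Rightarrow> real \<Rightarrow> complex \<Rightarrow> complex" where
  "iseki_kernel a b y x = kap a (of_real (- 2 * pi * y) * x) * kap b (tpi * x) / x"

lemma exp_2pi_i_eq_1_iff: "exp (tpi * x) = 1 \<longleftrightarrow> (\<exists>n::int. x = of_int n)"
proof
  assume "exp (tpi * x) = 1"
  then obtain n :: int where "Re (tpi * x) = 0" "Im (tpi * x) = of_int (2 * n) * pi"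
    by (auto simp: exp_eq_1)
  then have "Im x = 0" "Re x = of_int n" by auto
  then show "\<exists>n::int. x = of_int n" by (auto simp: complex_eq_iff)
next
  assume "\<exists>n::int. x = of_int n"
  then show "exp (tpi * x) = 1"
    by (auto simp: exp_eq_1)
qed

lemma exp_real_2pi_eq_1_iff:
  assumes "y > 0"
  shows "exp (of_real (- 2 * pi * y) * x) = 1 \<longleftrightarrow> (\<exists>n::int. x = of_int n * (\<i> / of_real y))"
proof -
  have "of_real (- 2 * pi * y) * x = tpi * (\<i> * of_real y * x)"
    by simp
  then have "exp (of_real (- 2 * pi * y) * x) = 1 \<longleftrightarrow> (\<exists>n::int. \<i> * of_real y * x = of_int n)"
    by (simp only: exp_2pi_i_eq_1_iff)
  also have "\<dots> \<longleftrightarrow> (\<exists>n::int. x = of_int n * (\<i> / of_real y))"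
  proof -
    have "\<i> * of_real y * x = of_int n \<longleftrightarrow> x = of_int (- n) * (\<i> / of_real y)" for n :: int
    proof
      assume *: "\<i> * of_real y * x = of_int n"
      have "x = - (\<i> * of_real y * x) * (\<i> / of_real y)"
        using assms by (simp add: mult.commute[of x])
      then show "x = of_int (- n) * (\<i> / of_real y)" unfolding * by simp
    qed (use assms in \<open>simp add: mult_ac\<close>)
    then show ?thesis by (metis minus_minus)
  qed
  finally show ?thesis .
qed

lemma residue_iseki_kernel_0:
  assumes "y > 0"
  shows "tpi * residue (iseki_kernel a b y) 0 =
    of_real (- pi * y * B2 a + pi / y * B2 b) + tpi * of_real ((a - 1/2) * (b - 1/2))"
proof -
  have "residue (iseki_kernel a b y) 0 = (tpi / of_real (- 2 * pi * y)) * of_real (B2 b) / 2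
     + of_real ((a - 1/2) * (b - 1/2)) + (of_real (- 2 * pi * y) / tpi) * of_real (B2 a) / 2"
    unfolding iseki_kernel_def using assms by (intro residue_kap_kap_0) auto
  also have "tpi / of_real (- 2 * pi * y) = - \<i> / of_real y"
    using assms by (simp add: field_simps)
  also have "of_real (- 2 * pi * y) / tpi = \<i> * of_real y"
    using assms by (simp add: field_simps)
  finally have eq: "residue (iseki_kernel a b y) 0 = - \<i> / of_real y * of_real (B2 b) / 2 +
      of_real ((a - 1/2) * (b - 1/2)) + \<i> * of_real y * of_real (B2 a) / 2" .
  have "2 * P * \<i> * (- \<i> / Y * b2 / 2 + r + \<i> * Y * a2 / 2) = - P * Y * a2 + P / Y * b2 + 2 * P * \<i> * r"
    for P Y a2 b2 r :: complex
    by (simp add: algebra_simps)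
  from this[of "of_real pi" "of_real y"] show ?thesis unfolding eq by simp
qed

lemma exp_2pi_i_of_int [simp]: "exp (tpi * of_int m) = 1"
  by (subst exp_2pi_i_eq_1_iff) auto

lemma exp_real_2pi_of_int:
  "y > 0 \<Longrightarrow> exp (of_real (- 2 * pi * y) * (of_int m * (\<i> / of_real y))) = 1"
  by (subst exp_real_2pi_eq_1_iff) auto

lemma residue_iseki_kernel_int:
  fixes m :: int assumes "m \<noteq> 0" "y > 0"
  shows "tpi * residue (iseki_kernel a b y) (of_int m) = - iseki_term a b y (of_int m)"
proof -
  have ne: "exp (of_real (- 2 * pi * y) * of_int m) \<noteq> (1 :: complex)"
  proof
    assume "exp (of_real (- 2 * pi * y) * of_int m) = (1 :: complex)"
    then obtain n :: int where "(of_int m :: complex) = of_int n * (\<i> / of_real y)"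
      by (subst (asm) exp_real_2pi_eq_1_iff) (use assms in auto)
    from arg_cong[OF this, of Re] show False using assms by simp
  qed
  have "iseki_kernel a b y = (\<lambda>x. kap b (tpi * x) * kap a (of_real (- 2 * pi * y) * x) / x)"
    by (rule ext) (simp add: iseki_kernel_def mult_ac)
  then have "residue (iseki_kernel a b y) (of_int m) =
     - (exp (of_real b * tpi * of_int m) * kap a (of_real (- 2 * pi * y) * of_int m) / (tpi * of_int m))"
    using ne assms exp_2pi_i_of_int[of m]
    by (simp only:) (rule residue_kap_kap_nonzero; simp)
  then show ?thesis using assms by (simp add: iseki_term_def mult_ac)
qed

lemma residue_iseki_kernel_imag:
  fixes m :: int assumes "m \<noteq> 0" "y > 0"
  shows "tpi * residue (iseki_kernel a b y) (of_int m * (\<i> / of_real y)) = iseki_term b (- a) (1 / y) (of_int m)"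
proof -
  have ne: "exp (tpi * (of_int m * (\<i> / of_real y))) \<noteq> (1 :: complex)"
  proof
    assume "exp (tpi * (of_int m * (\<i> / of_real y))) = (1 :: complex)"
    then obtain n :: int where "(of_int m * (\<i> / of_real y) :: complex) = of_int n"
      by (subst (asm) exp_2pi_i_eq_1_iff) auto
    from arg_cong[OF this, of Im] show False using assms by simp
  qed
  have "residue (iseki_kernel a b y) (of_int m * (\<i> / of_real y)) =
     - (exp (of_real a * of_real (- 2 * pi * y) * (of_int m * (\<i> / of_real y))) * kap b (tpi * (of_int m * (\<i> / of_real y)))
        / (of_real (- 2 * pi * y) * (of_int m * (\<i> / of_real y))))"
    unfolding iseki_kernel_def using ne assms exp_real_2pi_of_int[of y m]
    by (intro residue_kap_kap_nonzero) auto
  then show ?thesis using assms by (simp add: iseki_term_def field_simps)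
qed

lemma iseki_residue_sum:
  fixes N :: nat
  assumes y: "y > 0"
  defines "c \<equiv> Complex (real N + 1/2) ((real N + 1/2) / y)"
  shows "contour_integral (rectpath (- c) c) (iseki_kernel a b y) =
    tpi * residue (iseki_kernel a b y) 0
    - (\<Sum>m=1..N. iseki_term a b y (of_nat m) + iseki_term a b y (- of_nat m))
    + (\<Sum>m=1..N. iseki_term b (- a) (1 / y) (of_nat m) + iseki_term b (- a) (1 / y) (- of_nat m))"
proof -
  define I :: "int set" where "I = {-int N..int N} - {0}"
  define P1 :: "complex set" where "P1 = of_int ` I"
  define P2 :: "complex set" where "P2 = (\<lambda>m. of_int m * (\<i> / of_real y)) ` I"
  define pts where "pts = insert 0 (P1 \<union> P2)"
  \<comment> \<open>3/4 lies strictly between 1/2 and 1: the open box S contains the closed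
    rectangle, but no pole beyond those in \<open>pts\<close>.\<close>
  define e where "e = Complex (real N + 3/4) ((real N + 3/4) / y)"
  define S where "S = box (- e) e"
  have fin: "finite I" by (simp add: I_def)
  have disj: "P1 \<inter> P2 = {}" "0 \<notin> P1" "0 \<notin> P2"
    using y by (auto simp: P1_def P2_def I_def complex_eq_iff)
  have inbox: "x \<in> box (- Complex r (r / y)) (Complex r (r / y)) \<longleftrightarrow> \<bar>Re x\<bar> < r \<and> \<bar>Im x\<bar> < r / y" for x r
    by (auto simp: in_box_complex_iff abs_less_iff)
  have incbox: "x \<in> cbox (- Complex r (r / y)) (Complex r (r / y)) \<longleftrightarrow> \<bar>Re x\<bar> \<le> r \<and> \<bar>Im x\<bar> \<le> r / y" for x r
    by (auto simp: in_cbox_complex_iff abs_le_iff)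
  have I_abs: "m \<in> I \<Longrightarrow> \<bar>real_of_int m\<bar> < real N + 1/2" for m
    by (auto simp: I_def)
  have pts_box: "pts \<subseteq> box (- c) c"
    using y I_abs unfolding c_def pts_def P1_def P2_def
    by (auto simp: inbox abs_mult divide_strict_right_mono)
  have cbox_S: "cbox (- c) c \<subseteq> S"
  proof
    fix x assume "x \<in> cbox (- c) c"
    then have "\<bar>Re x\<bar> \<le> real N + 1/2" "\<bar>Im x\<bar> \<le> (real N + 1/2) / y" unfolding c_def incbox by auto
    moreover have "(real N + 1/2) / y < (real N + 3/4) / y" using y by (intro divide_strict_right_mono) auto
    ultimately show "x \<in> S" unfolding S_def e_def inbox by auto
  qed
  have in_pts: "x \<in> pts" if x: "x \<in> S" and or: "x = 0 \<or> exp (of_real (- 2 * pi * y) * x) = 1 \<or> exp (tpi * x) = 1" for x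
  proof -
    have xS: "\<bar>Re x\<bar> < real N + 3/4" "\<bar>Im x\<bar> < (real N + 3/4) / y" using x unfolding S_def e_def inbox by auto
    consider "x = 0" | n :: int where "x = of_int n" | n :: int where "x = of_int n * (\<i> / of_real y)"
      using or unfolding exp_2pi_i_eq_1_iff exp_real_2pi_eq_1_iff[OF y] by blast
    then show ?thesis
    proof cases
      case 2
      then have "\<bar>of_int n\<bar> < real N + 3/4" using xS by simp
      then have "\<bar>n\<bar> \<le> int N" by linarith
      then have "n = 0 \<or> n \<in> I" by (auto simp: I_def)
      then show ?thesis using 2 by (auto simp: pts_def P1_def)
    next
      case 3
      then have "\<bar>of_int n\<bar> / y < (real N + 3/4) / y" using xS y by (simp add: abs_mult)
      then have "\<bar>of_int n\<bar> < real N + 3/4" using y by (simp add: divide_less_cancel)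
      then have "\<bar>n\<bar> \<le> int N" by linarith
      then have "n = 0 \<or> n \<in> I" by (auto simp: I_def)
      then show ?thesis using 3 by (auto simp: pts_def P2_def)
    qed (simp add: pts_def)
  qed
  have sum_I: "(\<Sum>m\<in>I. f (of_int m)) = (\<Sum>m=1..N. f (of_nat m) + f (- of_nat m))" for f :: "complex \<Rightarrow> complex"
  proof -
    have I: "I = int ` {1..N} \<union> (\<lambda>m. - int m) ` {1..N}"
    proof (intro equalityI subsetI)
      fix m assume m: "m \<in> I"
      show "m \<in> int ` {1..N} \<union> (\<lambda>m. - int m) ` {1..N}"
      proof (cases "m > 0")
        case True then show ?thesis using m by (auto simp: I_def image_iff intro!: bexI[of _ "nat m"])
      next
        case False then show ?thesis using m by (auto simp: I_def image_iff intro!: bexI[of _ "nat (- m)"])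
      qed
    qed (auto simp: I_def)
    show ?thesis
      unfolding I by (subst sum.union_disjoint) (auto simp: sum.reindex inj_on_def o_def sum.distrib)
  qed
  have le: "Re (- c) \<le> Re c" "Im (- c) \<le> Im c" using y by (auto simp: c_def)
  have lt: "Re (- c) < Re c" "Im (- c) < Im c" using y by (auto simp: c_def)
  have pim: "path_image (rectpath (- c) c) = cbox (- c) c - box (- c) c"
    using path_image_rectpath_cbox_minus_box[OF le] .
  have "contour_integral (rectpath (- c) c) (iseki_kernel a b y) =
      tpi * (\<Sum>x\<in>pts. winding_number (rectpath (- c) c) x * residue (iseki_kernel a b y) x)"
  proof (rule Residue_theorem[of S])
    show "open S" "connected S" unfolding S_def by (auto intro: convex_connected)
    show "finite pts" unfolding pts_def P1_def P2_def using fin by auto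
    show "iseki_kernel a b y holomorphic_on S - pts"
      unfolding iseki_kernel_def kap_def using in_pts by (auto intro!: holomorphic_intros)
    show "path_image (rectpath (- c) c) \<subseteq> S - pts" using pim cbox_S pts_box by auto
    show "\<forall>z. z \<notin> S \<longrightarrow> winding_number (rectpath (- c) c) z = 0"
      using cbox_S le by (auto intro!: winding_number_rectpath_outside)
  qed auto
  also have "\<dots> = (\<Sum>x\<in>pts. tpi * residue (iseki_kernel a b y) x)"
    unfolding sum_distrib_left using pts_box
    by (intro sum.cong) (auto simp: winding_number_rectpath)
  also have "\<dots> = tpi * residue (iseki_kernel a b y) 0
      + (\<Sum>x\<in>P1. tpi * residue (iseki_kernel a b y) x)
      + (\<Sum>x\<in>P2. tpi * residue (iseki_kernel a b y) x)"
    unfolding pts_def using fin disj by (simp add: P1_def P2_def sum.union_disjoint)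
  also have "(\<Sum>x\<in>P1. tpi * residue (iseki_kernel a b y) x) = (\<Sum>m\<in>I. - iseki_term a b y (of_int m))"
    unfolding P1_def using y
    by (subst sum.reindex, force simp: inj_on_def, unfold o_def, intro sum.cong refl residue_iseki_kernel_int)
       (auto simp: I_def)
  also have "(\<Sum>x\<in>P2. tpi * residue (iseki_kernel a b y) x) = (\<Sum>m\<in>I. iseki_term b (- a) (1 / y) (of_int m))"
    unfolding P2_def using y
    by (subst sum.reindex, force simp: inj_on_def, unfold o_def, intro sum.cong refl residue_iseki_kernel_imag)
       (auto simp: I_def)
  finally show ?thesis by (simp only: sum_negf sum_I diff_conv_add_uminus)
qed

section \<open>Decay of the kernel on the growing rectangles\<close>

lemma rectpath_frame:
  assumes "Re c > 0" "Im c > 0" "x \<in> path_image (rectpath (- c) c)"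
  shows "(\<bar>Re x\<bar> = Re c \<and> \<bar>Im x\<bar> \<le> Im c) \<or> (\<bar>Im x\<bar> = Im c \<and> \<bar>Re x\<bar> \<le> Re c)"
  using assms path_image_rectpath[of "- c" c]
  by (auto simp: abs_le_iff)

lemma sin_cos_half_odd:
  assumes "\<bar>t\<bar> = real N + 1/2"
  shows "sin (2 * (pi * t)) = 0" "cos (2 * (pi * t)) = - 1"
proof -
  have eq: "2 * (pi * \<bar>t\<bar>) = real (2 * N + 1) * pi"
    unfolding assms by (simp add: algebra_simps)
  have "sin (2 * (pi * \<bar>t\<bar>)) = 0" "cos (2 * (pi * \<bar>t\<bar>)) = - 1"
    unfolding eq by (simp_all only: sin_npi cos_npi) simp
  then show "sin (2 * (pi * t)) = 0" "cos (2 * (pi * t)) = - 1"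
    by (cases "t \<ge> 0"; simp)+
qed

text \<open>On a vertical side Re x is a half-integer, so e^(2 pi i x) is a negative real number and
  the second factor is at most 1, while the first one decays with the distance from the imaginary
  axis. On a horizontal side the two factors exchange these roles.\<close>

lemma norm_iseki_kernel_vertical:
  assumes ab: "0 < \<mu>" "\<mu> \<le> a" "\<mu> \<le> 1 - a" "\<mu> \<le> b" "\<mu> \<le> 1 - b" and y: "y > 0"
    and x: "\<bar>Re x\<bar> = real N + 1/2"
  shows "norm (iseki_kernel a b y x) \<le>
     exp (- \<mu> * (2 * pi * y * (real N + 1/2))) / (1 - exp (- (2 * pi * y * (real N + 1/2)))) / (real N + 1/2)"
proof -
  define X where "X = real N + 1/2"
  have X: "X > 0" by (simp add: X_def)
  have Re: "\<bar>Re (of_real (- 2 * pi * y) * x)\<bar> = 2 * pi * y * X"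
    using x y by (simp add: abs_mult X_def)
  have nn: "0 \<le> exp (- \<mu> * (2 * pi * y * X)) / (1 - exp (- (2 * pi * y * X)))"
    using X y by (intro divide_nonneg_nonneg) auto
  note sin_cos_half_odd[OF x]
  then have "norm (kap b (tpi * x)) \<le> 1"
    using ab by (intro norm_kap_le_1) (auto simp: complex_eq_iff Re_exp Im_exp mult.assoc)
  moreover have "norm (kap a (of_real (- 2 * pi * y) * x)) \<le>
      exp (- \<mu> * (2 * pi * y * X)) / (1 - exp (- (2 * pi * y * X)))"
    using ab y X Re by (intro norm_kap_le) auto
  ultimately have P: "norm (kap a (of_real (- 2 * pi * y) * x)) * norm (kap b (tpi * x)) \<le>
      exp (- \<mu> * (2 * pi * y * X)) / (1 - exp (- (2 * pi * y * X))) * 1"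
    by (intro mult_mono nn norm_ge_zero zero_le_one)
  have Q: "X \<le> norm x" using abs_Re_le_cmod[of x] x by (simp add: X_def)
  show ?thesis
    unfolding iseki_kernel_def norm_divide norm_mult[of "kap _ _"] X_def[symmetric]
    by (rule frac_le) (use P Q X y nn in \<open>simp_all only: mult_1 mult_1_right divide_pos_pos\<close>)
qed

lemma norm_iseki_kernel_horizontal:
  assumes ab: "0 < \<mu>" "\<mu> \<le> a" "\<mu> \<le> 1 - a" "\<mu> \<le> b" "\<mu> \<le> 1 - b" and y: "y > 0"
    and x: "\<bar>Im x\<bar> = (real N + 1/2) / y"
  shows "norm (iseki_kernel a b y x) \<le>
     exp (- \<mu> * (2 * pi / y * (real N + 1/2))) / (1 - exp (- (2 * pi / y * (real N + 1/2)))) / ((real N + 1/2) / y)"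
proof -
  define X where "X = real N + 1/2"
  have X: "X > 0" by (simp add: X_def)
  have Re: "\<bar>Re (tpi * x)\<bar> = 2 * pi / y * X"
    using x y by (simp add: abs_mult X_def)
  have nn: "0 \<le> exp (- \<mu> * (2 * pi / y * X)) / (1 - exp (- (2 * pi / y * X)))"
    using X y by (intro divide_nonneg_nonneg) auto
  have "\<bar>y * Im x\<bar> = real N + 1/2" using x y by (simp add: abs_mult)
  note sin_cos_half_odd[OF this]
  then have "norm (kap a (of_real (- 2 * pi * y) * x)) \<le> 1"
    using ab by (intro norm_kap_le_1) (auto simp: complex_eq_iff Re_exp Im_exp mult.assoc)
  moreover have "norm (kap b (tpi * x)) \<le>
      exp (- \<mu> * (2 * pi / y * X)) / (1 - exp (- (2 * pi / y * X)))"
    using ab y X Re by (intro norm_kap_le) auto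
  ultimately have P: "norm (kap a (of_real (- 2 * pi * y) * x)) * norm (kap b (tpi * x)) \<le>
      1 * (exp (- \<mu> * (2 * pi / y * X)) / (1 - exp (- (2 * pi / y * X))))"
    by (intro mult_mono nn norm_ge_zero zero_le_one)
  have Q: "X / y \<le> norm x" using abs_Im_le_cmod[of x] x by (simp add: X_def)
  show ?thesis
    unfolding iseki_kernel_def norm_divide norm_mult[of "kap _ _"] X_def[symmetric]
    by (rule frac_le) (use P Q X y nn in \<open>simp_all only: mult_1 mult_1_right divide_pos_pos\<close>)
qed

lemma exp_quotient_tendsto_0:
  assumes "k > 0" "\<mu> > (0::real)"
  shows "(\<lambda>N. exp (- \<mu> * (k * (real N + 1/2))) / (1 - exp (- (k * (real N + 1/2))))) \<longlonglongrightarrow> 0"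
proof -
  have e: "exp (- \<mu> * (k * (real N + 1/2))) = exp (- \<mu> * k / 2) * exp (- \<mu> * k) ^ N" for \<mu> N
    by (simp add: exp_of_nat_mult[symmetric] exp_add[symmetric] algebra_simps)
  have "(\<lambda>N. exp (- \<mu> * k / 2) * exp (- \<mu> * k) ^ N) \<longlonglongrightarrow> exp (- \<mu> * k / 2) * 0" if "\<mu> > 0" for \<mu>
    using that assms by (intro tendsto_intros LIMSEQ_realpow_zero) auto
  then have "(\<lambda>N. exp (- \<mu> * (k * (real N + 1/2)))) \<longlonglongrightarrow> 0" if "\<mu> > 0" for \<mu>
    using that unfolding e by simp
  from tendsto_divide[OF this[OF assms(2)] tendsto_diff[OF tendsto_const[of 1] this[of 1]]]
  show ?thesis by simp
qed

text \<open>The factor 1/x of the kernel compensates the length of the sides, which is proportional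
  to N + 1/2; what remains is the exponential decay of one \<open>kap\<close> factor.\<close>

lemma iseki_contour_tendsto_0:
  assumes ab: "0 < a" "a < 1" "0 < b" "b < 1" and y: "y > 0"
  defines "c \<equiv> \<lambda>N. Complex (real N + 1/2) ((real N + 1/2) / y)"
  shows "(\<lambda>N. contour_integral (rectpath (- c N) (c N)) (iseki_kernel a b y)) \<longlonglongrightarrow> 0"
proof -
  define \<mu> where "\<mu> = min (min a (1 - a)) (min b (1 - b))"
  have mu: "0 < \<mu>" "\<mu> \<le> a" "\<mu> \<le> 1 - a" "\<mu> \<le> b" "\<mu> \<le> 1 - b" using ab by (auto simp: \<mu>_def)
  define V where "V k N = exp (- \<mu> * (k * (real N + 1/2))) / (1 - exp (- (k * (real N + 1/2))))" for k and N :: nat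
  show ?thesis
  proof (rule Lim_null_comparison)
    show "(\<lambda>N. 4 / y * V (2 * pi * y) N + 4 * y * V (2 * pi / y) N) \<longlonglongrightarrow> 0"
      unfolding V_def using mu y
      by (intro tendsto_add_zero tendsto_mult_right_zero exp_quotient_tendsto_0) auto
    show "\<forall>\<^sub>F N in sequentially. norm (contour_integral (rectpath (- c N) (c N)) (iseki_kernel a b y))
         \<le> 4 / y * V (2 * pi * y) N + 4 * y * V (2 * pi / y) N"
    proof (intro always_eventually allI)
      fix N
      define X where "X = real N + 1/2"
      have X: "X > 0" by (simp add: X_def)
      have cN: "c N = Complex X (X / y)" by (simp add: c_def X_def)
      \<comment> \<open>The half-integral size keeps the sides away from the integers and from the
        multiples of i/y, so the kernel is continuous on them.\<close>
      have noint: "\<bar>of_int n\<bar> \<noteq> X" for n :: int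
      proof
        assume "\<bar>of_int n\<bar> = X"
        then have "real_of_int (2 * \<bar>n\<bar>) = of_int (2 * int N + 1)" by (simp add: X_def)
        then show False by presburger
      qed
      have V: "0 \<le> V k N" if "k > 0" for k using that unfolding V_def by auto
      have cont: "continuous_on (path_image (rectpath (- c N) (c N))) (iseki_kernel a b y)"
      proof -
        have "x \<noteq> 0 \<and> exp (of_real (- 2 * pi * y) * x) \<noteq> 1 \<and> exp (tpi * x) \<noteq> 1"
          if "x \<in> path_image (rectpath (- c N) (c N))" for x
        proof -
          have fr: "\<bar>Re x\<bar> = X \<or> \<bar>Im x\<bar> = X / y"
            using rectpath_frame[OF _ _ that] X y by (auto simp: cN)
          have "x \<noteq> of_int n" "x \<noteq> of_int n * (\<i> / of_real y)" for n :: int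
            using fr noint[of n] X y by (auto simp: abs_mult)
          then show ?thesis
            unfolding exp_2pi_i_eq_1_iff exp_real_2pi_eq_1_iff[OF y] using fr X y by auto
        qed
        then show ?thesis
          unfolding iseki_kernel_def kap_def by (intro continuous_intros) auto
      qed
      note ci = contour_integral_rectpath[OF cont, unfolded cN]
      have vert: "norm (contour_integral (linepath u v) (iseki_kernel a b y)) \<le> 2 / y * V (2 * pi * y) N"
        if "iseki_kernel a b y contour_integrable_on linepath u v" "Re u = Re v" "\<bar>Re v\<bar> = X" "\<bar>Im u - Im v\<bar> = 2 * X / y" for u v
      proof -
        have "norm (contour_integral (linepath u v) (iseki_kernel a b y)) \<le> V (2 * pi * y) N / X * norm (v - u)"
          using that norm_iseki_kernel_vertical[OF mu y] V[of "2 * pi * y"] X y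
          by (intro contour_integral_bound_linepath)
             (auto simp: closed_segment_same_Re V_def X_def intro!: divide_nonneg_nonneg)
        also have "norm (v - u) = 2 * X / y"
          using that by (simp add: norm_complex_def cmod_def abs_minus_commute)
        finally show ?thesis using X by (simp add: field_simps)
      qed
      have horiz: "norm (contour_integral (linepath u v) (iseki_kernel a b y)) \<le> 2 * y * V (2 * pi / y) N"
        if "iseki_kernel a b y contour_integrable_on linepath u v" "Im u = Im v" "\<bar>Im v\<bar> = X / y" "\<bar>Re u - Re v\<bar> = 2 * X" for u v
      proof -
        have "norm (contour_integral (linepath u v) (iseki_kernel a b y)) \<le> V (2 * pi / y) N / (X / y) * norm (v - u)"
          using that norm_iseki_kernel_horizontal[OF mu y] V[of "2 * pi / y"] X y
          by (intro contour_integral_bound_linepath)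
             (auto simp: closed_segment_same_Im V_def X_def intro!: divide_nonneg_nonneg)
        also have "norm (v - u) = 2 * X"
          using that by (simp add: norm_complex_def cmod_def abs_minus_commute)
        finally show ?thesis using X y by (simp add: field_simps)
      qed
      have tri: "norm (p + q + r + s) \<le> P + Q + P + Q"
        if "norm q \<le> Q" "norm s \<le> Q" "norm p \<le> P" "norm r \<le> P" for p q r s :: complex and P Q
        using norm_triangle_ineq[of "p + q + r" s] norm_triangle_ineq[of "p + q" r] norm_triangle_ineq[of p q] that by linarith
      have "norm (contour_integral (rectpath (- c N) (c N)) (iseki_kernel a b y)) \<le>
        2 * y * V (2 * pi / y) N + 2 / y * V (2 * pi * y) N + 2 * y * V (2 * pi / y) N + 2 / y * V (2 * pi * y) N"
        unfolding cN ci(1) using X y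
        by (intro tri vert horiz ci(2-5)) (auto simp: field_simps)
      then show "norm (contour_integral (rectpath (- c N) (c N)) (iseki_kernel a b y))
         \<le> 4 / y * V (2 * pi * y) N + 4 * y * V (2 * pi / y) N" by (simp add: algebra_simps)
    qed
  qed
qed

section \<open>Logarithms of infinite products and Iseki's equation\<close>

abbreviation J_nome :: "real \<Rightarrow> real \<Rightarrow> real \<Rightarrow> nat \<Rightarrow> complex" where
  "J_nome a b y r \<equiv> exp (tpi * of_real b - of_real (2 * pi * y * (a + real r)))"

text \<open>The logarithm of the product of 1/(1 - e^(2 pi i b - 2 pi y (a + r))) over r \<ge> 0.
  For a = 1 and b = 0 it is \<open>logf\<close> at e^(-2 pi y); rational a and b with denominator k
  give the part of \<open>logf\<close> over one residue class modulo k.\<close>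

definition J :: "real \<Rightarrow> real \<Rightarrow> real \<Rightarrow> complex" where
  "J a b y = (\<Sum>r. - Ln (1 - J_nome a b y r))"

text \<open>Tannery's theorem for the partial sums in m: they are dominated, uniformly in n, by
  \<open>suminf A * B r\<close>.\<close>

lemma sums_swap:
  fixes f :: "nat \<Rightarrow> nat \<Rightarrow> 'a :: {real_normed_algebra, banach}"
  assumes A: "summable A" "\<And>m. 0 \<le> A m" and B: "summable B" "\<And>r. 0 \<le> B r"
    and le: "\<And>m r. norm (f m r) \<le> A m * B r"
    and g: "\<And>m. (\<lambda>r. f m r) sums g m" and h: "\<And>r. (\<lambda>m. f m r) sums h r"
  shows "g sums suminf h"
proof -
  have eq: "(\<Sum>m<n. g m) = (\<Sum>r. \<Sum>m<n. f m r)" for n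
    using sums_sum[of "{..<n}" f g] g by (simp add: sums_iff)
  have "(\<lambda>n. \<Sum>r. \<Sum>m<n. f m r) \<longlonglongrightarrow> suminf h"
  proof (rule tannerys_theorem[THEN conjunct2, THEN conjunct2])
    show "(\<lambda>n. \<Sum>m<n. f m r) \<longlonglongrightarrow> h r" for r using h[of r] by (simp add: sums_def)
    show "summable (\<lambda>r. suminf A * B r)" by (intro summable_mult B)
    have "norm (\<Sum>m<n. f m r) \<le> suminf A * B r" for n r
    proof -
      have "norm (\<Sum>m<n. f m r) \<le> (\<Sum>m<n. A m * B r)" by (intro sum_norm_le le)
      also have "\<dots> = (\<Sum>m<n. A m) * B r" by (simp add: sum_distrib_right)
      also have "\<dots> \<le> suminf A * B r" by (intro mult_right_mono sum_le_suminf A B) auto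
      finally show ?thesis .
    qed
    then show "\<forall>\<^sub>F (r, n) in at_top \<times>\<^sub>F sequentially. norm (\<Sum>m<n. f m r) \<le> suminf A * B r"
      by (intro always_eventually) auto
  qed auto
  then show ?thesis by (simp add: sums_def eq)
qed

lemma norm_exp_J:
  "norm (J_nome a b y r) = exp (- 2 * pi * y * (a + real r))"
  by (simp add: norm_exp_eq_Re)

text \<open>Expand every logarithm in J into its power series in m. For fixed m the sum over r is
  geometric, and its closed form is exactly the factor \<open>kap\<close> in
  \<open>iseki_term\<close>.\<close>

lemma iseki_term_sums_J:
  assumes a: "a > 0" and y: "y > 0"
  shows "(\<lambda>m. iseki_term a b y (of_nat (Suc m))) sums J a b y"
  unfolding J_def
proof (rule sums_swap)
  define w where "w r = J_nome a b y r" for r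
  define \<alpha> where "\<alpha> = exp (- 2 * pi * y * a)"
  define \<beta> where "\<beta> = exp (- 2 * pi * y)"
  have ab: "0 \<le> \<alpha>" "\<alpha> < 1" "0 \<le> \<beta>" "\<beta> < 1" using a y by (auto simp: \<alpha>_def \<beta>_def)
  show "summable (\<lambda>m. \<alpha> ^ Suc m)" "summable (\<lambda>r. \<beta> ^ r)"
    using ab by (auto intro!: summable_geometric summable_mult)
  show "0 \<le> \<alpha> ^ Suc m" "0 \<le> \<beta> ^ r" for m r using ab by auto
  have nw: "norm (w r) = \<alpha> * \<beta> ^ r" for r
    unfolding w_def norm_exp_J \<alpha>_def \<beta>_def
    by (simp add: exp_of_nat_mult[symmetric] exp_add[symmetric] algebra_simps)
  have nw1: "norm (w r) < 1" for r
    using ab power_le_one[of \<beta> r] mult_le_one[of "\<beta> ^ r" 1] unfolding nw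
    by (intro le_less_trans[OF mult_left_le[of "\<beta> ^ r" \<alpha>]]) auto
  show "norm (w r ^ Suc m / of_nat (Suc m)) \<le> \<alpha> ^ Suc m * \<beta> ^ r" for m r
  proof -
    have "norm (w r ^ Suc m / of_nat (Suc m)) \<le> norm (w r) ^ Suc m"
      unfolding norm_divide norm_power norm_of_nat using divide_left_mono[of 1 "real (Suc m)" "norm (w r) ^ Suc m"]
      by (simp del: power_Suc)
    also have "\<dots> = \<alpha> ^ Suc m * (\<beta> ^ r) ^ Suc m" unfolding nw by (rule power_mult_distrib)
    also have "\<dots> \<le> \<alpha> ^ Suc m * \<beta> ^ r"
      using ab power_decreasing[of 1 "Suc m" "\<beta> ^ r"]
      by (intro mult_left_mono) (simp_all add: power_le_one del: power_Suc)
    finally show ?thesis .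
  qed
  show "(\<lambda>m. w r ^ Suc m / of_nat (Suc m)) sums - Ln (1 - J_nome a b y r)" for r
  proof -
    have "(\<lambda>n. - (w r ^ n) / of_nat n) sums ln (1 - w r)"
      using Ln_series'[of "- w r"] nw1 by simp
    from sums_minus[OF this] have "(\<lambda>n. w r ^ n / of_nat n) sums - ln (1 - w r)" by simp
    then show ?thesis unfolding w_def[symmetric] by (subst sums_Suc_iff) auto
  qed
  show "(\<lambda>r. w r ^ Suc m / of_nat (Suc m)) sums iseki_term a b y (of_nat (Suc m))" for m
  proof -
    define M where "M = complex_of_nat (Suc m)"
    have "w r ^ Suc m = exp (tpi * of_real b * M) * exp (of_real a * (of_real (- 2 * pi * y) * M))
        * exp (of_real (- 2 * pi * y) * M) ^ r" for r
      unfolding w_def M_def exp_of_nat_mult[symmetric] exp_add[symmetric]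
      by (intro arg_cong[of _ _ exp]) (simp add: algebra_simps)
    moreover have "norm (exp (of_real (- 2 * pi * y) * M)) < 1"
      using y by (simp add: M_def norm_exp_eq_Re)
    ultimately show ?thesis
      using sums_divide[OF sums_mult[OF geometric_sums[of "exp (of_real (- 2 * pi * y) * M)"],
          of "exp (tpi * of_real b * M) * exp (of_real a * (of_real (- 2 * pi * y) * M))"], of M]
      unfolding M_def[symmetric] iseki_term_def kap_def by (simp only: times_divide_eq_right mult_1_right)
  qed
qed

text \<open>From \<kappa>_a(-u) = -\<kappa>_(1-a)(u), with the sign absorbed by 1/m. Hence the
  residues at negative integers sum to a J-function as well. At the poles of \<open>kap\<close> both
  sides are 0, because division by zero gives 0.\<close>

lemma iseki_term_uminus: "iseki_term a b y (- m) = iseki_term (1 - a) (- b) y m"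
proof (cases "exp (of_real (2 * pi * y) * m) = 1")
  case True
  then show ?thesis by (simp add: iseki_term_def kap_def exp_minus)
next
  case False
  define V where "V = of_real (2 * pi * y) * m"
  have "exp V \<noteq> 1" using False by (simp add: V_def)
  then have alg: "E / (1 - exp V) / - m = E / exp V / (1 - inverse (exp V)) / m" for E
    by (cases "m = 0") (simp_all add: divide_simps, algebra)
  have "of_real (- 2 * pi * y) * - m = V" "of_real (- 2 * pi * y) * m = - V" by (auto simp: V_def)
  moreover have "exp (of_real (1 - a) * (- V)) = exp (of_real a * V) / exp V"
    by (simp add: exp_diff[symmetric] algebra_simps)
  moreover have "tpi * of_real b * - m = tpi * of_real (- b) * m" by simp
  ultimately show ?thesis
    unfolding iseki_term_def kap_def using alg by (simp only: exp_minus times_divide_eq_right)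
qed

text \<open>As the rectangles grow, the contour integral tends to 0, and the residues at the
  integers and at the multiples of i/y sum to the two J-functions on either side. The remaining
  terms are the residue at 0: the Bernoulli values carry the exponential factors of the
  transformation law, and the product (a - 1/2)(b - 1/2) is a summand of a Dedekind sum.\<close>

theorem iseki:
  assumes ab: "0 < a" "a < 1" "0 < b" "b < 1" and y: "y > 0"
  shows "J a b y + J (1 - a) (- b) y = J b (- a) (1 / y) + J (1 - b) a (1 / y)
     + of_real (- pi * y * B2 a + pi / y * B2 b) + tpi * of_real ((a - 1/2) * (b - 1/2))"
proof -
  define R where "R = tpi * residue (iseki_kernel a b y) 0"
  have sum1: "(\<Sum>m=1..N. f (of_nat m)) = (\<Sum>m<N. f (of_nat (Suc m)))" for f :: "complex \<Rightarrow> complex" and N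
    by (rule sum.reindex_bij_witness[of _ Suc "\<lambda>m. m - 1"]) auto
  have lim: "(\<lambda>N. \<Sum>m=1..N. iseki_term a b y (of_nat m) + iseki_term a b y (- of_nat m))
      \<longlonglongrightarrow> J a b y + J (1 - a) (- b) y" if "0 < a" "a < 1" "y > 0" for a b y
    unfolding iseki_term_uminus sum.distrib sum1
    using iseki_term_sums_J[of a y b] iseki_term_sums_J[of "1 - a" y "- b"] that
    by (intro tendsto_add) (auto simp: sums_def)
  have "(\<lambda>N. R - (\<Sum>m=1..N. iseki_term a b y (of_nat m) + iseki_term a b y (- of_nat m))
    + (\<Sum>m=1..N. iseki_term b (- a) (1 / y) (of_nat m) + iseki_term b (- a) (1 / y) (- of_nat m)))
     \<longlonglongrightarrow> R - (J a b y + J (1 - a) (- b) y) + (J b (- a) (1 / y) + J (1 - b) (- (- a)) (1 / y))"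
    using assms by (intro tendsto_intros lim) auto
  moreover have "(\<lambda>N. R - (\<Sum>m=1..N. iseki_term a b y (of_nat m) + iseki_term a b y (- of_nat m))
    + (\<Sum>m=1..N. iseki_term b (- a) (1 / y) (of_nat m) + iseki_term b (- a) (1 / y) (- of_nat m)))
     \<longlonglongrightarrow> 0"
    using iseki_contour_tendsto_0[OF assms] unfolding iseki_residue_sum[OF y] R_def .
  ultimately have "R - (J a b y + J (1 - a) (- b) y) + (J b (- a) (1 / y) + J (1 - b) (- (- a)) (1 / y)) = 0"
    by (rule LIMSEQ_unique)
  then show ?thesis
    unfolding R_def residue_iseki_kernel_0[OF y] by (simp add: algebra_simps)
qed

section \<open>The transformation formula\<close>

lemma Re_one_minus_pos: "norm (w::complex) < 1 \<Longrightarrow> 0 < Re (1 - w)"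
  using complex_Re_le_cmod[of w] by simp

text \<open>Both arguments are below pi/2 in absolute value, so their difference stays inside the
  range of the principal branch.\<close>

lemma Ln_diff_eq_Ln_divide:
  assumes "Re z > 0" "Re w > 0"
  shows "Ln z - Ln w = Ln (z / w)"
proof -
  have nz: "z \<noteq> 0" "w \<noteq> 0" using assms by auto
  have "\<bar>Im (Ln z)\<bar> < pi / 2" "\<bar>Im (Ln w)\<bar> < pi / 2"
    using assms Re_Ln_pos_lt[OF nz(1)] Re_Ln_pos_lt[OF nz(2)] by blast+
  then have "Ln (exp (Ln z - Ln w)) = Ln z - Ln w" by (intro Ln_exp) auto
  then show ?thesis using nz by (simp add: exp_diff)
qed

text \<open>The majorant depends on the lower bound a' only, not on a and b; this uniformity permits
  the passage to the limit in the parameters of J.\<close>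

lemma J_term_bound:
  assumes "a \<ge> a'" "a' > 0" "y > 0"
  shows "norm (- Ln (1 - J_nome a b y r))
    \<le> exp (- 2 * pi * y) ^ r / (1 - exp (- 2 * pi * y * a'))"
proof -
  let ?w = "J_nome a b y r"
  have n: "norm ?w = exp (- 2 * pi * y * (a + real r))" by (rule norm_exp_J)
  have p: "0 \<le> 2 * pi * y" using assms by simp
  have "2 * pi * y * a' \<le> 2 * pi * y * (a + real r)" "2 * pi * y * real r \<le> 2 * pi * y * (a + real r)"
    using assms by (intro mult_left_mono p; simp)+
  then have 1: "norm ?w \<le> exp (- 2 * pi * y * a')" and 2: "norm ?w \<le> exp (- 2 * pi * y) ^ r"
    unfolding n by (simp_all add: exp_of_nat_mult[symmetric] mult_ac)
  have lt: "exp (- 2 * pi * y * a') < 1" using assms by simp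
  have "norm (- Ln (1 - ?w)) \<le> norm ?w / (1 - exp (- 2 * pi * y * a'))"
    using norm_Ln_one_minus_le'[OF 1 lt] by simp
  also have "\<dots> \<le> exp (- 2 * pi * y) ^ r / (1 - exp (- 2 * pi * y * a'))"
    using 2 lt by (intro divide_right_mono) auto
  finally show ?thesis .
qed

lemma summable_J_bound:
  assumes "y > 0" shows "summable (\<lambda>r. exp (- 2 * pi * y) ^ r / (c::real))"
  using assms by (intro summable_divide summable_geometric) auto

lemma summable_J:
  assumes "a > 0" "y > 0"
  shows "summable (\<lambda>r. - Ln (1 - J_nome a b y r))"
  by (rule summable_comparison_test'[OF summable_J_bound[OF assms(2)]])
     (rule J_term_bound[OF order_refl assms])

text \<open>Only the term r = 0 becomes singular when a and b tend to 0; the rest, with a replaced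
  by 1 + a, stays regular there.\<close>

lemma J_split:
  assumes "a > 0" "y > 0"
  shows "J a b y = - Ln (1 - exp (tpi * of_real b - of_real (2 * pi * y * a))) + J (1 + a) b y"
  using suminf_split_head[OF summable_J[OF assms, of b]] unfolding J_def
  by (simp add: add_ac)

lemma exp_add_2pi_i_of_int:
  "exp (tpi * of_real (b + of_int n) - w) = exp (tpi * of_real b - w)"
proof -
  have "tpi * of_real (b + of_int n) - w
      = (tpi * of_real b - w) + tpi * of_int n"
    by (simp add: algebra_simps)
  then show ?thesis by (simp only: exp_add exp_2pi_i_of_int mult_1_right)
qed

lemma J_periodic:
  assumes "b - b' \<in> \<int>"
  shows "J a b y = J a b' y"
proof -
  obtain n :: int where n: "b = b' + of_int n" using assms by (auto elim!: Ints_cases simp: algebra_simps)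
  show ?thesis unfolding J_def n exp_add_2pi_i_of_int ..
qed

lemma logf_eq_J:
  assumes "y > 0" shows "logf (exp (of_real (- 2 * pi * y))) = J 1 0 y"
  unfolding logf_def J_def exp_of_nat_mult[symmetric]
  by (intro suminf_cong) (simp add: algebra_simps)

lemma J_tendsto:
  assumes f: "(f \<longlongrightarrow> a) F" and g: "(g \<longlongrightarrow> b) F" and "a > 0" "y > 0" "F \<noteq> bot"
  shows "((\<lambda>t. J (f t) (g t) y) \<longlongrightarrow> J a b y) F"
  unfolding J_def
proof (rule tannerys_theorem[THEN conjunct2, THEN conjunct2])
  fix r
  have "norm (J_nome a b y r) < 1"
    unfolding norm_exp_J using assms by (simp add: mult_pos_pos add_pos_nonneg)
  from Re_one_minus_pos[OF this]
  have "1 - J_nome a b y r \<notin> \<real>\<^sub>\<le>\<^sub>0"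
    by (auto simp: complex_nonpos_Reals_iff)
  then show "((\<lambda>t. - Ln (1 - J_nome (f t) (g t) y r))
     \<longlongrightarrow> - Ln (1 - J_nome a b y r)) F"
    by (intro tendsto_intros f g)
next
  show "summable (\<lambda>r. exp (- 2 * pi * y) ^ r / (1 - exp (- 2 * pi * y * (a / 2))))"
    by (rule summable_J_bound) fact
  have "eventually (\<lambda>t. f t > a / 2) F"
    using f assms by (intro order_tendstoD) auto
  then have "\<forall>\<^sub>F (r, t) in sequentially \<times>\<^sub>F F. f t > a / 2"
    by (subst eventually_prod2) auto
  then show "\<forall>\<^sub>F (r, t) in sequentially \<times>\<^sub>F F.
      norm (- Ln (1 - J_nome (f t) (g t) y r))
      \<le> exp (- 2 * pi * y) ^ r / (1 - exp (- 2 * pi * y * (a / 2)))"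
    by (rule eventually_mono, clarify, intro J_term_bound) (use assms in auto)
qed fact

text \<open>Each 1 - e^(tc) is asymptotic to -tc, so t cancels in the quotient. The left half-plane
  makes the difference of logarithms the logarithm of the quotient, and the last hypothesis makes Ln
  continuous at the limit.\<close>

lemma Ln_quotient_tendsto:
  assumes c: "Re c1 < 0" "Re c2 < 0" and q: "c2 / c1 \<notin> \<real>\<^sub>\<le>\<^sub>0"
  shows "((\<lambda>t. Ln (1 - exp (of_real t * c2)) - Ln (1 - exp (of_real t * c1))) \<longlongrightarrow> Ln (c2 / c1)) (at_right 0)"
proof -
  have nz: "c1 \<noteq> 0" using c by auto
  have lim: "((\<lambda>t. (1 - exp (of_real t * c)) / of_real t) \<longlongrightarrow> - c) (at_right 0)" for c :: complex
  proof -
    have "((\<lambda>z. exp (z * c)) has_field_derivative c) (at 0)"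
      by (auto intro!: derivative_eq_intros)
    then have "((\<lambda>z. (exp (z * c) - 1) / z) \<longlongrightarrow> c) (at 0)"
      by (simp add: has_field_derivative_iff)
    moreover have "filterlim complex_of_real (at 0) (at_right 0)"
      unfolding filterlim_at by (auto simp: eventually_at_filter intro!: tendsto_eq_intros)
    ultimately have "((\<lambda>t. (exp (of_real t * c) - 1) / of_real t) \<longlongrightarrow> c) (at_right 0)"
      by (rule filterlim_compose)
    from tendsto_minus[OF this] show ?thesis by (simp add: minus_divide_left)
  qed
  have "((\<lambda>t. Ln (((1 - exp (of_real t * c2)) / of_real t) / ((1 - exp (of_real t * c1)) / of_real t)))
      \<longlongrightarrow> Ln ((- c2) / (- c1))) (at_right 0)"
    using q nz by (intro tendsto_Ln tendsto_divide lim) auto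
  then have "((\<lambda>t. Ln (((1 - exp (of_real t * c2)) / of_real t) / ((1 - exp (of_real t * c1)) / of_real t)))
      \<longlongrightarrow> Ln (c2 / c1)) (at_right 0)" by simp
  moreover have "\<forall>\<^sub>F t in at_right 0. Ln (((1 - exp (of_real t * c2)) / of_real t) / ((1 - exp (of_real t * c1)) / of_real t))
      = Ln (1 - exp (of_real t * c2)) - Ln (1 - exp (of_real t * c1))"
  proof (rule eventually_at_right_less[THEN eventually_mono])
    fix t :: real assume t: "0 < t"
    have "Re (1 - exp (of_real t * c)) > 0" if "Re c < 0" for c
      using t that by (intro Re_one_minus_pos) (simp add: norm_exp_eq_Re mult_pos_neg)
    from Ln_diff_eq_Ln_divide[OF this[OF c(2)] this[OF c(1)]] t
    show "Ln (((1 - exp (of_real t * c2)) / of_real t) / ((1 - exp (of_real t * c1)) / of_real t))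
      = Ln (1 - exp (of_real t * c2)) - Ln (1 - exp (of_real t * c1))" by simp
  qed
  ultimately show ?thesis by (rule Lim_transform_eventually)
qed

text \<open>Iseki's equation with $a = b = t \to 0$; its two singular terms differ by the logarithm of $i/y$
  in the limit.\<close>

lemma logf_inversion_real:
  assumes y: "y > 0"
  shows "logf (exp (of_real (- 2 * pi * y))) =
    logf (exp (of_real (- 2 * pi * (1 / y)))) + of_real (ln y / 2 + pi / 12 * (1 / y - y))"
proof -
  \<comment> \<open>t c1 and t c2 are the exponents in the singular terms of \<open>J t t y\<close>
    and \<open>J t (- t) (1 / y)\<close>.\<close>
  define c1 where "c1 = of_real (2 * pi) * (\<i> - of_real y)"
  define c2 where "c2 = - of_real (2 * pi) * (\<i> + 1 / of_real y)"
  have c: "Re c1 < 0" "Re c2 < 0" using y by (auto simp: c1_def c2_def)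
  have ne: "\<i> - of_real y \<noteq> 0" by (auto simp: complex_eq_iff)
  have "c2 / c1 = - (\<i> + 1 / of_real y) / (\<i> - of_real y)"
  proof -
    have "- P * A / (P * B) = - A / B" if "P \<noteq> 0" for P A B :: complex using that by simp
    then show ?thesis unfolding c1_def c2_def by this (simp add: pi_neq_zero)
  qed
  also have "\<dots> = \<i> / of_real y"
    using ne y by (simp add: field_simps)
  finally have c12: "c2 / c1 = \<i> / of_real y" .
  have Ln12: "Ln (c2 / c1) = \<i> * of_real pi / 2 - of_real (ln y)"
  proof -
    have "\<i> / of_real y = \<i> * of_real (1 / y)" by simp
    also have "Ln \<dots> = of_real (ln (1 / y)) + Ln \<i>"
      by (subst mult.commute, subst Ln_times_of_real) (use y Ln_of_real[of "1 / y"] in auto)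
    finally show ?thesis unfolding c12 using y by (simp add: ln_div)
  qed
  let ?L = "\<lambda>t::real. Ln (1 - exp (of_real t * c2)) - Ln (1 - exp (of_real t * c1))"
  let ?C = "\<lambda>t. of_real (- pi * y * B2 t + pi / y * B2 t) + tpi * of_real ((t - 1/2) * (t - 1/2))"
  let ?R = "\<lambda>t. J (1 + t) (- t) (1 / y) + J (1 - t) t (1 / y) - J (1 + t) t y - J (1 - t) (- t) y + ?C t"
  have ev: "\<forall>\<^sub>F t in at_right 0. ?L t = ?R t"
  proof (rule eventually_at_right_real[of 0 1, THEN eventually_mono])
    fix t :: real assume t: "t \<in> {0<..<1}"
    have e1: "tpi * of_real t - of_real (2 * pi * y * t) = of_real t * c1"
      by (simp add: c1_def algebra_simps)
    have e2: "tpi * of_real (- t) - of_real (2 * pi * (1 / y) * t) = of_real t * c2"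
      by (simp add: c2_def algebra_simps)
    show "?L t = ?R t"
      using iseki[of t t y] J_split[of t y t] J_split[of t "1 / y" "- t"] t y
      unfolding e1 e2 by (simp add: algebra_simps)
  qed simp
  have "(?R \<longlongrightarrow> J (1 + 0) (- 0) (1 / y) + J (1 - 0) 0 (1 / y) - J (1 + 0) 0 y - J (1 - 0) (- 0) y + ?C 0) (at_right 0)"
    unfolding B2_def using y by (intro tendsto_intros J_tendsto) auto
  moreover have "(?R \<longlongrightarrow> Ln (c2 / c1)) (at_right 0)"
    using Ln_quotient_tendsto[OF c] y ev
    by (intro Lim_transform_eventually[OF _ ev]) (auto simp: c12 complex_nonpos_Reals_iff)
  ultimately have "J (1 + 0) (- 0) (1 / y) + J (1 - 0) 0 (1 / y) - J (1 + 0) 0 y - J (1 - 0) (- 0) y + ?C 0 = Ln (c2 / c1)"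
    by (rule tendsto_unique[OF trivial_limit_at_right_real])
  \<comment> \<open>The value of (t - 1/2)^2 at t = 0 contributes i pi / 2, which cancels the
    argument of i in Ln(i/y). What is left is twice the inversion formula of the logarithm of
    eta.\<close>
  then have "2 * J 1 0 (1 / y) - 2 * J 1 0 y + of_real (- pi * y / 6 + pi / y / 6) + \<i> * of_real pi / 2 = \<i> * of_real pi / 2 - of_real (ln y)"
    unfolding Ln12 by (simp add: B2_def)
  moreover have "2 * b = 2 * a + r + l" if "2 * a - 2 * b + r + w = w - l" for a b r w l :: complex
    using that by algebra
  ultimately have "2 * J 1 0 y = 2 * J 1 0 (1 / y) + of_real (- pi * y / 6 + pi / y / 6) + of_real (ln y)"
    by blast
  also have "\<dots> = 2 * (J 1 0 (1 / y) + of_real (ln y / 2 + pi / 12 * (1 / y - y)))"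
    using y by (simp add: field_simps)
  finally have "J 1 0 y = J 1 0 (1 / y) + of_real (ln y / 2 + pi / 12 * (1 / y - y))"
    by (simp only: mult_cancel_left) simp
  then show ?thesis using y by (simp only: logf_eq_J zero_less_divide_1_iff)
qed

section \<open>Residue classes modulo k and the Dedekind sum\<close>

abbreviation nome :: "nat \<Rightarrow> nat \<Rightarrow> complex \<Rightarrow> complex" where
  "nome h k z \<equiv> exp (of_real (2 * pi) * (\<i> * of_nat h - z) / of_nat k)"

lemma norm_exp_logf_arg:
  "Re z > 0 \<Longrightarrow> k > 0 \<Longrightarrow> norm (nome h k z) < 1"
  by (simp add: norm_exp_eq_Re Re_divide_of_nat)

text \<open>\<open>nome h k z\<close> is e^(2 pi i \<tau>) for \<tau> = (h + i z)/k. In the exponent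
  rk + \<mu> the phase depends on \<mu> only, up to a full turn, and the modulus gives (\<mu>/k +
  r); so each class \<mu> contributes one J. Blocks of k consecutive terms are summed, which avoids
  a rearrangement.\<close>

lemma logf_eq_sum_J:
  fixes h k :: nat
  assumes k: "k > 0" and y: "y > 0"
  shows "logf (nome h k (of_real y)) =
    (\<Sum>\<mu>=1..k. J (real \<mu> / real k) (real (h * \<mu>) / real k) y)"
proof -
  define q where "q = nome h k (of_real y)"
  have q: "norm q < 1" unfolding q_def using assms by (intro norm_exp_logf_arg) auto
  define g where "g \<mu> r = - Ln (1 - J_nome (real \<mu> / real k) (real (h * \<mu>) / real k) y r)" for \<mu> r
  have g: "g (Suc j) r = - Ln (1 - q ^ (r * k + j + 1))" for j r
  proof -
    have "q ^ (r * k + j + 1) = exp (of_nat (r * k + j + 1) * (of_real (2 * pi) * (\<i> * of_nat h - of_real y) / of_nat k))"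
      unfolding q_def by (rule exp_of_nat_mult[symmetric])
    also have "of_nat (r * k + j + 1) * (of_real (2 * pi) * (\<i> * of_nat h - of_real y) / of_nat k) =
        tpi * of_real (real (h * Suc j) / real k + of_int (int (r * h))) - of_real (2 * pi * y * (real (Suc j) / real k + real r))"
      using k by (simp add: field_simps)
    also have "exp \<dots> = J_nome (real (Suc j) / real k) (real (h * Suc j) / real k) y r"
      by (rule exp_add_2pi_i_of_int)
    finally show ?thesis by (simp add: g_def)
  qed
  have "(\<lambda>n. - Ln (1 - q ^ (n + 1))) sums logf q"
    using summable_logf[OF q] unfolding logf_def by (rule summable_sums)
  from sums_group[OF this k] have "(\<lambda>r. \<Sum>n=r*k..<r*k+k. - Ln (1 - q ^ (n + 1))) sums logf q" .
  also have "(\<lambda>r. \<Sum>n=r*k..<r*k+k. - Ln (1 - q ^ (n + 1))) = (\<lambda>r. \<Sum>\<mu>=1..k. g \<mu> r)"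
  proof
    fix r
    show "(\<Sum>n=r*k..<r*k+k. - Ln (1 - q ^ (n + 1))) = (\<Sum>\<mu>=1..k. g \<mu> r)"
      by (rule sum.reindex_bij_witness[of _ "\<lambda>\<mu>. r * k + \<mu> - 1" "\<lambda>n. n - r * k + 1"])
         (auto simp: g[simplified])
  qed
  finally have "(\<lambda>r. \<Sum>\<mu>=1..k. g \<mu> r) sums logf q" .
  moreover have "(\<lambda>r. \<Sum>\<mu>=1..k. g \<mu> r) sums (\<Sum>\<mu>=1..k. J (real \<mu> / real k) (real (h * \<mu>) / real k) y)"
  proof (rule sums_sum)
    fix \<mu> assume "\<mu> \<in> {1..k}"
    then have "summable (g \<mu>)" unfolding g_def using k y by (intro summable_J) auto
    then show "g \<mu> sums J (real \<mu> / real k) (real (h * \<mu>) / real k) y"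
      unfolding g_def J_def by (rule summable_sums)
  qed
  ultimately show ?thesis unfolding q_def by (rule sums_unique2)
qed

text \<open>The distribution relation: over all residues modulo k the sum is B_2(0)/k = 1/(6k). The
  class 0, with value 1/6, is left out here because Iseki's equation does not cover it.\<close>

lemma sum_B2:
  assumes "k > 0"
  shows "(\<Sum>\<mu>=1..<k. B2 (real \<mu> / real k)) = 1 / (6 * real k) - 1 / 6"
proof -
  have s: "(\<Sum>\<mu>=1..<k. real \<mu>) = real k * (real k - 1) / 2 \<and>
        (\<Sum>\<mu>=1..<k. (real \<mu>)\<^sup>2) = real k * (real k - 1) * (2 * real k - 1) / 6" if "k \<ge> 1" for k
    using that by (induction k rule: dec_induct) (auto simp: field_simps power2_eq_square)
  have "(\<Sum>\<mu>=1..<k. B2 (real \<mu> / real k)) = (\<Sum>\<mu>=1..<k. (real \<mu>)\<^sup>2) / (real k)\<^sup>2 - (\<Sum>\<mu>=1..<k. real \<mu>) / real k + (real k - 1) / 6"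
    using assms by (simp add: B2_def sum.distrib sum_subtractf sum_divide_distrib power_divide of_nat_diff)
  also have "\<dots> = (real k * (real k - 1) * (2 * real k - 1) / 6) / (real k)\<^sup>2
      - (real k * (real k - 1) / 2) / real k + (real k - 1) / 6"
    using s[of k] assms by (metis One_nat_def Suc_leI)
  also have "\<dots> = 1 / (6 * real k) - 1 / 6"
    using assms by (simp add: field_simps power2_eq_square)
  finally show ?thesis .
qed

lemma frac_nat_divide:
  assumes "k > 0"
  shows "real n / real k - of_int \<lfloor>real n / real k\<rfloor> = real (n mod k) / real k"
proof -
  have "real n = real k * real (n div k) + real (n mod k)"
    using mult_div_mod_eq[of k n] by (metis of_nat_add of_nat_mult)
  moreover have "\<lfloor>real n / real k\<rfloor> = int (n div k)" by (rule floor_divide_of_nat_eq)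
  ultimately show ?thesis using assms by (simp only: of_int_of_nat_eq) (simp add: field_simps)
qed

text \<open>Iseki's equation is used with a = \<mu>/k and b = (h \<mu> mod k)/k. The dual terms have
  b in the first place, so they belong to the class \<sigma>(\<mu>), and as \<sigma> permutes the
  nonzero classes they add up to \<open>logf\<close> at the dual nome. The class \<mu> = k is the
  inversion formula of eta.\<close>

lemma logf_transform_real:
  fixes h H k :: nat
  assumes k: "k > 0" and y: "y > 0" and hH: "k dvd h * H + 1"
  shows "logf (nome h k (of_real y)) =
    logf (nome H k (of_real (1 / y)))
    + of_real (ln y / 2 + pi / (12 * real k) * (1 / y - y)) + of_real pi * \<i> * of_real (dedekind_sum h k)"
proof -
  define A where "A \<mu> = J (real \<mu> / real k) (real (h * \<mu>) / real k) y" for \<mu>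
  define C where "C \<nu> = J (real \<nu> / real k) (real (H * \<nu>) / real k) (1 / y)" for \<nu>
  define \<sigma> where "\<sigma> \<mu> = h * \<mu> mod k" for \<mu>
  define I where "I = {1..<k}"
  have cop: "coprime h k"
  proof (rule coprimeI)
    fix d assume "d dvd h" "d dvd k"
    with hH have "d dvd h * H + 1" "d dvd h * H" by auto
    then show "is_unit d" using dvd_add_right_iff[of d "h * H" 1] by simp
  qed
  have \<sigma>_ne: "\<sigma> \<mu> \<in> I" if "\<mu> \<in> I" for \<mu>
  proof -
    have "\<not> k dvd h * \<mu>"
      using that cop nat_dvd_not_less[of \<mu> k] by (auto simp: I_def coprime_dvd_mult_right_iff coprime_commute)
    then show ?thesis using k by (auto simp: I_def \<sigma>_def Suc_le_eq dvd_eq_mod_eq_0)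
  qed
  have inj: "inj_on \<sigma> I"
  proof (rule inj_onI)
    fix a b assume ab: "a \<in> I" "b \<in> I" "\<sigma> a = \<sigma> b"
    then have "[h * a = h * b] (mod k)" by (simp add: \<sigma>_def cong_def)
    then have "[a = b] (mod k)" using cop by (simp add: cong_mult_lcancel_nat)
    then show "a = b" using ab by (simp add: cong_def I_def)
  qed
  have bij: "bij_betw \<sigma> I I"
    using inj \<sigma>_ne by (intro bij_betw_imageI endo_inj_surj) (auto simp: I_def)
  have reidx: "(\<Sum>\<mu>\<in>I. f (\<sigma> \<mu>)) = (\<Sum>\<mu>\<in>I. f \<mu>)" for f :: "nat \<Rightarrow> 'b :: comm_monoid_add"
    by (rule sum.reindex_bij_betw[OF bij])
  have refl: "(\<Sum>\<mu>\<in>I. f (k - \<mu>)) = (\<Sum>\<mu>\<in>I. f \<mu>)" for f :: "nat \<Rightarrow> 'b :: comm_monoid_add"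
    by (rule sum.reindex_bij_witness[of _ "\<lambda>\<mu>. k - \<mu>" "\<lambda>\<mu>. k - \<mu>"]) (auto simp: I_def)
  have ints: "real a / real k - real b / real k \<in> \<int>" if "[a = b] (mod k)" for a b
  proof -
    have "a mod k = b mod k" using that by (simp add: cong_def)
    then have "real a / real k - of_int \<lfloor>real a / real k\<rfloor> = real b / real k - of_int \<lfloor>real b / real k\<rfloor>"
      using k by (simp add: frac_nat_divide)
    then have "real a / real k - real b / real k = of_int (\<lfloor>real a / real k\<rfloor> - \<lfloor>real b / real k\<rfloor>)" by simp
    then show ?thesis by (metis Ints_of_int)
  qed
  have ints': "real a / real k - (- (real b / real k)) \<in> \<int>" if "[a + b = 0] (mod k)" for a b
    using ints[OF that] by (simp add: add_divide_distrib)
  have key: "A \<mu> + A (k - \<mu>) = C (\<sigma> \<mu>) + C (k - \<sigma> \<mu>)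
      + of_real (- pi * y * B2 (real \<mu> / real k) + pi / y * B2 (real (\<sigma> \<mu>) / real k))
      + tpi * of_real ((real \<mu> / real k - 1/2) * (real (\<sigma> \<mu>) / real k - 1/2))"
    if "\<mu> \<in> I" for \<mu>
  proof -
    define a where "a = real \<mu> / real k"
    define b where "b = real (\<sigma> \<mu>) / real k"
    have ab: "0 < a" "a < 1" "0 < b" "b < 1"
      using that \<sigma>_ne[OF that] k by (auto simp: a_def b_def I_def)
    have m: "\<mu> < k" "\<sigma> \<mu> < k" using that \<sigma>_ne[OF that] by (auto simp: I_def)
    have sig: "[\<sigma> \<mu> = h * \<mu>] (mod k)" by (simp add: \<sigma>_def cong_def)
    \<comment> \<open>This is where h H \<equiv> -1 is needed: the dual term carries the phase
      -\<mu>/k, and H \<sigma>(\<mu>) \<equiv> -\<mu> makes it the phase that the class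
      \<sigma>(\<mu>) has in the nome of H/k.\<close>
    have hm: "[H * \<sigma> \<mu> + \<mu> = 0] (mod k)"
    proof -
      have "[H * \<sigma> \<mu> + \<mu> = H * (h * \<mu>) + \<mu>] (mod k)"
        by (intro cong_add cong_mult sig) auto
      also have "H * (h * \<mu>) + \<mu> = (h * H + 1) * \<mu>" by (simp add: algebra_simps)
      also have "[\<dots> = 0] (mod k)" by (simp only: cong_0_iff dvd_mult2[OF hH])
      finally show ?thesis .
    qed
    have "A \<mu> = J a b y"
      unfolding A_def a_def b_def by (intro J_periodic ints) (use sig in \<open>simp add: cong_sym\<close>)
    moreover have "A (k - \<mu>) = J (1 - a) (- b) y"
    proof -
      have "[h * (k - \<mu>) + \<sigma> \<mu> = h * (k - \<mu>) + h * \<mu>] (mod k)" by (intro cong_add sig) auto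
      also have "h * (k - \<mu>) + h * \<mu> = h * k" using m by (simp add: diff_mult_distrib2)
      finally have "[h * (k - \<mu>) + \<sigma> \<mu> = 0] (mod k)" by (simp add: cong_def)
      moreover have "real (k - \<mu>) / real k = 1 - a" using m k by (simp add: a_def of_nat_diff field_simps)
      ultimately show ?thesis
        unfolding A_def b_def by (simp only:) (intro J_periodic ints')
    qed
    moreover have "C (\<sigma> \<mu>) = J b (- a) (1 / y)"
      unfolding C_def a_def b_def by (intro J_periodic ints' hm)
    moreover have "C (k - \<sigma> \<mu>) = J (1 - b) a (1 / y)"
    proof -
      have "[H * (k - \<sigma> \<mu>) + (H * \<sigma> \<mu> + \<mu>) = H * (k - \<sigma> \<mu>) + 0] (mod k)" by (intro cong_add hm) auto
      moreover have "H * (k - \<sigma> \<mu>) + (H * \<sigma> \<mu> + \<mu>) = \<mu> + H * k" using m by (simp add: diff_mult_distrib2)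
      ultimately have "[H * (k - \<sigma> \<mu>) = \<mu>] (mod k)" by (simp add: cong_def)
      moreover have "real (k - \<sigma> \<mu>) / real k = 1 - b" using m k by (simp add: b_def of_nat_diff field_simps)
      ultimately show ?thesis
        unfolding C_def a_def by (simp only:) (intro J_periodic ints)
    qed
    ultimately show ?thesis
      using iseki[OF ab y] by (simp add: a_def b_def)
  qed
  \<comment> \<open>Iseki's equation only controls the sum over a class and its negative. Summing
    over all \<mu> counts every class twice, and the factor 2 is divided out below.\<close>
  have "2 * (\<Sum>\<mu>\<in>I. A \<mu>) = (\<Sum>\<mu>\<in>I. A \<mu> + A (k - \<mu>))"
    using refl[of A] by (simp add: sum.distrib)
  also have "\<dots> = (\<Sum>\<mu>\<in>I. C (\<sigma> \<mu>) + C (k - \<sigma> \<mu>)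
      + of_real (- pi * y * B2 (real \<mu> / real k) + pi / y * B2 (real (\<sigma> \<mu>) / real k))
      + tpi * of_real ((real \<mu> / real k - 1/2) * (real (\<sigma> \<mu>) / real k - 1/2)))"
    by (rule sum.cong[OF HOL.refl key])
  also have "\<dots> = 2 * (\<Sum>\<nu>\<in>I. C \<nu>)
      + of_real (- pi * y * (\<Sum>\<mu>\<in>I. B2 (real \<mu> / real k)) + pi / y * (\<Sum>\<mu>\<in>I. B2 (real \<mu> / real k)))
      + tpi * of_real (\<Sum>\<mu>\<in>I. (real \<mu> / real k - 1/2) * (real (\<sigma> \<mu>) / real k - 1/2))"
    using reidx[of C] reidx[of "\<lambda>\<mu>. C (k - \<mu>)"] refl[of C] reidx[of "\<lambda>\<mu>. B2 (real \<mu> / real k)"]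
    by (simp only: sum.distrib of_real_sum[symmetric] sum_distrib_left[symmetric])
       (simp add: sum.distrib sum_distrib_left)
  also have "(\<Sum>\<mu>\<in>I. (real \<mu> / real k - 1/2) * (real (\<sigma> \<mu>) / real k - 1/2)) = dedekind_sum h k"
    unfolding dedekind_sum_def I_def frac_nat_divide[OF k]
    by (intro sum.cong) (auto simp: \<sigma>_def mult.commute)
  also have "(\<Sum>\<mu>\<in>I. B2 (real \<mu> / real k)) = 1 / (6 * real k) - 1 / 6"
    unfolding I_def by (rule sum_B2[OF k])
  finally have two: "2 * (\<Sum>\<mu>\<in>I. A \<mu>) = 2 * (\<Sum>\<nu>\<in>I. C \<nu>) +
      of_real (- pi * y * (1 / (6 * real k) - 1 / 6) + pi / y * (1 / (6 * real k) - 1 / 6))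
      + tpi * of_real (dedekind_sum h k)" .
  have "(\<Sum>\<mu>\<in>I. A \<mu>) = (\<Sum>\<nu>\<in>I. C \<nu>) +
      of_real (pi / 12 * (1 / real k - 1) * (1 / y - y)) + of_real pi * \<i> * of_real (dedekind_sum h k)"
  proof -
    have "2 * (\<Sum>\<mu>\<in>I. A \<mu>) = 2 * ((\<Sum>\<nu>\<in>I. C \<nu>) +
      of_real (pi / 12 * (1 / real k - 1) * (1 / y - y)) + of_real pi * \<i> * of_real (dedekind_sum h k))"
      unfolding two using k y by (simp add: field_simps)
    then show ?thesis by (simp only: mult_cancel_left) simp
  qed
  moreover have "{1..k} = insert k I" "k \<notin> I" "finite I" using k by (auto simp: I_def)
  then have "logf (nome h k (of_real y)) = A k + (\<Sum>\<mu>\<in>I. A \<mu>)"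
    "logf (nome H k (of_real (1 / y))) = C k + (\<Sum>\<mu>\<in>I. C \<mu>)"
    using k y by (simp_all only: logf_eq_sum_J zero_less_divide_1_iff A_def C_def) simp_all
  moreover have "A k = C k + of_real (ln y / 2 + pi / 12 * (1 / y - y))"
  proof -
    have "A k = J 1 0 y" "C k = J 1 0 (1 / y)"
      unfolding A_def C_def using k by (auto intro!: J_periodic)
    then show ?thesis using logf_inversion_real[OF y] y by (simp only: logf_eq_J zero_less_divide_1_iff)
  qed
  \<comment> \<open>The nonzero classes contribute the factor 1/k - 1 and the class k the factor 1
    to (pi/12)(1/y - y), together 1/k.\<close>
  moreover have "of_real (ln y / 2 + pi / (12 * real k) * (1 / y - y)) =
      complex_of_real (pi / 12 * (1 / real k - 1) * (1 / y - y)) + of_real (ln y / 2 + pi / 12 * (1 / y - y))"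
    unfolding of_real_add[symmetric] by (rule arg_cong[of _ _ of_real]) (use k y in \<open>simp add: field_simps\<close>)
  ultimately show ?thesis by (simp only: add_ac)
qed

text \<open>The right half-plane is mapped to itself by z -> 1/z, keeps both nomes in the unit disc
  and avoids the cut of Ln; so both sides are holomorphic on it, and agreement on the positive axis
  extends to all of it, branches included.\<close>

theorem logf_transform:
  fixes h H k :: nat
  assumes k: "k > 0" and z: "Re z > 0" and hH: "k dvd h * H + 1"
  shows "logf (nome h k z) =
    logf (nome H k (1 / z))
    + Ln z / 2 + of_real (pi / (12 * real k)) * (1 / z - z) + of_real pi * \<i> * of_real (dedekind_sum h k)"
proof -
  define S where "S = {z. Re z > 0}"
  define f where "f z = logf (nome h k z) -
    (logf (nome H k (1 / z))
    + Ln z / 2 + of_real (pi / (12 * real k)) * (1 / z - z) + of_real pi * \<i> * of_real (dedekind_sum h k))" for z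
  have inv: "Re (1 / z) > 0" if "Re z > 0" for z
    using that by (simp add: Re_divide add_pos_nonneg)
  have "f z = 0"
  proof (rule analytic_continuation[of f S "of_real ` {0<..}" 1])
    show "open S" "connected S"
      unfolding S_def by (auto simp: open_halfspace_Re_gt convex_halfspace_Re_gt intro: convex_connected)
    have hol: "(\<lambda>z. logf (exp (g z))) holomorphic_on S"
      if "g holomorphic_on S" "\<And>z. z \<in> S \<Longrightarrow> norm (exp (g z)) < 1" for g
    proof -
      have "(\<lambda>z. exp (g z)) holomorphic_on S" by (intro holomorphic_intros that)
      moreover have "(\<lambda>z. exp (g z)) ` S \<subseteq> ball 0 1" using that(2) by auto
      ultimately have "logf \<circ> (\<lambda>z. exp (g z)) holomorphic_on S"
        by (intro holomorphic_on_compose_gen[OF _ holomorphic_logf])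
      then show ?thesis by (simp only: o_def)
    qed
    show "f holomorphic_on S"
      unfolding f_def
    proof (intro holomorphic_intros hol)
      show "norm (nome H k (1 / z)) < 1" if "z \<in> S" for z
        using that k inv by (intro norm_exp_logf_arg) (auto simp: S_def)
      show "norm (nome h k z) < 1" if "z \<in> S" for z
        using that k inv by (intro norm_exp_logf_arg) (auto simp: S_def)
    qed (use k in \<open>auto simp: S_def complex_nonpos_Reals_iff\<close>)
    show "(1::complex) islimpt of_real ` {0<..}"
      unfolding islimpt_approachable
    proof (intro allI impI)
      fix e :: real assume "e > 0"
      then show "\<exists>x'\<in>of_real ` {0<..}. x' \<noteq> 1 \<and> dist x' (1::complex) < e"
        by (intro bexI[of _ "of_real (1 + e / 2)"]) (auto simp: dist_norm complex_eq_iff norm_divide)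
    qed
    fix w assume "w \<in> complex_of_real ` {0<..}"
    then obtain y where y: "y > 0" "w = of_real y" by auto
    show "f w = 0"
      using logf_transform_real[OF k y(1) hH] y by (simp add: f_def Ln_of_real)
  qed (use z in \<open>auto simp: S_def\<close>)
  then show ?thesis by (simp add: f_def)
qed

section \<open>The Bessel integral\<close>

text \<open>The integrand e^(a/z + bz) in the variable w = 1/z; the denominator is the
  Jacobian.\<close>

definition psi :: "real \<Rightarrow> real \<Rightarrow> complex \<Rightarrow> complex" where
  "psi a b w = exp (of_real a * w + of_real b / w) / w\<^sup>2"

text \<open>I_1(x) = (x/2) times this series at (x/2)^2. Being entire in its argument, it needs no
  square root and has the value 1 at 0, so the degenerate case of the main term requires no separate
  analysis of integrals.\<close>

definition bessel_sum :: "real \<Rightarrow> real" where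
  "bessel_sum x = (\<Sum>n. 1 / (fact n * fact (n + 1)) * x ^ n)"

text \<open>The singularity at 0 is essential, so no finite pole formula applies. Instead e^(b/w) is
  expanded in powers of b/w, which converges uniformly on the unit circle; the j-th term has a pole
  of finite order, and its integral yields the j-th term of the Bessel series.\<close>

lemma residue_psi: "residue (psi a b) 0 = of_real (a * bessel_sum (a * b))"
proof -
  define f where "f j w = of_real (b ^ j / fact j) * (exp (of_real a * w) / w ^ Suc (Suc j))" for j and w :: complex
  define c where "c j = b ^ j / fact j * (a ^ Suc j / fact (Suc j))" for j :: nat
  have f: "(f j has_contour_integral 2 * pi * \<i> * of_real (c j)) (circlepath 0 1)" for j
  proof -
    have "residue (\<lambda>w. exp (of_real a * w) / w ^ Suc (Suc j)) 0 = of_real a ^ Suc j / fact (Suc j)"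
      using residue_fps_expansion_over_power_at_0[OF has_fps_expansion_exp[of "complex_of_real a"], of "Suc j"]
      by (simp del: power_Suc fact_Suc)
    moreover have "((\<lambda>w. exp (of_real a * w) / w ^ Suc (Suc j)) has_contour_integral
        2 * pi * \<i> * residue (\<lambda>w. exp (of_real a * w) / w ^ Suc (Suc j)) 0) (circlepath 0 1)"
      by (rule base_residue[of UNIV]) (auto intro!: holomorphic_intros)
    ultimately have "((\<lambda>w. exp (of_real a * w) / w ^ Suc (Suc j)) has_contour_integral
        2 * pi * \<i> * (of_real a ^ Suc j / fact (Suc j))) (circlepath 0 1)" by simp
    from has_contour_integral_lmul[OF this, of "of_real (b ^ j / fact j)"]
    show ?thesis unfolding f_def by (rule arg_cong[of _ _ "\<lambda>x. (_ has_contour_integral x) _", THEN iffD1, rotated]) (simp add: c_def field_simps)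
  qed
  have ul: "uniform_limit (sphere 0 1) (\<lambda>n w. \<Sum>j<n. f j w) (psi a b) sequentially"
  proof -
    have "uniform_limit (sphere 0 1) (\<lambda>n w. \<Sum>j<n. f j w) (\<lambda>w. \<Sum>j. f j w) sequentially"
    proof (rule Weierstrass_m_test)
      show "summable (\<lambda>j. inverse (fact j) * \<bar>b\<bar> ^ j * exp \<bar>a\<bar>)"
        by (intro summable_mult2 summable_exp)
      fix j and w :: complex assume w: "w \<in> sphere 0 1"
      have "a * Re w \<le> \<bar>a\<bar> * 1"
        using abs_Re_le_cmod[of w] w abs_ge_self[of "a * Re w"] mult_left_mono[of "\<bar>Re w\<bar>" 1 "\<bar>a\<bar>"]
        by (simp add: abs_mult)
      then have "norm (exp (of_real a * w)) \<le> exp \<bar>a\<bar>" by (simp add: norm_exp_eq_Re)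
      moreover have nf: "norm (f j w) = \<bar>b\<bar> ^ j / fact j * norm (exp (of_real a * w))"
        using w unfolding f_def norm_mult norm_divide norm_power norm_of_real by (simp add: power_abs)
      ultimately show "norm (f j w) \<le> inverse (fact j) * \<bar>b\<bar> ^ j * exp \<bar>a\<bar>"
        using mult_left_mono[of "norm (exp (of_real a * w))" "exp \<bar>a\<bar>" "\<bar>b\<bar> ^ j / fact j"] nf
        by (simp add: divide_inverse mult_ac)
    qed
    moreover have "(\<Sum>j. f j w) = psi a b w" if "w \<in> sphere 0 1" for w
    proof -
      have "(\<lambda>j. (of_real b / w) ^ j /\<^sub>R fact j * (exp (of_real a * w) / w\<^sup>2)) sums (exp (of_real b / w) * (exp (of_real a * w) / w\<^sup>2))"
        by (intro sums_mult2 exp_converges)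
      also have "(\<lambda>j. (of_real b / w) ^ j /\<^sub>R fact j * (exp (of_real a * w) / w\<^sup>2)) = (\<lambda>j. f j w)"
        by (simp add: f_def fun_eq_iff scaleR_conv_of_real divide_inverse power2_eq_square power_mult_distrib power_inverse mult_ac)
      finally show ?thesis by (simp add: sums_iff psi_def exp_add mult_ac)
    qed
    ultimately show ?thesis by (subst uniform_limit_cong'[of _ _ _ "psi a b"]) auto
  qed
  have "((\<lambda>n. contour_integral (circlepath 0 1) (\<lambda>w. \<Sum>j<n. f j w)) \<longlongrightarrow> contour_integral (circlepath 0 1) (psi a b)) sequentially"
    by (rule contour_integral_uniform_limit_circlepath[OF _ ul])
       (auto intro!: always_eventually has_contour_integral_integrable[OF f] contour_integrable_sum)
  moreover have "contour_integral (circlepath 0 1) (\<lambda>w. \<Sum>j<n. f j w) = (\<Sum>j<n. 2 * pi * \<i> * of_real (c j))" for n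
    by (intro contour_integral_unique has_contour_integral_sum f) auto
  ultimately have s1: "(\<lambda>j. 2 * pi * \<i> * of_real (c j)) sums contour_integral (circlepath 0 1) (psi a b)"
    by (simp add: sums_def)
  have "(\<lambda>j. a * (1 / (fact j * fact (j + 1)) * (a * b) ^ j)) sums (a * bessel_sum (a * b))"
    unfolding bessel_sum_def
  proof (intro sums_mult summable_sums summable_comparison_test'[OF summable_exp[of "\<bar>a * b\<bar>"]])
    fix n
    have "(fact n :: real) * 1 \<le> fact n * fact (n + 1)"
      by (intro mult_left_mono fact_ge_1) auto
    then have "1 / (fact n * fact (n + 1)) \<le> (inverse (fact n) :: real)"
      unfolding inverse_eq_divide by (intro divide_left_mono) auto
    from mult_right_mono[OF this, of "\<bar>a * b\<bar> ^ n"]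
    show "norm (1 / (fact n * fact (n + 1)) * (a * b) ^ n) \<le> inverse (fact n) * \<bar>a * b\<bar> ^ n"
      by (simp add: abs_mult power_abs)
  qed
  also have "(\<lambda>j. a * (1 / (fact j * fact (j + 1)) * (a * b) ^ j)) = c"
    by (simp add: c_def fun_eq_iff power_mult_distrib)
  finally have "(\<lambda>j. 2 * pi * \<i> * of_real (c j)) sums (2 * pi * \<i> * of_real (a * bessel_sum (a * b)))"
    by (intro sums_mult sums_of_real)
  with s1 have "contour_integral (circlepath 0 1) (psi a b) = 2 * pi * \<i> * of_real (a * bessel_sum (a * b))"
    by (rule sums_unique2)
  moreover have "contour_integral (circlepath 0 1) (psi a b) = 2 * pi * \<i> * residue (psi a b) 0"
    by (intro contour_integral_unique base_residue[of UNIV]) (auto simp: psi_def[abs_def] intro!: holomorphic_intros)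
  ultimately show ?thesis by simp
qed

lemma norm_psi:
  "norm (psi a b w) = exp (a * Re w + b * Re (1 / w)) / (norm w)\<^sup>2"
  by (simp add: psi_def norm_divide norm_power norm_exp_eq_Re Re_divide)

lemma continuous_on_psi: "0 \<notin> S \<Longrightarrow> continuous_on S (psi a b)"
  unfolding psi_def[abs_def] by (intro continuous_intros) auto

lemma holomorphic_on_psi: "0 \<notin> S \<Longrightarrow> psi a b holomorphic_on S"
  unfolding psi_def[abs_def] by (intro holomorphic_intros) auto

lemma norm_psi_line:
  "norm (psi a b (Complex 1 t)) = exp (a + b * (1 / (1 + t\<^sup>2))) / (1 + t\<^sup>2)"
proof -
  have "(norm (Complex 1 t))\<^sup>2 = 1 + t\<^sup>2" "Re (1 / Complex 1 t) = 1 / (1 + t\<^sup>2)"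
    by (simp_all add: cmod_def Re_divide)
  then show ?thesis by (simp only: norm_psi complex.sel mult_1_right)
qed

text \<open>On Re w = 1 one has 1/|w|^2 = 1/(1 + t^2) = Re(1/w), so c bounds the exponent on the
  piece and the remaining density integrates to an arctangent.\<close>

lemma psi_vertical_bound:
  assumes st: "s \<le> t" and b: "b \<ge> 0" and c: "\<And>x. s \<le> x \<Longrightarrow> x \<le> t \<Longrightarrow> 1 / (1 + x\<^sup>2) \<le> c"
  shows "norm (contour_integral (linepath (Complex 1 s) (Complex 1 t)) (psi a b)) \<le> exp (a + b * c) * (arctan t - arctan s)"
proof (cases "s = t")
  case False
  define I where "I = contour_integral (linepath (Complex 1 s) (Complex 1 t)) (psi a b)"
  have "0 \<notin> closed_segment (Complex 1 s) (Complex 1 t)"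
    by (auto simp: closed_segment_same_Re)
  then have "psi a b contour_integrable_on linepath (Complex 1 s) (Complex 1 t)"
    by (intro contour_integrable_continuous_linepath continuous_on_psi)
  then have "(psi a b has_contour_integral I) (linepath (Complex 1 s) (Complex 1 t))"
    unfolding I_def by (rule has_contour_integral_integral)
  then have hi: "((\<lambda>x. psi a b (Complex 1 x)) has_integral (- \<i> * I)) {s..t}"
    using False st by (subst (asm) has_contour_integral_linepath_same_Re_iff[of _ 1 _ s t]) auto
  have "((\<lambda>x. 1 / (1 + x\<^sup>2)) has_integral (arctan t - arctan s)) {s..t}"
    by (intro fundamental_theorem_of_calculus st)
       (auto intro!: derivative_eq_intros simp: has_real_derivative_iff_has_vector_derivative[symmetric] divide_inverse)
  from has_integral_mult_right[OF this, of "exp (a + b * c)"]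
  have hg: "((\<lambda>x. exp (a + b * c) * (1 / (1 + x\<^sup>2))) has_integral exp (a + b * c) * (arctan t - arctan s)) {s..t}" .
  have "norm (integral {s..t} (\<lambda>x. psi a b (Complex 1 x))) \<le> integral {s..t} (\<lambda>x. exp (a + b * c) * (1 / (1 + x\<^sup>2)))"
  proof (rule Henstock_Kurzweil_Integration.integral_norm_bound_integral)
    show "(\<lambda>x. psi a b (Complex 1 x)) integrable_on {s..t}"
      "(\<lambda>x. exp (a + b * c) * (1 / (1 + x\<^sup>2))) integrable_on {s..t}"
      using hi hg by (auto simp: integrable_on_def)
    fix x assume "x \<in> {s..t}"
    then have "b * (1 / (1 + x\<^sup>2)) \<le> b * c" using b c by (intro mult_left_mono) auto
    then show "norm (psi a b (Complex 1 x)) \<le> exp (a + b * c) * (1 / (1 + x\<^sup>2))"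
      unfolding norm_psi_line by (simp add: divide_right_mono)
  qed
  then have "norm (- \<i> * I) \<le> exp (a + b * c) * (arctan t - arctan s)"
    using hi hg by (simp add: integral_unique)
  then show ?thesis by (simp add: I_def norm_mult)
qed auto

text \<open>The segment is completed to the right side of a rectangle around 0 of size R. The whole
  boundary gives the residue, the other three sides are O(1/R), and the two missing pieces of the
  line Re w = 1 are estimated by arctangents. Then R tends to infinity.\<close>

lemma psi_integral_approx:
  assumes ab: "a \<ge> 0" "b \<ge> 0" and T: "T1 \<ge> 0" "T2 \<ge> 0"
    and c: "1 / (1 + T1\<^sup>2) \<le> c" "1 / (1 + T2\<^sup>2) \<le> c"
  shows "norm (contour_integral (linepath (Complex 1 (- T1)) (Complex 1 T2)) (psi a b)
      - 2 * pi * \<i> * of_real (a * bessel_sum (a * b)))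
    \<le> exp (a + b * c) * ((pi / 2 - arctan T1) + (pi / 2 - arctan T2))"
    (is "norm (?I - ?B) \<le> ?E")
proof -
  have key: "norm (?I - ?B) \<le> ?E + 6 * exp (a + b) / R" if R: "R > T1" "R > T2" "R \<ge> 1" for R
  proof -
    define a1 where "a1 = Complex (- R) (- R)"
    define a3 where "a3 = Complex 1 R"
    have le: "Re a1 \<le> Re a3" "Im a1 \<le> Im a3" using R by (auto simp: a1_def a3_def)
    have 0: "0 \<in> box a1 a3" using R by (auto simp: a1_def a3_def in_box_complex_iff)
    have pim: "path_image (rectpath a1 a3) = cbox a1 a3 - box a1 a3"
      using path_image_rectpath_cbox_minus_box[OF le] .
    have "contour_integral (rectpath a1 a3) (psi a b) = 2 * pi * \<i> * (\<Sum>x\<in>{0}. winding_number (rectpath a1 a3) x * residue (psi a b) x)"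
    proof (rule Residue_theorem[of UNIV])
      show "path_image (rectpath a1 a3) \<subseteq> UNIV - {0}" unfolding pim using 0 by blast
    qed (simp_all add: holomorphic_on_psi connected_UNIV)
    then have B: "contour_integral (rectpath a1 a3) (psi a b) = ?B"
      using 0 by (simp add: winding_number_rectpath residue_psi)
    have cont: "continuous_on (path_image (rectpath a1 a3)) (psi a b)"
      using pim 0 by (intro continuous_on_psi) auto
    note ci = contour_integral_rectpath[OF cont]
    define I1 where "I1 = contour_integral (linepath a1 (Complex (Re a3) (Im a1))) (psi a b)"
    define I3 where "I3 = contour_integral (linepath a3 (Complex (Re a1) (Im a3))) (psi a b)"
    define I4 where "I4 = contour_integral (linepath (Complex (Re a1) (Im a3)) a1) (psi a b)"
    \<comment> \<open>On the three far sides Re x \<le> 1 and |x| \<ge> R \<ge> 1, hence also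
      Re(1/x) \<le> 1; the horizontal ones have length R + 1 \<le> 2R.\<close>
    have bnd: "norm (contour_integral (linepath u v) (psi a b)) \<le> exp (a + b) / R\<^sup>2 * (2 * R)"
      if "psi a b contour_integrable_on linepath u v" "norm (v - u) \<le> 2 * R"
        "\<And>x. x \<in> closed_segment u v \<Longrightarrow> Re x \<le> 1 \<and> (R \<le> \<bar>Re x\<bar> \<or> R \<le> \<bar>Im x\<bar>)" for u v
    proof -
      have "norm (contour_integral (linepath u v) (psi a b)) \<le> exp (a + b) / R\<^sup>2 * norm (v - u)"
      proof (rule contour_integral_bound_linepath[OF that(1)])
        fix x assume "x \<in> closed_segment u v"
        from that(3)[OF this] have x: "Re x \<le> 1" "R \<le> norm x"
          using abs_Re_le_cmod[of x] abs_Im_le_cmod[of x] by linarith+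
        have "norm (1 / x) \<le> 1" using x R by (simp add: norm_divide divide_le_eq)
        then have "Re (1 / x) \<le> 1" using complex_Re_le_cmod[of "1 / x"] by linarith
        then have "a * Re x + b * Re (1 / x) \<le> a * 1 + b * 1"
          using x ab by (intro add_mono mult_left_mono) auto
        moreover have "R\<^sup>2 \<le> (norm x)\<^sup>2" using x R by (intro power_mono) auto
        ultimately show "norm (psi a b x) \<le> exp (a + b) / R\<^sup>2"
          unfolding norm_psi using R by (intro frac_le) auto
      qed auto
      also have "\<dots> \<le> exp (a + b) / R\<^sup>2 * (2 * R)" using that by (intro mult_left_mono) auto
      finally show ?thesis .
    qed
    have b1: "norm I1 \<le> exp (a + b) / R\<^sup>2 * (2 * R)"
      unfolding I1_def using R
      by (intro bnd ci(2)) (auto simp: a1_def a3_def cmod_def real_sqrt_mult closed_segment_same_Im closed_segment_eq_real_ivl)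
    have b3: "norm I3 \<le> exp (a + b) / R\<^sup>2 * (2 * R)"
      unfolding I3_def using R
      by (intro bnd ci(4)) (auto simp: a1_def a3_def cmod_def real_sqrt_mult closed_segment_same_Im closed_segment_eq_real_ivl)
    have b4: "norm I4 \<le> exp (a + b) / R\<^sup>2 * (2 * R)"
      unfolding I4_def using R
      by (intro bnd ci(5)) (auto simp: a1_def a3_def cmod_def real_sqrt_mult closed_segment_same_Re closed_segment_eq_real_ivl)
    define K1 where "K1 = contour_integral (linepath (Complex 1 (- R)) (Complex 1 (- T1))) (psi a b)"
    define K2 where "K2 = contour_integral (linepath (Complex 1 T2) (Complex 1 R)) (psi a b)"
    have cont': "continuous_on (closed_segment (Complex 1 s) (Complex 1 t)) (psi a b)" for s t
      by (intro continuous_on_psi) (auto simp: closed_segment_same_Re)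
    have "contour_integral (linepath (Complex 1 (- R)) (Complex 1 R)) (psi a b) = K1 + contour_integral (linepath (Complex 1 (- T1)) (Complex 1 R)) (psi a b)"
      unfolding K1_def using R T by (intro contour_integral_split_linepath cont') (auto simp: closed_segment_same_Re closed_segment_eq_real_ivl)
    also have "contour_integral (linepath (Complex 1 (- T1)) (Complex 1 R)) (psi a b) = ?I + K2"
      unfolding K2_def using R T by (intro contour_integral_split_linepath cont') (auto simp: closed_segment_same_Re closed_segment_eq_real_ivl)
    finally have split: "contour_integral (linepath (Complex (Re a3) (Im a1)) a3) (psi a b) = K1 + ?I + K2"
      by (simp add: a1_def a3_def add_ac)
    have K2: "norm K2 \<le> exp (a + b * c) * (arctan R - arctan T2)"
      unfolding K2_def
    proof (rule psi_vertical_bound)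
      fix x assume "T2 \<le> x"
      then have "1 / (1 + x\<^sup>2) \<le> 1 / (1 + T2\<^sup>2)"
        using T by (intro divide_left_mono add_left_mono power_mono) (auto intro!: mult_pos_pos add_pos_nonneg)
      then show "1 / (1 + x\<^sup>2) \<le> c" using c by linarith
    qed (use R ab in auto)
    have K1: "norm K1 \<le> exp (a + b * c) * (arctan (- T1) - arctan (- R))"
      unfolding K1_def
    proof (rule psi_vertical_bound)
      fix x assume "x \<le> - T1"
      then have "T1\<^sup>2 \<le> (- x)\<^sup>2" using T by (intro power_mono) auto
      then have "1 / (1 + x\<^sup>2) \<le> 1 / (1 + T1\<^sup>2)"
        by (intro divide_left_mono add_left_mono) (auto intro!: mult_pos_pos add_pos_nonneg)
      then show "1 / (1 + x\<^sup>2) \<le> c" using c by linarith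
    qed (use R ab in auto)
    have at: "arctan R \<le> pi / 2" using arctan_ubound[of R] by simp
    have "?B = I1 + (K1 + ?I + K2) + I3 + I4"
      using ci(1) unfolding B split[symmetric] I1_def I3_def I4_def by (simp add: add_ac)
    then have eq: "?I - ?B = - K1 - K2 - I1 - I3 - I4" by (simp add: algebra_simps)
    have "norm (?I - ?B) \<le> norm K1 + norm K2 + norm I1 + norm I3 + norm I4"
      unfolding eq
      using norm_triangle_ineq4[of "- K1 - K2 - I1 - I3" I4] norm_triangle_ineq4[of "- K1 - K2 - I1" I3]
        norm_triangle_ineq4[of "- K1 - K2" I1] norm_triangle_ineq4[of "- K1" K2] norm_minus_cancel[of K1]
      by linarith
    also have "\<dots> \<le> exp (a + b * c) * (arctan (- T1) - arctan (- R)) + exp (a + b * c) * (arctan R - arctan T2)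
        + exp (a + b) / R\<^sup>2 * (2 * R) + exp (a + b) / R\<^sup>2 * (2 * R) + exp (a + b) / R\<^sup>2 * (2 * R)"
      by (intro add_mono K1 K2 b1 b3 b4)
    also have "\<dots> = exp (a + b * c) * ((arctan R - arctan T1) + (arctan R - arctan T2)) + 6 * exp (a + b) / R"
      using R by (simp add: arctan_minus field_simps power2_eq_square)
    also have "\<dots> \<le> ?E + 6 * exp (a + b) / R"
      using at by (intro add_right_mono mult_left_mono) auto
    finally show ?thesis .
  qed
  show ?thesis
  proof (rule tendsto_lowerbound)
    show "((\<lambda>R. ?E + 6 * exp (a + b) / R) \<longlongrightarrow> ?E) at_top"
      by (rule tendsto_eq_intros refl tendsto_divide_0[OF tendsto_const] filterlim_at_top_imp_at_infinity filterlim_ident)+ simp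
    show "\<forall>\<^sub>F R in at_top. norm (?I - ?B) \<le> ?E + 6 * exp (a + b) / R"
      using eventually_gt_at_top[of T1] eventually_gt_at_top[of T2] eventually_ge_at_top[of 1]
      by eventually_elim (rule key)
  qed simp
qed

lemma sin_ge_linear:
  assumes "0 \<le> x" "x \<le> pi / 2"
  shows "2 / pi * x \<le> sin x"
proof -
  have "convex_on {0..pi / 2} (\<lambda>x. - sin x)"
  proof (rule f''_ge0_imp_convex)
    fix x :: real assume x: "x \<in> {0..pi / 2}"
    show "((\<lambda>x. - sin x) has_real_derivative - cos x) (at x)"
      "((\<lambda>x. - cos x) has_real_derivative sin x) (at x)"
      by (auto intro!: derivative_eq_intros)
    show "0 \<le> sin x" using x pi_gt_zero by (intro sin_ge_zero) auto
  qed auto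
  from convex_onD[OF this, of "2 * x / pi" 0 "pi / 2"] assms show ?thesis
    by (simp add: field_simps)
qed

text \<open>The sine of the left-hand side is 1/sqrt(1 + T^2), and Jordan's inequality compares an
  angle with its sine; it is the origin of the factor pi/2.\<close>

lemma arctan_complement_le:
  assumes "T \<ge> 0"
  shows "pi / 2 - arctan T \<le> pi / 2 * (1 / sqrt (1 + T\<^sup>2))"
proof -
  have "0 \<le> pi / 2 - arctan T" "pi / 2 - arctan T \<le> pi / 2"
    using arctan_ubound[of T] assms by auto
  from sin_ge_linear[OF this] have "2 / pi * (pi / 2 - arctan T) \<le> 1 / sqrt (1 + T\<^sup>2)"
    by (simp only: sin_cos_eq[symmetric] cos_arctan[symmetric]) (simp add: sin_diff)
  then have "pi / 2 * (2 / pi * (pi / 2 - arctan T)) \<le> pi / 2 * (1 / sqrt (1 + T\<^sup>2))"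
    by (intro mult_left_mono) auto
  then show ?thesis by simp
qed

text \<open>The map z -> 1/z does not send a segment to a segment. On the right half-plane, however,
  both integrands have primitives, g and -g(1/w), so only the end points matter and the image arc
  may be replaced by a straight segment.\<close>

lemma contour_integral_inversion:
  assumes "Re z1 > 0" "Re z2 > 0"
  shows "contour_integral (linepath z1 z2) (\<lambda>z. exp (of_real a / z + of_real b * z))
    = - contour_integral (linepath (1 / z1) (1 / z2)) (psi a b)"
proof -
  define S where "S = {z. Re z > 0}"
  have S: "convex S" "open S" unfolding S_def by (auto simp: convex_halfspace_Re_gt open_halfspace_Re_gt)
  have inv: "1 / z \<in> S" if "z \<in> S" for z
    using that by (simp add: S_def Re_divide add_pos_nonneg)
  have "(\<lambda>z. exp (of_real a / z + of_real b * z)) holomorphic_on S"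
    by (intro holomorphic_intros) (auto simp: S_def)
  from holomorphic_convex_primitive'[OF S this] obtain g where
    g: "\<And>z. z \<in> S \<Longrightarrow> (g has_field_derivative exp (of_real a / z + of_real b * z)) (at z within S)" by blast
  have sub: "path_image (linepath u v) \<subseteq> S" if "u \<in> S" "v \<in> S" for u v
    using that S closed_segment_subset[of u S v] by simp
  have z: "z1 \<in> S" "z2 \<in> S" using assms by (auto simp: S_def)
  have 1: "contour_integral (linepath z1 z2) (\<lambda>z. exp (of_real a / z + of_real b * z)) = g z2 - g z1"
    using contour_integral_primitive[OF g, where g = "linepath z1 z2"] sub[OF z]
    by (intro contour_integral_unique) auto
  have "((\<lambda>w. - g (1 / w)) has_field_derivative psi a b w) (at w within S)" if w: "w \<in> S" for w
  proof -
    have "(g has_field_derivative exp (of_real a / (1 / w) + of_real b * (1 / w))) (at (1 / w))"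
      using g[OF inv[OF w]] at_within_open[OF inv[OF w] S(2)] by simp
    moreover have "((\<lambda>w. 1 / w) has_field_derivative - (1 / w\<^sup>2)) (at w within S)"
      using w by (auto intro!: derivative_eq_intros simp: S_def power2_eq_square)
    ultimately have "((\<lambda>w. g (1 / w)) has_field_derivative exp (of_real a / (1 / w) + of_real b * (1 / w)) * - (1 / w\<^sup>2)) (at w within S)"
      by (rule DERIV_chain2)
    from DERIV_minus[OF this] show ?thesis by (simp add: psi_def)
  qed
  from contour_integral_primitive[OF this, where g = "linepath (1 / z1) (1 / z2)"] sub[OF inv[OF z(1)] inv[OF z(2)]]
  have "contour_integral (linepath (1 / z1) (1 / z2)) (psi a b) = - g z2 - (- g z1)"
    by (intro contour_integral_unique) auto
  then show ?thesis unfolding 1 by simp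
qed

section \<open>Farey fractions and Ford circles\<close>

lemma residue_in_window:
  assumes "0 < k" "k \<le> (M::nat)"
  shows "\<exists>x. M < k + x \<and> x \<le> M \<and> [x = r] (mod k)"
proof -
  define d where "d = (int M - int r) mod int k"
  have d: "0 \<le> d" "d < int k" using assms by (auto simp: d_def)
  define x where "x = nat (int M - d)"
  have x: "int x = int M - d" using d assms by (simp add: x_def)
  have "[int M - d = int M - (int M - int r)] (mod int k)"
    unfolding d_def by (intro cong_diff) (auto simp: cong_def)
  then have "[int x = int r] (mod int k)" unfolding x by simp
  then have "[x = r] (mod k)" by (simp add: cong_int_iff)
  moreover have "M < k + x" "x \<le> M" using x d by linarith+
  ultimately show ?thesis by blast
qed

lemma window_unique:
  assumes "[x = y] (mod (k::nat))" "M < k + x" "x \<le> M" "M < k + y" "y \<le> M"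
  shows "x = y"
proof -
  have "int k dvd int x - int y"
    using assms(1) by (simp add: cong_int_iff[symmetric] cong_iff_dvd_diff)
  moreover have "\<bar>int x - int y\<bar> < int k" using assms by linarith
  ultimately have "int x - int y = 0"
    using dvd_imp_le_int[of "int x - int y" "int k"] by fastforce
  then show ?thesis by simp
qed

text \<open>The denominator of the right neighbour of h/k in the Farey sequence of order M: the
  largest x \<le> M for which (h x + 1)/k is an integer. \<open>farey_left\<close> does the same for
  the left neighbour with (h x - 1)/k. The neighbours are thus found without listing the
  sequence.\<close>

definition farey_right :: "nat \<Rightarrow> nat \<Rightarrow> nat \<Rightarrow> nat" where
  "farey_right M h k = (SOME x. M < k + x \<and> x \<le> M \<and> k dvd h * x + 1)"

definition farey_left :: "nat \<Rightarrow> nat \<Rightarrow> nat \<Rightarrow> nat" where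
  "farey_left M h k = (SOME x. M < k + x \<and> x \<le> M \<and> [h * x = 1] (mod k))"

lemma farey_right:
  assumes "coprime h k" "0 < k" "k \<le> M"
  shows "M < k + farey_right M h k" "farey_right M h k \<le> M" "k dvd h * farey_right M h k + 1"
proof -
  obtain r where r: "[h * r = 1] (mod k)"
    using assms(1) cong_solve_coprime_nat by auto
  \<comment> \<open>Multiplication by k - 1 is negation modulo k, written in natural
    numbers.\<close>
  obtain x where x: "M < k + x" "x \<le> M" "[x = r * (k - 1)] (mod k)"
    using residue_in_window[OF assms(2,3)] by blast
  have "[h * x + 1 = (h * r) * (k - 1) + 1] (mod k)"
    using cong_scalar_left[OF x(3), of h] by (intro cong_add) (auto simp: mult_ac)
  also have "[(h * r) * (k - 1) + 1 = 1 * (k - 1) + 1] (mod k)"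
    by (intro cong_add cong_mult r) auto
  also have "1 * (k - 1) + 1 = k" using assms by simp
  finally have "k dvd h * x + 1" by (simp add: cong_def dvd_eq_mod_eq_0)
  with x have "\<exists>x. M < k + x \<and> x \<le> M \<and> k dvd h * x + 1" by blast
  from someI_ex[OF this] show "M < k + farey_right M h k" "farey_right M h k \<le> M" "k dvd h * farey_right M h k + 1"
    unfolding farey_right_def by auto
qed

lemma farey_left:
  assumes "coprime h k" "0 < k" "k \<le> M"
  shows "M < k + farey_left M h k" "farey_left M h k \<le> M" "[h * farey_left M h k = 1] (mod k)"
proof -
  obtain r where r: "[h * r = 1] (mod k)"
    using assms(1) cong_solve_coprime_nat by auto
  obtain x where x: "M < k + x" "x \<le> M" "[x = r] (mod k)"
    using residue_in_window[OF assms(2,3)] by blast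
  have "[h * x = 1] (mod k)"
    using cong_trans[OF cong_scalar_left[OF x(3), of h] r] .
  with x have "\<exists>x. M < k + x \<and> x \<le> M \<and> [h * x = 1] (mod k)" by blast
  from someI_ex[OF this] show "M < k + farey_left M h k" "farey_left M h k \<le> M" "[h * farey_left M h k = 1] (mod k)"
    unfolding farey_left_def by auto
qed

lemma farey_left_unique:
  assumes "coprime h k" "0 < k" "k \<le> M" "M < k + x" "x \<le> M" "[h * x = 1] (mod k)"
  shows "farey_left M h k = x"
proof (rule window_unique)
  have "[h * farey_left M h k = h * x] (mod k)"
    using farey_left(3)[OF assms(1-3)] assms(6) by (metis cong_sym cong_trans)
  then show "[farey_left M h k = x] (mod k)"
    using assms(1) by (simp add: cong_mult_lcancel_nat)
qed (use farey_left[OF assms(1-3)] assms in auto)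

text \<open>The point where the Ford circle at h/k, with centre h/k + i/(2 k^2) and radius 1/(2
  k^2), touches the one at the left neighbour; \<open>ford_right\<close> is the contact on the other
  side.\<close>

definition ford_left :: "nat \<Rightarrow> nat \<Rightarrow> nat \<Rightarrow> complex" where
  "ford_left M h k = of_nat h / of_nat k + \<i> / (of_nat k * (of_nat k - \<i> * of_nat (farey_left M h k)))"

definition ford_right :: "nat \<Rightarrow> nat \<Rightarrow> nat \<Rightarrow> complex" where
  "ford_right M h k = of_nat h / of_nat k + \<i> / (of_nat k * (of_nat k + \<i> * of_nat (farey_right M h k)))"

definition farey :: "nat \<Rightarrow> (nat \<times> nat) set" where
  "farey M = {(h, k). 0 < k \<and> k \<le> M \<and> h < k \<and> coprime h k}"

definition farey_succ :: "nat \<Rightarrow> nat \<times> nat \<Rightarrow> nat \<times> nat" where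
  "farey_succ M = (\<lambda>(h, k). ((h * farey_right M h k + 1) div k, farey_right M h k))"

lemma finite_farey [simp]: "finite (farey M)"
  by (rule finite_subset[of _ "{..M} \<times> {..M}"]) (auto simp: farey_def)

lemma ford_tangent:
  assumes "k > 0" "k' > 0" "h' * k = h * k' + (1::nat)"
  shows "of_nat h / of_nat k + \<i> / (of_nat k * (of_nat k + \<i> * of_nat k'))
       = (of_nat h' / of_nat k' + \<i> / (of_nat k' * (of_nat k' - \<i> * of_nat k)) :: complex)"
proof -
  define a b where "a = complex_of_nat k" and "b = complex_of_nat k'"
  have nz: "a \<noteq> 0" "b \<noteq> 0" "a + \<i> * b \<noteq> 0"
    using assms by (auto simp: a_def b_def complex_eq_iff)
  have rel: "of_nat h' * a = of_nat h * b + 1"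
    using arg_cong[OF assms(3), of complex_of_nat] by (simp add: a_def b_def)
  have "b - \<i> * a = - \<i> * (a + \<i> * b)" by (simp add: algebra_simps)
  moreover have "\<i> / (b * (- \<i> * c)) = - 1 / (b * c)" for c
    by (simp add: divide_simps)
  ultimately have "\<i> / (b * (b - \<i> * a)) = - 1 / (b * (a + \<i> * b))" by metis
  moreover have "\<i> / (a * (a + \<i> * b)) + 1 / (b * (a + \<i> * b)) = 1 / (a * b)"
  proof -
    have "\<i> / (a * (a + \<i> * b)) + 1 / (b * (a + \<i> * b)) = (\<i> * b + a) / (a * b * (a + \<i> * b))"
      using nz(1,2) by (simp add: add_divide_distrib)
    also have "\<dots> = 1 / (a * b)" using nz by (simp add: add.commute)
    finally show ?thesis .
  qed
  moreover have "of_nat h' / b = of_nat h / a + 1 / (a * b)"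
    using rel nz by (simp add: field_simps)
  ultimately show ?thesis unfolding a_def[symmetric] b_def[symmetric]
    by (simp add: algebra_simps)
qed

text \<open>The determinant relation h' k - h k' = 1 gives everything. The window condition M < k +
  k' is symmetric in k and k', so k satisfies the conditions that characterise the left neighbour of
  h'/k', and the two expressions for the point of contact agree by
  \<open>ford_tangent\<close>.\<close>

lemma farey_succ:
  assumes "(h, k) \<in> farey M" and "farey_succ M (h, k) = (h', k')"
  shows "h' * k = h * k' + 1" "0 < k'" "k' \<le> M" "0 < h'" "h' \<le> k'" "coprime h' k'"
    "farey_left M h' k' = k" "ford_left M h' k' = ford_right M h k"
proof -
  have hk: "0 < k" "k \<le> M" "h < k" "coprime h k" using assms(1) by (auto simp: farey_def)
  note fr = farey_right[OF hk(4,1,2)]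
  have k': "k' = farey_right M h k" and h': "h' = (h * k' + 1) div k"
    using assms(2) by (auto simp: farey_succ_def)
  show rel: "h' * k = h * k' + 1" unfolding h' using fr(3) by (simp add: k')
  show k'0: "0 < k'" "k' \<le> M" using fr hk by (auto simp: k')
  have "h' \<noteq> 0" using rel by (intro notI) simp
  then show h'0: "0 < h'" by simp
  have "(h + 1) * k' \<le> k * k'" using hk by (intro mult_right_mono) auto
  then have "h' * k \<le> k' * k" using rel k'0 by (simp add: algebra_simps)
  then show le: "h' \<le> k'" using hk by simp
  show cop: "coprime h' k'"
  proof (rule coprimeI)
    fix d assume "d dvd h'" "d dvd k'"
    then have "d dvd h * k' + 1" "d dvd h * k'" unfolding rel[symmetric] by auto
    then show "is_unit d" using dvd_add_right_iff[of d "h * k'" 1] by simp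
  qed
  show left: "farey_left M h' k' = k"
  proof (rule farey_left_unique[OF cop k'0])
    show "M < k' + k" using fr by (simp add: k')
    show "[h' * k = 1] (mod k')" unfolding rel cong_def by (rule mod_mult_self3)
  qed (use hk in auto)
  show "ford_left M h' k' = ford_right M h k"
    unfolding ford_left_def ford_right_def left k'[symmetric]
    by (rule ford_tangent[symmetric]) (use rel hk k'0 in auto)
qed

text \<open>No ordering of the fractions is used. The successor map is a bijection from the
  fractions in [0, 1) to those in (0, 1] that turns right contact points into left ones, so all
  terms cancel except those of 1/1 and 0/1, whose contact points differ by 1.\<close>

lemma farey_telescope:
  fixes \<Phi> :: "complex \<Rightarrow> 'a :: ab_group_add"
  assumes M: "M > 0"
  shows "(\<Sum>(h, k)\<in>farey M. \<Phi> (ford_right M h k) - \<Phi> (ford_left M h k))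
     = \<Phi> (ford_left M 0 1 + 1) - \<Phi> (ford_left M 0 1)"
proof -
  \<comment> \<open>The reduced fractions in (0, 1]: 0/1 is exchanged for 1/1, so the cardinality is
    that of \<open>farey M\<close>, and injectivity of the successor implies surjectivity.\<close>
  define S' where "S' = {(h, k). 0 < k \<and> k \<le> M \<and> 0 < h \<and> h \<le> k \<and> coprime h k}"
  have S'_eq: "S' = insert (1, 1) (farey M - {(0, 1)})"
  proof (intro equalityI subsetI)
    fix x assume x: "x \<in> S'"
    obtain h k where [simp]: "x = (h, k)" by (cases x)
    show "x \<in> insert (1, 1) (farey M - {(0, 1)})"
      using x by (cases "h = k") (auto simp: S'_def farey_def)
  next
    fix x assume x: "x \<in> insert (1, 1) (farey M - {(0, 1)})"
    obtain h k where [simp]: "x = (h, k)" by (cases x)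
    have "h \<noteq> 0" using x by (intro notI) (auto simp: farey_def)
    then show "x \<in> S'" using x M by (auto simp: S'_def farey_def)
  qed
  have in1: "(0, 1) \<in> farey M" "(1, 1) \<notin> farey M" using M by (auto simp: farey_def)
  have fin: "finite S'" unfolding S'_eq by simp
  have card: "card S' = card (farey M)"
    unfolding S'_eq using in1 by (simp add: card_Suc_Diff1 del: card_Diff_insert)
  have into: "farey_succ M ` farey M \<subseteq> S'"
  proof clarify
    fix h k h' k' assume *: "(h, k) \<in> farey M" "(h', k') = farey_succ M (h, k)"
    from farey_succ[OF this(1) this(2)[symmetric]] show "(h', k') \<in> S'" by (simp add: S'_def)
  qed
  have inj: "inj_on (farey_succ M) (farey M)"
  proof (rule inj_onI, clarify)
    fix h1 k1 h2 k2
    assume 1: "(h1, k1) \<in> farey M" and 2: "(h2, k2) \<in> farey M"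
      and eq: "farey_succ M (h1, k1) = farey_succ M (h2, k2)"
    obtain h' k' where s: "farey_succ M (h2, k2) = (h', k')" by (cases "farey_succ M (h2, k2)")
    note f1 = farey_succ[OF 1 trans[OF eq s]] and f2 = farey_succ[OF 2 s]
    have k: "k1 = k2" using f1(7) f2(7) by simp
    have "h1 * k' = h2 * k'" using f1(1) f2(1) unfolding k by (metis add_right_cancel)
    then have "h1 = h2" using f1(2) by auto
    with k show "h1 = h2 \<and> k1 = k2" by simp
  qed
  have img: "farey_succ M ` farey M = S'"
    using into fin card by (intro card_subset_eq) (auto simp: card_image[OF inj])
  have "(\<Sum>(h, k)\<in>farey M. \<Phi> (ford_right M h k)) = (\<Sum>x\<in>farey M. (\<lambda>(h, k). \<Phi> (ford_left M h k)) (farey_succ M x))"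
  proof (rule sum.cong[OF refl], clarify)
    fix h k assume x: "(h, k) \<in> farey M"
    obtain h' k' where s: "farey_succ M (h, k) = (h', k')" by (cases "farey_succ M (h, k)")
    then show "\<Phi> (ford_right M h k) = (case farey_succ M (h, k) of (h, k) \<Rightarrow> \<Phi> (ford_left M h k))"
      using farey_succ(8)[OF x s] by simp
  qed
  also have "\<dots> = (\<Sum>(h, k)\<in>S'. \<Phi> (ford_left M h k))"
    unfolding img[symmetric] by (subst sum.reindex[OF inj]) simp
  also have "\<dots> = \<Phi> (ford_left M 1 1) + (\<Sum>(h, k)\<in>farey M - {(0, 1)}. \<Phi> (ford_left M h k))"
    unfolding S'_eq using in1 by (subst sum.insert) auto
  also have "(\<Sum>(h, k)\<in>farey M - {(0, 1)}. \<Phi> (ford_left M h k))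
      = (\<Sum>(h, k)\<in>farey M. \<Phi> (ford_left M h k)) - \<Phi> (ford_left M 0 1)"
    using in1 by (subst sum_diff) auto
  also have "ford_left M 1 1 = ford_left M 0 1 + 1"
  proof -
    have "farey_left M 1 1 = M" "farey_left M 0 1 = M"
      using M by (intro farey_left_unique; simp)+
    then show ?thesis unfolding ford_left_def by simp
  qed
  finally have "(\<Sum>(h, k)\<in>farey M. \<Phi> (ford_right M h k)) =
     \<Phi> (ford_left M 0 1 + 1) - \<Phi> (ford_left M 0 1) + (\<Sum>(h, k)\<in>farey M. \<Phi> (ford_left M h k))"
    by simp
  moreover have "(\<Sum>(h, k)\<in>farey M. \<Phi> (ford_right M h k) - \<Phi> (ford_left M h k))
     = (\<Sum>(h, k)\<in>farey M. \<Phi> (ford_right M h k)) - (\<Sum>(h, k)\<in>farey M. \<Phi> (ford_left M h k))"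
    by (simp add: sum_subtractf case_prod_unfold)
  ultimately show ?thesis by simp
qed

section \<open>Coefficients as contour integrals\<close>

definition integrand :: "nat \<Rightarrow> real \<Rightarrow> nat \<Rightarrow> complex \<Rightarrow> complex" where
  "integrand p \<delta> n \<tau> = exp (of_real \<delta> * logG p (exp (tpi * \<tau>))) * exp (- (tpi * of_nat n * \<tau>))"

lemma norm_exp_upper: "Im \<tau> > 0 \<Longrightarrow> norm (exp (tpi * \<tau>)) < 1"
  by (simp add: norm_exp_eq_Re)

lemma holomorphic_integrand:
  assumes "p > 0"
  shows "integrand p \<delta> n holomorphic_on {\<tau>. Im \<tau> > 0}"
proof -
  have "logG p \<circ> (\<lambda>\<tau>. exp (tpi * \<tau>)) holomorphic_on {\<tau>. Im \<tau> > 0}"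
    by (rule holomorphic_on_compose_gen[OF _ holomorphic_logG[OF assms]])
       (use norm_exp_upper in \<open>auto intro!: holomorphic_intros\<close>)
  then show ?thesis unfolding integrand_def[abs_def] o_def by (intro holomorphic_intros)
qed

text \<open>Cauchy's formula on the circle of radius e^(-2 pi), which is the image of the segment
  from i to i + 1 under e^(2 pi i \<tau>). The factor q of dq turns q^(n+1) into q^n, and 2 pi i
  cancels.\<close>

lemma borwein_coeff_eq_contour_integral:
  assumes "p > 0"
  shows "(integrand p \<delta> n has_contour_integral borwein_coeff p \<delta> n) (linepath \<i> (\<i> + 1))"
proof -
  define g where "g q = exp (of_real \<delta> * borwein_log_G p q)" for q
  define r where "r = exp (- 2 * pi)"
  have r: "0 < r" "r < 1" by (auto simp: r_def)
  have "(\<lambda>q. exp (of_real \<delta> * logG p q)) holomorphic_on ball 0 1"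
    by (intro holomorphic_intros holomorphic_logG assms)
  then have hol: "g holomorphic_on ball 0 1"
    by (rule holomorphic_transform) (simp add: g_def borwein_log_G_eq[OF assms])
  have "((\<lambda>u. g u / (u - 0) ^ Suc n) has_contour_integral (2 * pi * \<i> / fact n) * (deriv ^^ n) g 0) (circlepath 0 r)"
    by (rule Cauchy_has_contour_integral_higher_derivative_circlepath)
       (use r in \<open>auto intro!: holomorphic_on_imp_continuous_on holomorphic_on_subset[OF hol]\<close>)
  moreover have "(2 * pi * \<i> / fact n) * (deriv ^^ n) g 0 = 2 * pi * \<i> * borwein_coeff p \<delta> n"
    by (simp add: borwein_coeff_def fps_expansion_def g_def[abs_def])
  ultimately have "((\<lambda>t. g (circlepath 0 r t) / circlepath 0 r t ^ Suc n * vector_derivative (circlepath 0 r) (at t within {0..1}))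
      has_integral 2 * pi * \<i> * borwein_coeff p \<delta> n) {0..1}"
    by (simp add: has_contour_integral_def)
  then have "((\<lambda>t. 2 * pi * \<i> * integrand p \<delta> n (linepath \<i> (\<i> + 1) t)) has_integral 2 * pi * \<i> * borwein_coeff p \<delta> n) {0..1}"
  proof (rule has_integral_eq[rotated])
    fix t :: real assume t: "t \<in> {0..1}"
    define q where "q = exp (tpi * (\<i> + of_real t))"
    have q: "circlepath 0 r t = q"
      by (simp add: circlepath r_def q_def exp_of_real[symmetric] exp_add[symmetric] algebra_simps)
    have l: "linepath \<i> (\<i> + 1) t = \<i> + of_real t"
      by (simp add: linepath_def scaleR_conv_of_real algebra_simps)
    have "norm q < 1" unfolding q_def by (rule norm_exp_upper) simp
    then have gq: "g q = exp (of_real \<delta> * logG p q)" by (simp add: g_def borwein_log_G_eq[OF assms])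
    have qn: "exp (- (tpi * of_nat n * (\<i> + of_real t))) = 1 / q ^ n"
      unfolding q_def exp_of_nat_mult[symmetric]
      by (simp only: inverse_eq_divide[symmetric] exp_minus[symmetric] mult_ac)
    have "vector_derivative (circlepath 0 r) (at t within {0..1}) = 2 * pi * \<i> * q"
      using vector_derivative_circlepath01[of t 0 r] t unfolding q[symmetric] circlepath[of 0 r]
      by (simp add: mult_ac)
    then have "g (circlepath 0 r t) / circlepath 0 r t ^ Suc n * vector_derivative (circlepath 0 r) (at t within {0..1})
      = 2 * pi * \<i> * (g q / q ^ n)"
      unfolding q by (simp add: q_def)
    also have "g q / q ^ n = integrand p \<delta> n (\<i> + of_real t)"
      unfolding integrand_def qn gq q_def[symmetric] by simp
    finally show "g (circlepath 0 r t) / circlepath 0 r t ^ Suc n * vector_derivative (circlepath 0 r) (at t within {0..1})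
      = 2 * pi * \<i> * integrand p \<delta> n (linepath \<i> (\<i> + 1) t)" unfolding l .
  qed
  from has_integral_mult_right[OF this, of "1 / (2 * pi * \<i>)"]
  have "((\<lambda>t. integrand p \<delta> n (linepath \<i> (\<i> + 1) t)) has_integral borwein_coeff p \<delta> n) {0..1}" by simp
  then show ?thesis by (simp add: has_contour_integral_linepath)
qed

lemma integrand_periodic: "integrand p \<delta> n (\<tau> + 1) = integrand p \<delta> n \<tau>"
proof -
  have "exp (tpi * (\<tau> + 1)) = exp (tpi * \<tau>)"
    using exp_2pi_i_of_int[of 1] by (simp add: distrib_left exp_add)
  moreover have "exp (- (tpi * of_nat n * (\<tau> + 1))) = exp (- (tpi * of_nat n * \<tau>))"
    using exp_2pi_i_of_int[of "- int n"] by (simp add: distrib_left exp_add exp_diff exp_minus)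
  ultimately show ?thesis by (simp only: integrand_def)
qed

text \<open>In the coordinate z the Ford circle at h/k is always |z - 1/2| = 1/2, whatever h and k
  are.\<close>

abbreviation farey_point :: "nat \<Rightarrow> nat \<Rightarrow> complex \<Rightarrow> complex" where
  "farey_point h k z \<equiv> of_nat h / of_nat k + \<i> / (of_nat k)\<^sup>2 * z"

lemma ford_left_alt:
  "ford_left M h k = of_nat h / of_nat k + \<i> / (of_nat k)\<^sup>2 * (of_nat k / (of_nat k - \<i> * of_nat (farey_left M h k)))"
  and ford_right_alt:
  "ford_right M h k = of_nat h / of_nat k + \<i> / (of_nat k)\<^sup>2 * (of_nat k / (of_nat k + \<i> * of_nat (farey_right M h k)))"
  by (simp_all add: ford_left_def ford_right_def power2_eq_square)

lemma Re_ford_pos: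
  assumes "k > 0"
  shows "Re (of_nat k / (of_nat k - \<i> * of_nat m)) > 0" "Re (of_nat k / (of_nat k + \<i> * of_nat m)) > 0"
proof -
  have "0 < (real k)\<^sup>2 + (real m)\<^sup>2" using assms by (simp add: add_pos_nonneg)
  then show "Re (of_nat k / (of_nat k - \<i> * of_nat m)) > 0" "Re (of_nat k / (of_nat k + \<i> * of_nat m)) > 0"
    using assms by (simp_all add: Re_divide)
qed

lemma Im_farey_point: "Im (farey_point h k z) = Re z / (real k)\<^sup>2"
proof -
  have "of_nat h / of_nat k + \<i> / (of_nat k)\<^sup>2 * z = of_real (real h / real k) + \<i> * z / of_real ((real k)\<^sup>2)"
    by simp
  then show ?thesis by (simp only: Im_divide_of_real plus_complex.sel Im_complex_of_real) simp
qed

lemma Im_ford_pos: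
  assumes "k > 0"
  shows "Im (ford_left M h k) > 0" "Im (ford_right M h k) > 0"
  unfolding ford_left_alt ford_right_alt Im_farey_point
  using assms Re_ford_pos[OF assms] by (auto intro!: divide_pos_pos)

text \<open>With a primitive \<Phi> of the periodic integrand, \<Phi>(\<tau> + 1) - \<Phi>(\<tau>)
  has derivative 0. So its value at the starting point of the polygon is its value at i, which is
  the coefficient; the vertical sides of a deformation never appear.\<close>

lemma borwein_coeff_eq_sum:
  assumes p: "p > 0" and M: "M > 0"
  shows "borwein_coeff p \<delta> n =
    (\<Sum>(h, k)\<in>farey M. contour_integral (linepath (ford_left M h k) (ford_right M h k)) (integrand p \<delta> n))"
proof -
  define H where "H = {\<tau>. Im \<tau> > 0}"
  have H: "convex H" "open H" unfolding H_def by (auto simp: convex_halfspace_Im_gt open_halfspace_Im_gt)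
  from holomorphic_convex_primitive'[OF H holomorphic_integrand[OF p, folded H_def]]
  obtain \<Phi> where \<Phi>: "\<And>\<tau>. \<tau> \<in> H \<Longrightarrow> (\<Phi> has_field_derivative integrand p \<delta> n \<tau>) (at \<tau> within H)" by metis
  have prim: "(integrand p \<delta> n has_contour_integral \<Phi> v - \<Phi> u) (linepath u v)" if "u \<in> H" "v \<in> H" for u v
    using contour_integral_primitive[OF \<Phi>, where g = "linepath u v"] closed_segment_subset[OF that H(1)] by simp
  have "\<exists>c. \<forall>\<tau>\<in>H. \<Phi> (\<tau> + 1) - \<Phi> \<tau> = c"
  proof (rule has_field_derivative_zero_constant[OF H(1)])
    fix \<tau> assume t: "\<tau> \<in> H"
    then have t1: "\<tau> + 1 \<in> H" by (simp add: H_def)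
    have "(\<Phi> has_field_derivative integrand p \<delta> n (\<tau> + 1)) (at (\<tau> + 1))"
      using \<Phi>[OF t1] at_within_open[OF t1 H(2)] by simp
    then have "((\<lambda>\<tau>. \<Phi> (\<tau> + 1)) has_field_derivative integrand p \<delta> n (\<tau> + 1) * 1) (at \<tau> within H)"
      by (rule DERIV_chain2) (auto intro!: derivative_eq_intros)
    from DERIV_diff[OF this \<Phi>[OF t]]
    show "((\<lambda>\<tau>. \<Phi> (\<tau> + 1) - \<Phi> \<tau>) has_field_derivative 0) (at \<tau> within H)"
      by (simp add: integrand_periodic)
  qed
  then obtain c where c: "\<And>\<tau>. \<tau> \<in> H \<Longrightarrow> \<Phi> (\<tau> + 1) - \<Phi> \<tau> = c" by blast
  have "(integrand p \<delta> n has_contour_integral \<Phi> (\<i> + 1) - \<Phi> \<i>) (linepath \<i> (\<i> + 1))"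
    by (rule prim) (auto simp: H_def)
  then have "\<Phi> (\<i> + 1) - \<Phi> \<i> = borwein_coeff p \<delta> n"
    using borwein_coeff_eq_contour_integral[OF p] by (rule has_contour_integral_unique)
  then have c_eq: "c = borwein_coeff p \<delta> n" using c[of \<i>] by (simp add: H_def)
  have "(\<Sum>(h, k)\<in>farey M. contour_integral (linepath (ford_left M h k) (ford_right M h k)) (integrand p \<delta> n))
    = (\<Sum>(h, k)\<in>farey M. \<Phi> (ford_right M h k) - \<Phi> (ford_left M h k))"
    by (intro sum.cong refl) (auto simp: farey_def H_def Im_ford_pos intro!: contour_integral_unique prim)
  also have "\<dots> = \<Phi> (ford_left M 0 1 + 1) - \<Phi> (ford_left M 0 1)"
    by (rule farey_telescope[OF M])
  also have "\<dots> = c" by (rule c) (simp add: H_def Im_ford_pos)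
  finally show ?thesis using c_eq by simp
qed

section \<open>The integrand near a Farey fraction\<close>

lemma contour_integral_linepath_affine:
  "contour_integral (linepath (c + m * u) (c + m * v)) f = m * contour_integral (linepath u v) (\<lambda>z. f (c + m * z))"
proof -
  have "linepath (c + m * u) (c + m * v) t = c + m * linepath u v t" for t
    by (simp add: linepath_def scaleR_conv_of_real algebra_simps)
  then have "contour_integral (linepath (c + m * u) (c + m * v)) f
      = integral {0..1} (\<lambda>t. m * (f (c + m * linepath u v t) * (v - u)))"
    by (simp add: contour_integral_integral algebra_simps)
  also have "\<dots> = m * integral {0..1} (\<lambda>t. f (c + m * linepath u v t) * (v - u))"
    by simp
  also have "integral {0..1} (\<lambda>t. f (c + m * linepath u v t) * (v - u)) = contour_integral (linepath u v) (\<lambda>z. f (c + m * z))"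
    by (simp add: contour_integral_integral)
  finally show ?thesis .
qed

lemma exp_farey_point:
  assumes "k > 0"
  shows "exp (tpi * (farey_point h k z))
    = nome h k (z / of_nat k)"
  using assms by (intro arg_cong[of _ _ exp]) (simp add: field_simps power2_eq_square)

abbreviation excess :: "nat \<Rightarrow> real \<Rightarrow> nat \<Rightarrow> real" where
  "excess p \<delta> n \<equiv> 24 * real n - (real p - 1) * \<delta>"

text \<open>If k = p k0, then q^p lies near h/k0 with the same scaled variable w = z/k as q near
  h/k. Hence the terms Ln w / 2 cancel and no power of z survives; the difference 1/k0 - 1/k = (p -
  1)/k produces the exponent a/z, and the factor e^(-2 pi i n \<tau>) completes the coefficient of
  z.\<close>

lemma integrand_transform_dvd:
  fixes p h k H n :: nat and \<delta> :: real
  assumes p: "p > 0" "p dvd k" and k: "k > 0" and hH: "k dvd h * H + 1" and z: "Re z > 0"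
  defines "q \<equiv> nome H k (of_nat k / z)"
  shows "integrand p \<delta> n (farey_point h k z) =
    omega_ratio_power \<delta> p h k * exp (- (tpi * of_nat h * of_nat n / of_nat k)) *
    (exp (of_real \<delta> * logG p q) *
     exp (of_real (pi * \<delta> * (real p - 1) / 12) / z + of_real (pi * excess p \<delta> n / (12 * (real k)\<^sup>2)) * z))"
    and "norm q = exp (- 2 * pi * Re (1 / z))"
proof -
  obtain k0 where k0: "k = p * k0" using p by auto
  have k0p: "k0 > 0" using k k0 by (auto intro: Nat.gr0I)
  have kdiv: "k div p = k0" using k0 p by simp
  define w where "w = z / of_nat k"
  have z0: "z \<noteq> 0" using z by auto
  have w: "Re w > 0" using z k by (simp add: w_def Re_divide_of_nat)
  have iw: "1 / w = of_nat k / z" by (simp add: w_def)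
  \<comment> \<open>One H serves both denominators, so the dual nomes are again q^p and q for a
    single q, and the two \<open>logf\<close> terms recombine to \<open>logG p q\<close>.\<close>
  have hH0: "k0 dvd h * H + 1" using hH unfolding k0 by (rule dvd_mult_right)
  define Q where "Q = nome h k w"
  have Qp: "Q ^ p = nome h k0 w"
    unfolding Q_def exp_of_nat_mult[symmetric] using p k0p
    by (intro arg_cong[of _ _ exp]) (simp add: k0)
  have qp: "q ^ p = nome H k0 (1 / w)"
    unfolding q_def iw exp_of_nat_mult[symmetric] using p k0p
    by (intro arg_cong[of _ _ exp]) (simp add: k0)
  have q': "q = nome H k (1 / w)"
    unfolding q_def iw ..
  have "logG p Q = logG p q + of_real (pi / (12 * real k0)) * (1 / w - w) - of_real (pi / (12 * real k)) * (1 / w - w)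
      + of_real pi * \<i> * (of_real (dedekind_sum h k0) - of_real (dedekind_sum h k))"
    unfolding logG_def Qp qp using logf_transform[OF k0p w hH0] logf_transform[OF k w hH]
    unfolding Q_def[symmetric] q'[symmetric] by (simp add: algebra_simps)
  also have "of_real (pi / (12 * real k0)) * (1 / w - w) = of_real (pi / (12 * real k)) * (1 / w - w) + of_real (pi * (real p - 1) / (12 * real k)) * (1 / w - w)"
    using p k0p by (simp add: k0 field_simps)
  also have "of_real (pi * (real p - 1) / (12 * real k)) * (1 / w - w)
     = of_real (pi * (real p - 1) / 12) / z - of_real (pi * (real p - 1) / (12 * (real k)\<^sup>2)) * z"
    using k z0 by (simp add: w_def field_simps power2_eq_square)
  finally have L: "logG p Q = logG p q + (of_real (pi * (real p - 1) / 12) / z - of_real (pi * (real p - 1) / (12 * (real k)\<^sup>2)) * z)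
      + of_real pi * \<i> * (of_real (dedekind_sum h k0) - of_real (dedekind_sum h k))"
    by (simp add: algebra_simps)
  have Qe: "exp (tpi * (farey_point h k z)) = Q"
    unfolding Q_def w_def by (rule exp_farey_point[OF k])
  have "integrand p \<delta> n (farey_point h k z) =
    exp (of_real \<delta> * logG p Q - tpi * of_nat n * (farey_point h k z))"
    unfolding integrand_def Qe by (simp add: exp_diff exp_minus divide_inverse)
  also have "of_real \<delta> * logG p Q - tpi * of_nat n * (farey_point h k z)
    = of_real \<delta> * (- log_omega h k + log_omega h (k div p)) + - (tpi * of_nat h * of_nat n / of_nat k)
     + (of_real \<delta> * logG p q + (of_real (pi * \<delta> * (real p - 1) / 12) / z + of_real (pi * excess p \<delta> n / (12 * (real k)\<^sup>2)) * z))"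
    unfolding L log_omega_def kdiv using k by (simp add: field_simps power2_eq_square)
  finally show "integrand p \<delta> n (farey_point h k z) =
    omega_ratio_power \<delta> p h k * exp (- (tpi * of_nat h * of_nat n / of_nat k)) *
    (exp (of_real \<delta> * logG p q) *
     exp (of_real (pi * \<delta> * (real p - 1) / 12) / z + of_real (pi * excess p \<delta> n / (12 * (real k)\<^sup>2)) * z))"
    unfolding omega_ratio_power_def exp_add mult.assoc .
  have "of_real (2 * pi) * (\<i> * of_nat H - of_nat k / z) / of_nat k = \<i> * of_real (2 * pi * real H / real k) - of_real (2 * pi) * (1 / z)"
    using k by (simp add: field_simps)
  moreover have "Re (\<i> * of_real x - of_real (2 * pi) * v) = - 2 * pi * Re v" for x v by simp
  ultimately show "norm q = exp (- 2 * pi * Re (1 / z))"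
    unfolding q_def norm_exp_eq_Re by (simp only:)
qed

text \<open>Now q^p lies near ph/k, with the same denominator but with variable pw. So the half
  logarithms leave (ln p)/2, and 1/(pw) - 1/w makes the coefficient of Re(1/z) negative: the
  integrand is small where Re(1/z) is large. The dual nomes are unrelated, and a bound for the
  modulus is enough.\<close>

lemma norm_integrand_not_dvd:
  fixes p h k n :: nat and \<delta> :: real
  assumes p: "p > 0" "coprime p k" and k: "k > 0" "coprime h k" and z: "Re z > 0" and \<delta>: "\<delta> > 0"
  shows "norm (integrand p \<delta> n (farey_point h k z)) \<le>
    exp (\<delta> * lnf (exp (- 2 * pi * Re (1 / z) / real p))) * exp (\<delta> * lnf (exp (- 2 * pi * Re (1 / z)))) *
    (real p powr (\<delta> / 2) * exp (- (pi * (real p - 1) * \<delta> / (12 * real p)) * Re (1 / z)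
       + pi * excess p \<delta> n / (12 * (real k)\<^sup>2) * Re z))"
proof -
  obtain H where hH: "k dvd h * H + 1" using farey_right(3)[OF k(2,1) order_refl] by blast
  have "coprime (p * h) k" using p(2) k(2) by simp
  from farey_right(3)[OF this k(1) order_refl] obtain H' where hH': "k dvd p * h * H' + 1" by blast
  define w where "w = z / of_nat k"
  have z0: "z \<noteq> 0" using z by auto
  have w: "Re w > 0" using z k by (simp add: w_def Re_divide_of_nat)
  have pw: "Re (of_nat p * w) > 0" using w p by simp
  have w0: "w \<noteq> 0" using w by auto
  define Q where "Q = nome h k w"
  define q1 where "q1 = nome H' k (1 / (of_nat p * w))"
  define q2 where "q2 = nome H k (1 / w)"
  have Qp: "Q ^ p = nome (p * h) k (of_nat p * w)"
    unfolding Q_def exp_of_nat_mult[symmetric] using p k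
    by (intro arg_cong[of _ _ exp]) (simp add: field_simps)
  have Re1: "Re (1 / (of_nat p * w)) / real k = Re (1 / z) / real p" and Re2: "Re (1 / w) / real k = Re (1 / z)"
  proof -
    have "1 / (of_nat p * w) = of_real (real k / real p) * (1 / z)" "1 / w = of_real (real k) * (1 / z)"
      using k by (simp_all add: w_def)
    moreover have "Re (of_real c * v) = c * Re v" for c v by simp
    ultimately show "Re (1 / (of_nat p * w)) / real k = Re (1 / z) / real p" "Re (1 / w) / real k = Re (1 / z)"
      using k by (simp_all only:) simp_all
  qed
  have nexp: "norm (nome H k v) = exp (- 2 * pi * (Re v / real k))" for H v
    unfolding norm_exp_eq_Re by (simp add: Re_divide_of_nat)
  have n1: "norm q1 = exp (- 2 * pi * Re (1 / z) / real p)" and n2: "norm q2 = exp (- 2 * pi * Re (1 / z))"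
    unfolding q1_def q2_def nexp Re1 Re2 by simp_all
  have iz: "Re (1 / z) > 0" using z by (simp add: Re_divide add_pos_nonneg)
  have lt: "norm q1 < 1" "norm q2 < 1" unfolding n1 n2 using iz p by simp_all
  have Ln: "Re (Ln (of_nat p * w)) = ln (real p) + Re (Ln w)"
    using w0 p by (simp add: ln_mult norm_mult)
  have "Re (logG p Q) = Re (logf q1) - Re (logf q2) + ln (real p) / 2
      + (pi / (12 * real k) * (Re (1 / (of_nat p * w)) - real p * Re w) - pi / (12 * real k) * (Re (1 / w) - Re w))"
    unfolding logG_def Qp logf_transform[OF k(1) pw hH', folded q1_def]
      logf_transform[OF k(1) w hH, folded Q_def q2_def]
    by (simp add: Ln[simplified] add_divide_distrib)
  also have "pi / (12 * real k) * (Re (1 / (of_nat p * w)) - real p * Re w) - pi / (12 * real k) * (Re (1 / w) - Re w)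
     = pi / 12 * (Re (1 / (of_nat p * w)) / real k) - pi / 12 * (Re (1 / w) / real k) - pi * (real p - 1) / (12 * real k) * Re w"
    using k by (simp add: field_simps)
  also have "\<dots> = - (pi * (real p - 1) / (12 * real p)) * Re (1 / z) - pi * (real p - 1) / (12 * (real k)\<^sup>2) * Re z"
    unfolding Re1 Re2 using k p by (simp add: w_def Re_divide_of_nat field_simps power2_eq_square)
  finally have ReG: "Re (logG p Q) = Re (logf q1) - Re (logf q2) + ln (real p) / 2
     - (pi * (real p - 1) / (12 * real p)) * Re (1 / z) - pi * (real p - 1) / (12 * (real k)\<^sup>2) * Re z" by simp
  \<comment> \<open>The second value enters with a minus sign, but |logf| \<le> lnf bounds 1/f just
    as well as f; hence the product of two values of f.\<close>
  have "Re (logf q1) \<le> lnf (norm q1)" "- Re (logf q2) \<le> lnf (norm q2)"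
    using norm_logf_le[OF lt(1)] norm_logf_le[OF lt(2)] abs_Re_le_cmod[of "logf q1"] abs_Re_le_cmod[of "logf q2"] by linarith+
  then have "\<delta> * Re (logG p Q) \<le> \<delta> * (lnf (norm q1) + lnf (norm q2) + ln (real p) / 2
     - (pi * (real p - 1) / (12 * real p)) * Re (1 / z) - pi * (real p - 1) / (12 * (real k)\<^sup>2) * Re z)"
    unfolding ReG using \<delta> by (intro mult_left_mono) auto
  then have le: "\<delta> * Re (logG p Q) + 2 * pi * real n / (real k)\<^sup>2 * Re z \<le>
     \<delta> * lnf (norm q1) + \<delta> * lnf (norm q2) + (\<delta> / 2 * ln (real p) +
      (- (pi * (real p - 1) * \<delta> / (12 * real p)) * Re (1 / z)
       + pi * excess p \<delta> n / (12 * (real k)\<^sup>2) * Re z))"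
  proof -
    have "\<delta> * (L1 + L2 + ln (real p) / 2 - (pi * (real p - 1) / (12 * real p)) * U - pi * (real p - 1) / (12 * (real k)\<^sup>2) * V)
        + 2 * pi * real n / (real k)\<^sup>2 * V
      = \<delta> * L1 + \<delta> * L2 + (\<delta> / 2 * ln (real p) + (- (pi * (real p - 1) * \<delta> / (12 * real p)) * U
       + pi * excess p \<delta> n / (12 * (real k)\<^sup>2) * V))" for L1 L2 U V
      using k p by (simp add: field_simps)
    then show ?thesis using add_right_mono[OF \<open>\<delta> * Re (logG p Q) \<le> _\<close>] by metis
  qed
  have Qe: "exp (tpi * (farey_point h k z)) = Q"
    unfolding Q_def w_def by (rule exp_farey_point[OF k(1)])
  have "tpi * of_nat n * (farey_point h k z)
     = \<i> * of_real (2 * pi * real n * real h / real k) - of_real (2 * pi * real n / (real k)\<^sup>2) * z"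
    by (simp add: algebra_simps)
  then have "norm (integrand p \<delta> n (farey_point h k z)) =
      exp (\<delta> * Re (logG p Q) + 2 * pi * real n / (real k)\<^sup>2 * Re z)"
    unfolding integrand_def Qe norm_mult norm_exp_eq_Re exp_add by simp
  also have "\<dots> \<le> exp (\<delta> * lnf (norm q1) + \<delta> * lnf (norm q2) + (\<delta> / 2 * ln (real p) +
      (- (pi * (real p - 1) * \<delta> / (12 * real p)) * Re (1 / z)
       + pi * excess p \<delta> n / (12 * (real k)\<^sup>2) * Re z)))"
    using le by simp
  finally show ?thesis
    using p unfolding n1 n2 powr_def exp_add by simp
qed

section \<open>Estimates on the chords\<close>

lemma norm_exp_minus_1_le:
  fixes z :: complex
  shows "norm (exp z - 1) \<le> exp (norm z) - 1"
proof -
  have split: "exp w - 1 = (\<Sum>n. w ^ Suc n /\<^sub>R fact (Suc n))" for w :: "'a :: {real_normed_field, banach}"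
    using suminf_split_head[OF summable_exp_generic[of w]] by (simp add: exp_def)
  have sum: "summable (\<lambda>n. norm z ^ Suc n /\<^sub>R fact (Suc n))"
    using summable_exp_generic[of "norm z"] by (subst summable_Suc_iff)
  show ?thesis
    unfolding split by (rule norm_suminf_le[OF _ sum]) (simp add: norm_mult norm_power abs_mult)
qed

lemma exp_scale_minus_1_le:
  fixes y :: real assumes "0 \<le> t" "t \<le> 1"
  shows "exp (t * y) - 1 \<le> t * (exp y - 1)"
proof -
  have "convex_on UNIV (exp :: real \<Rightarrow> real)"
    by (rule f''_ge0_imp_convex) (auto intro!: derivative_eq_intros)
  from convex_onD[OF this, of t 0 y] assms show ?thesis by (simp add: algebra_simps)
qed

lemma inverse_Complex_1:
  "Re (1 / Complex 1 t) = 1 / (1 + t\<^sup>2)" "(norm (1 / Complex 1 t))\<^sup>2 = 1 / (1 + t\<^sup>2)"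
proof -
  have "(norm (Complex 1 t))\<^sup>2 = 1 + t\<^sup>2" by (simp add: cmod_def)
  then show "(norm (1 / Complex 1 t))\<^sup>2 = 1 / (1 + t\<^sup>2)" by (simp add: norm_divide power_divide)
qed (simp add: Re_divide)

text \<open>Off 0 the right-hand side says Re(1/z) \<ge> 1, so inversion maps the Ford disc to a
  half-plane.\<close>

lemma in_ford_disc_iff: "z \<in> cball (1/2) (1/2) \<longleftrightarrow> (norm z)\<^sup>2 \<le> Re z"
proof -
  have "z \<in> cball (1/2) (1/2) \<longleftrightarrow> (norm (1/2 - z))\<^sup>2 \<le> (1/2)\<^sup>2"
    by (subst power_mono_iff) (auto simp: dist_norm)
  also have "(norm (1/2 - z))\<^sup>2 = (norm z)\<^sup>2 - Re z + (1/2)\<^sup>2"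
    unfolding cmod_power2 by (simp add: power2_eq_square algebra_simps)
  finally show ?thesis by simp
qed

lemma inverse_in_ford_disc: "1 / Complex 1 t \<in> cball (1/2) (1/2)"
  unfolding in_ford_disc_iff inverse_Complex_1 by simp

text \<open>The half-planes and the Ford disc are convex, so it suffices that both end points lie in
  them. The end points have real parts 1/(1 + s^2) and 1/(1 + t^2) and lie on the circle.\<close>

lemma chord_point_bounds:
  assumes z: "z \<in> closed_segment (1 / Complex 1 s) (1 / Complex 1 t)"
    and c: "1 / (1 + s\<^sup>2) \<le> c" "1 / (1 + t\<^sup>2) \<le> c"
  shows "0 < Re z" "Re z \<le> c" "1 \<le> Re (1 / z)"
proof -
  have "closed_segment (1 / Complex 1 s) (1 / Complex 1 t) \<subseteq> {z. Re z > 0}"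
    by (intro closed_segment_subset) (auto simp: inverse_Complex_1 convex_halfspace_Re_gt add_pos_nonneg)
  then show pos: "0 < Re z" using z by auto
  have "closed_segment (1 / Complex 1 s) (1 / Complex 1 t) \<subseteq> {z. Re z \<le> c}"
    by (intro closed_segment_subset) (use c in \<open>auto simp: inverse_Complex_1 convex_halfspace_Re_le\<close>)
  then show "Re z \<le> c" using z by auto
  have "closed_segment (1 / Complex 1 s) (1 / Complex 1 t) \<subseteq> cball (1/2) (1/2)"
    by (intro closed_segment_subset inverse_in_ford_disc convex_cball)
  then have "(norm z)\<^sup>2 \<le> Re z" using z in_ford_disc_iff by blast
  moreover have "Re (1 / z) = Re z / (norm z)\<^sup>2" by (simp add: Re_divide cmod_power2)
  ultimately show "1 \<le> Re (1 / z)" using pos by (auto simp: le_divide_eq)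
qed

lemma chord_length_le_1: "norm (1 / Complex 1 t - 1 / Complex 1 s) \<le> 1"
proof -
  have "dist (1 / Complex 1 t) (1 / Complex 1 s) \<le> dist (1 / Complex 1 t) (1/2) + dist (1 / Complex 1 s) (1/2)"
    by (rule dist_triangle2)
  also have "\<dots> \<le> 1/2 + 1/2"
    using inverse_in_ford_disc[of t] inverse_in_ford_disc[of s] by (intro add_mono) (auto simp: dist_commute)
  finally show ?thesis by (simp add: dist_norm)
qed

text \<open>The chord is longest when both ends have the smallest admissible parameter \<open>u\<close>.\<close>

lemma chord_length_le:
  assumes u: "1 \<le> u" "u \<le> s" "u \<le> t"
  shows "norm (1 / Complex 1 t - 1 / Complex 1 (- s)) \<le> 2 * u / (1 + u\<^sup>2)"
proof -
  have nz: "Complex 1 t \<noteq> 0" "Complex 1 (- s) \<noteq> 0" by (auto simp: complex_eq_iff)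
  have pos: "0 < 1 + x\<^sup>2" for x :: real by (simp add: add_pos_nonneg)
  have n2: "(norm (Complex 1 x))\<^sup>2 = 1 + x\<^sup>2" for x by (simp add: cmod_def)
  have "1 / Complex 1 t - 1 / Complex 1 (- s) = (Complex 1 (- s) - Complex 1 t) / (Complex 1 t * Complex 1 (- s))"
    using nz by (simp add: divide_simps)
  also have "Complex 1 (- s) - Complex 1 t = - \<i> * of_real (s + t)" by (simp add: complex_eq_iff)
  finally have quot: "1 / Complex 1 t - 1 / Complex 1 (- s) = - \<i> * of_real (s + t) / (Complex 1 t * Complex 1 (- s))" .
  have "norm (- \<i> * of_real (s + t)) = \<bar>s + t\<bar>" by (simp only: norm_mult norm_of_real) simp
  then have "norm (1 / Complex 1 t - 1 / Complex 1 (- s)) = \<bar>s + t\<bar> / (norm (Complex 1 t) * norm (Complex 1 (- s)))"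
    unfolding quot by (simp only: norm_divide norm_mult[of "Complex 1 t"])
  then have "(norm (1 / Complex 1 t - 1 / Complex 1 (- s)))\<^sup>2 = (s + t)\<^sup>2 / ((1 + t\<^sup>2) * (1 + s\<^sup>2))"
    by (simp only: power_divide power_mult_distrib n2 power2_abs power2_minus)
  also have "\<dots> \<le> (2 * u / (1 + u\<^sup>2))\<^sup>2"
  proof -
    have "0 \<le> (u\<^sup>2 + 1) * ((s - u) + (t - u)) + 2 * u * ((s - u) * (t - u))"
      using u by (intro add_nonneg_nonneg mult_nonneg_nonneg) auto
    then have "(s + t) * (u\<^sup>2 - 1) \<le> 2 * u * (s * t - 1)"
      by (simp add: algebra_simps power2_eq_square)
    then have "((s + t) * (u\<^sup>2 - 1))\<^sup>2 \<le> (2 * u * (s * t - 1))\<^sup>2"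
      using u by (intro power_mono mult_nonneg_nonneg) (auto simp: one_le_power)
    \<comment> \<open>Here (2u)^2 (s + t)^2 is added to both sides: (1 + s^2)(1 + t^2) = (s + t)^2 +
      (st - 1)^2 and (1 + u^2)^2 = (u^2 - 1)^2 + (2u)^2.\<close>
    then have "(s + t)\<^sup>2 * (1 + u\<^sup>2)\<^sup>2 \<le> (2 * u)\<^sup>2 * ((1 + t\<^sup>2) * (1 + s\<^sup>2))"
      by (simp add: algebra_simps power2_eq_square)
    then show ?thesis using pos[of u] pos[of s] pos[of t] by (simp add: power_divide divide_le_eq le_divide_eq mult_ac)
  qed
  finally show ?thesis using u pos[of u] by (rule_tac power2_le_imp_le) auto
qed

text \<open>The bound 2u/(1 + u^2) for u = (M - k)/k, the lower bound for the ratios of the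
  neighbouring denominators to k. For u < 1 the monotonicity behind it fails, and the diameter 1 of
  the Ford circle is used.\<close>

definition chord :: "nat \<Rightarrow> nat \<Rightarrow> real" where
  "chord M k = (if 2 * k \<le> M then 2 * real k * (real M - real k) / ((real M - real k)\<^sup>2 + (real k)\<^sup>2) else 1)"

lemma chord_nonneg: "0 \<le> chord M k"
  by (auto simp: chord_def intro!: divide_nonneg_nonneg mult_nonneg_nonneg)

lemma ford_chord_length:
  assumes k: "0 < k" "k \<le> M" and m: "M < k + m" "M < k + m'"
  shows "norm (1 / Complex 1 (real m' / real k) - 1 / Complex 1 (- (real m / real k))) \<le> chord M k"
proof (cases "2 * k \<le> M")
  case True
  define u where "u = (real M - real k) / real k"
  have le: "u \<le> real m / real k" "u \<le> real m' / real k"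
    unfolding u_def using m by (intro divide_right_mono; linarith)+
  have u1: "1 \<le> u" using True k by (simp add: u_def le_divide_eq)
  have "2 * (d / b) / (1 + (d / b)\<^sup>2) = 2 * b * d / (d\<^sup>2 + b\<^sup>2)" if "b > 0" for b d :: real
  proof -
    have "1 + (d / b)\<^sup>2 = (d\<^sup>2 + b\<^sup>2) / b\<^sup>2" using that by (simp add: power_divide field_simps)
    then show ?thesis using that by (simp add: power2_eq_square)
  qed
  then have "2 * u / (1 + u\<^sup>2) = chord M k"
    using True k unfolding chord_def u_def by (simp only: if_True of_nat_0_less_iff)
  then show ?thesis using chord_length_le[OF u1 le] by simp
qed (use chord_length_le_1 in \<open>simp add: chord_def\<close>)

text \<open>After clearing denominators this is $0 \le ((M - k) - k)^3$ when $2k \le M$.\<close>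

lemma chord_pair:
  assumes "0 < k" "k < M"
  shows "chord M k / real k + chord M (M - k) / real (M - k) \<le> 4 / real M"
proof -
  have main: "chord M k / real k + chord M (M - k) / real (M - k) \<le> 4 / real M" if k: "0 < k" "2 * k \<le> M" for k
  proof -
    define a b where "a = real (M - k)" and "b = real k"
    have ab: "0 < b" "b \<le> a" "real M = a + b" "real M - real k = a" "real (M - k) = a"
      using k by (auto simp: a_def b_def of_nat_diff)
    have c1: "chord M k / real k = 2 * a / (a\<^sup>2 + b\<^sup>2)"
    proof -
      have "chord M k = 2 * real k * a / (a\<^sup>2 + (real k)\<^sup>2)"
        unfolding chord_def using k(2) by (simp only: if_True ab(4))
      then show ?thesis using ab(1) by (simp add: b_def)
    qed
    have c2: "chord M (M - k) / real (M - k) = 1 / a"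
    proof (cases "2 * k = M")
      case True
      then have "a = b" by (simp add: a_def b_def)
      then show ?thesis using True ab k by (auto simp: chord_def of_nat_diff field_simps power2_eq_square)
    next
      case False
      then show ?thesis using k ab by (simp add: chord_def)
    qed
    have "0 \<le> (a - b) ^ 3" using ab by simp
    then have "(2 * a * a + (a\<^sup>2 + b\<^sup>2)) * (a + b) \<le> 4 * (a * (a\<^sup>2 + b\<^sup>2))"
      by (simp add: algebra_simps power2_eq_square power3_eq_cube)
    moreover have "2 * a / (a\<^sup>2 + b\<^sup>2) + 1 / a = (2 * a * a + (a\<^sup>2 + b\<^sup>2)) / (a * (a\<^sup>2 + b\<^sup>2))"
      using ab by (simp add: divide_simps)
    moreover have "0 < a * (a\<^sup>2 + b\<^sup>2)" using ab by (intro mult_pos_pos add_pos_pos) auto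
    ultimately show ?thesis
      unfolding c1 c2 ab(3) using ab by (simp add: divide_le_eq le_divide_eq mult_ac)
  qed
  show ?thesis
  proof (cases "2 * k \<le> M")
    case False
    then have "2 * (M - k) \<le> M" "0 < M - k" using assms by auto
    from main[OF this(2,1)] assms show ?thesis by simp
  qed (use main assms in auto)
qed

text \<open>Averaging over k and M - k replaces every summand by at most 2/M, by
  \<open>chord_pair\<close>. The denominator M has no partner, but its own term is 1/M. Closure of K
  under the reflection is what the choice of order \<open>p * N\<close> provides later.\<close>

lemma chord_sum:
  assumes K: "K \<subseteq> {1..M}" and refl: "\<And>k. k \<in> K \<Longrightarrow> k < M \<Longrightarrow> M - k \<in> K" and M: "M > 0"
  shows "(\<Sum>k\<in>K. chord M k / real k) \<le> 2 * real (card K) / real M"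
proof -
  define K' where "K' = K - {M}"
  have fin: "finite K" using K by (rule finite_subset) simp
  have K': "\<And>k. k \<in> K' \<Longrightarrow> 0 < k \<and> k < M" "finite K'" using K fin by (force simp: K'_def)+
  have "(\<Sum>k\<in>K'. chord M k / real k) = (\<Sum>k\<in>K'. chord M (M - k) / real (M - k))"
  proof (rule sum.reindex_bij_witness[of _ "\<lambda>k. M - k" "\<lambda>k. M - k"])
    fix k assume "k \<in> K'"
    then have k: "k \<in> K" "0 < k" "k < M" using K' by (auto simp: K'_def)
    show "M - (M - k) = k" "M - (M - k) = k" using k by simp_all
    show "M - k \<in> K'" "M - k \<in> K'" using refl[OF k(1,3)] k by (simp_all add: K'_def)
    show "chord M (M - (M - k)) / real (M - (M - k)) = chord M k / real k" using k by simp
  qed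
  then have "2 * (\<Sum>k\<in>K'. chord M k / real k) = (\<Sum>k\<in>K'. chord M k / real k + chord M (M - k) / real (M - k))"
    by (simp add: sum.distrib)
  also have "\<dots> \<le> (\<Sum>k\<in>K'. 4 / real M)" using K' by (intro sum_mono chord_pair) auto
  finally have half: "(\<Sum>k\<in>K'. chord M k / real k) \<le> 2 * real (card K') / real M"
    using M by (simp add: field_simps)
  show ?thesis
  proof (cases "M \<in> K")
    case True
    have "(\<Sum>k\<in>K. chord M k / real k) = chord M M / real M + (\<Sum>k\<in>K'. chord M k / real k)"
      unfolding K'_def by (rule sum.remove[OF fin True])
    moreover have "chord M M / real M \<le> 2 / real M" using M by (simp add: chord_def divide_right_mono)
    moreover have "real (card K) = 1 + real (card K')"
      unfolding K'_def using card_Suc_Diff1[OF fin True] by simp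
    then have "2 / real M + 2 * real (card K') / real M = 2 * real (card K) / real M"
      by (simp add: add_divide_distrib)
    ultimately show ?thesis using half by linarith
  next
    case False
    then show ?thesis using half by (simp add: K'_def)
  qed
qed

text \<open>Neighbouring denominators satisfy k + m > M, so k^2 + m^2 \<ge> M^2/2. The left side is
  the real part of an end point of the chord in the coordinate z.\<close>

lemma ford_point_height:
  assumes "0 < k" "M < k + m" "M > 0"
  shows "1 / (1 + (real m / real k)\<^sup>2) \<le> 2 * (real k)\<^sup>2 / (real M)\<^sup>2"
proof -
  have "(real M)\<^sup>2 \<le> (real k + real m)\<^sup>2" using assms by (intro power_mono) linarith+
  also have "\<dots> \<le> 2 * ((real k)\<^sup>2 + (real m)\<^sup>2)"
    using sum_squares_bound[of "real k" "real m"] by (simp add: power2_sum)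
  finally have le: "(real M)\<^sup>2 \<le> 2 * ((real k)\<^sup>2 + (real m)\<^sup>2)" .
  have "1 / (1 + (real m / real k)\<^sup>2) = (real k)\<^sup>2 / ((real k)\<^sup>2 + (real m)\<^sup>2)"
    using assms by (simp add: field_simps)
  also have "\<dots> \<le> 2 * (real k)\<^sup>2 / (real M)\<^sup>2"
    using le assms mult_left_mono[OF le, of "(real k)\<^sup>2"]
    by (simp add: divide_le_eq le_divide_eq add_pos_nonneg mult_ac)
  finally show ?thesis .
qed

lemma ford_arc_length:
  assumes "0 < k" "M < k + m" "M > 0"
  shows "pi / 2 - arctan (real m / real k) \<le> pi / 2 * (sqrt 2 * real k / real M)"
proof -
  have "1 / sqrt (1 + (real m / real k)\<^sup>2) = sqrt (1 / (1 + (real m / real k)\<^sup>2))"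
    by (simp add: real_sqrt_divide)
  also have "\<dots> \<le> sqrt (2 * (real k)\<^sup>2 / (real M)\<^sup>2)"
    using ford_point_height[OF assms] by simp
  also have "\<dots> = sqrt 2 * real k / real M"
    using assms by (simp add: real_sqrt_divide real_sqrt_mult)
  finally have "pi / 2 * (1 / sqrt (1 + (real m / real k)\<^sup>2)) \<le> pi / 2 * (sqrt 2 * real k / real M)"
    by (intro mult_left_mono) auto
  then show ?thesis using arctan_complement_le[of "real m / real k"] by simp
qed

text \<open>In the coordinate 1/z the end points of an edge lie on the line Re = 1, at heights given
  by the ratios of the denominators.\<close>

lemma ford_points_inverse:
  assumes "k > 0"
  shows "of_nat k / (of_nat k - \<i> * of_nat m) = 1 / Complex 1 (- (real m / real k))"
    "of_nat k / (of_nat k + \<i> * of_nat m) = 1 / Complex 1 (real m / real k)"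
proof -
  have "Complex 1 (- (real m / real k)) = (of_nat k - \<i> * of_nat m) / of_nat k"
    "Complex 1 (real m / real k) = (of_nat k + \<i> * of_nat m) / of_nat k"
    using assms by (simp_all add: complex_eq_iff Re_divide_of_nat Im_divide_of_nat)
  then show "of_nat k / (of_nat k - \<i> * of_nat m) = 1 / Complex 1 (- (real m / real k))"
    "of_nat k / (of_nat k + \<i> * of_nat m) = 1 / Complex 1 (real m / real k)" by simp_all
qed

text \<open>With t = e^(-2 pi (u - 1)), \<open>lnf_scale\<close> and the convexity of exp extract t
  from the second factor, while the first one grows by e^(a (u - 1)) only. Since a \<le> 2 pi, the
  product is largest at u = 1.\<close>

lemma tail_decay:
  assumes u: "1 \<le> u" and a: "a \<le> 2 * pi" and d: "0 \<le> \<delta>"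
  shows "exp (a * u) * (exp (\<delta> * lnf (exp (- 2 * pi * u))) - 1) \<le> exp a * (exp (\<delta> * lnf (exp (- 2 * pi))) - 1)"
proof -
  define t where "t = exp (- 2 * pi * (u - 1))"
  define y where "y = \<delta> * lnf (exp (- 2 * pi))"
  have t: "0 \<le> t" "t \<le> 1" using u by (auto simp: t_def)
  have y: "0 \<le> y" unfolding y_def using d by (intro mult_nonneg_nonneg lnf_nonneg) auto
  have "exp (- 2 * pi * u) = t * exp (- 2 * pi)"
    unfolding t_def exp_add[symmetric] by (rule arg_cong[of _ _ exp]) (simp add: algebra_simps)
  then have "lnf (exp (- 2 * pi * u)) \<le> t * lnf (exp (- 2 * pi))"
    using lnf_scale[OF t, of "exp (- 2 * pi)"] by simp
  then have "\<delta> * lnf (exp (- 2 * pi * u)) \<le> t * y"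
    unfolding y_def using mult_left_mono[OF _ d] by (simp add: mult.left_commute)
  then have "exp (\<delta> * lnf (exp (- 2 * pi * u))) - 1 \<le> t * (exp y - 1)"
    using exp_scale_minus_1_le[OF t, of y] by (smt (verit) exp_le_cancel_iff)
  then have "exp (a * u) * (exp (\<delta> * lnf (exp (- 2 * pi * u))) - 1) \<le> exp (a * u) * (t * (exp y - 1))"
    by (rule mult_left_mono) simp
  also have "\<dots> = exp (a + (a - 2 * pi) * (u - 1)) * (exp y - 1)"
  proof -
    have "exp (a * u) * t = exp (a + (a - 2 * pi) * (u - 1))"
      unfolding t_def exp_add[symmetric] by (rule arg_cong[of _ _ exp]) (simp add: algebra_simps)
    then show ?thesis by (simp only: mult.assoc[symmetric])
  qed
  also have "\<dots> \<le> exp a * (exp y - 1)"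
    using u a y by (intro mult_right_mono) (auto simp: mult_nonpos_nonneg)
  finally show ?thesis by (simp add: y_def)
qed

section \<open>Minor and major arcs\<close>

lemma contour_integral_ford_chord:
  assumes "k > 0"
  shows "contour_integral (linepath (ford_left M h k) (ford_right M h k)) f =
    \<i> / (of_nat k)\<^sup>2 * contour_integral (linepath (1 / Complex 1 (- (real (farey_left M h k) / real k)))
        (1 / Complex 1 (real (farey_right M h k) / real k)))
      (\<lambda>z. f (farey_point h k z))"
  unfolding ford_left_alt ford_right_alt ford_points_inverse[OF assms] contour_integral_linepath_affine ..

lemma continuous_on_integrand_chord:
  assumes p: "p > 0" and k: "k > 0" and S: "\<And>z. z \<in> S \<Longrightarrow> Re z > 0"
  shows "continuous_on S (\<lambda>z. integrand p \<delta> n (farey_point h k z))"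
proof (rule continuous_on_compose2[OF holomorphic_on_imp_continuous_on[OF holomorphic_integrand[OF p]]])
  show "continuous_on S (\<lambda>z. of_nat h / of_nat k + \<i> / (of_nat k)\<^sup>2 * z)"
    by (intro continuous_intros)
  show "(\<lambda>z. of_nat h / of_nat k + \<i> / (of_nat k)\<^sup>2 * z) ` S \<subseteq> {\<tau>. 0 < Im \<tau>}"
    using S k by (auto simp: Im_farey_point)
qed

lemma farey_chord:
  assumes "(h, k) \<in> farey M"
  defines "s \<equiv> - (real (farey_left M h k) / real k)" and "t \<equiv> real (farey_right M h k) / real k"
  shows "k > 0" "k \<le> M" "coprime h k" "s \<le> 0" "0 \<le> t"
    "1 / (1 + s\<^sup>2) \<le> 2 * (real k)\<^sup>2 / (real M)\<^sup>2" "1 / (1 + t\<^sup>2) \<le> 2 * (real k)\<^sup>2 / (real M)\<^sup>2"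
    "norm (1 / Complex 1 t - 1 / Complex 1 s) \<le> chord M k"
    "pi / 2 - arctan (- s) \<le> pi / 2 * (sqrt 2 * real k / real M)"
    "pi / 2 - arctan t \<le> pi / 2 * (sqrt 2 * real k / real M)"
proof -
  have k: "k > 0" "k \<le> M" "coprime h k" using assms(1) by (auto simp: farey_def)
  then show "k > 0" "k \<le> M" "coprime h k" "s \<le> 0" "0 \<le> t" by (auto simp: s_def t_def)
  note l = farey_left(1)[OF k(3,1,2)] and r = farey_right(1)[OF k(3,1,2)]
  have M: "M > 0" using k by simp
  show "1 / (1 + s\<^sup>2) \<le> 2 * (real k)\<^sup>2 / (real M)\<^sup>2" "1 / (1 + t\<^sup>2) \<le> 2 * (real k)\<^sup>2 / (real M)\<^sup>2"
    unfolding s_def t_def power2_minus by (intro ford_point_height k l r M)+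
  show "norm (1 / Complex 1 t - 1 / Complex 1 s) \<le> chord M k"
    unfolding s_def t_def by (intro ford_chord_length k l r)
  show "pi / 2 - arctan (- s) \<le> pi / 2 * (sqrt 2 * real k / real M)"
    "pi / 2 - arctan t \<le> pi / 2 * (sqrt 2 * real k / real M)"
    unfolding s_def t_def minus_minus by (intro ford_arc_length k l r M)+
qed

text \<open>The height bound 2 k^2/M^2 cancels the k^2 in the exponent, so one exponential factor
  serves all edges; for M = pN it is the one in front of the error term.\<close>

lemma weight_exponent_le:
  assumes "k > 0" "M > 0" "0 \<le> X" "Re z \<le> 2 * (real k)\<^sup>2 / (real M)\<^sup>2"
  shows "pi * X / (12 * (real k)\<^sup>2) * Re z \<le> X * pi / (6 * (real M)\<^sup>2)"
proof -
  have "pi * X / (12 * (real k)\<^sup>2) * Re z \<le> pi * X / (12 * (real k)\<^sup>2) * (2 * (real k)\<^sup>2 / (real M)\<^sup>2)"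
    using assms by (intro mult_left_mono) auto
  also have "\<dots> = X * pi / (6 * (real M)\<^sup>2)" using assms by (simp add: field_simps)
  finally show ?thesis .
qed

text \<open>On the chord Re(1/z) \<ge> 1, and both the nomes and the exponential decrease in
  Re(1/z), so every factor is bounded by its value at Re(1/z) = 1. The factor 1/k^2 is the scale of
  the coordinate z.\<close>

lemma minor_arc_bound:
  assumes p: "p > 0" "coprime p k" and hk: "(h, k) \<in> farey M" and \<delta>: "\<delta> > 0"
    and n: "(real p - 1) * \<delta> \<le> 24 * real n"
  shows "norm (contour_integral (linepath (ford_left M h k) (ford_right M h k)) (integrand p \<delta> n)) \<le>
     exp (\<delta> * lnf (exp (- 2 * pi / real p))) * exp (\<delta> * lnf (exp (- 2 * pi))) *
     (real p powr (\<delta> / 2) * exp (- (pi * (real p - 1) * \<delta> / (12 * real p)))) *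
     exp (excess p \<delta> n * pi / (6 * (real M)\<^sup>2)) * (chord M k / (real k)\<^sup>2)"
    (is "_ \<le> ?f1 * ?f2 * (?P * ?e) * ?Q * _")
proof -
  define s where "s = - (real (farey_left M h k) / real k)"
  define t where "t = real (farey_right M h k) / real k"
  note fc = farey_chord[OF hk, folded s_def t_def]
  have M: "M > 0" using fc by simp
  define F where "F z = integrand p \<delta> n (farey_point h k z)" for z
  note zb = chord_point_bounds[OF _ fc(6,7)]
  have "F contour_integrable_on linepath (1 / Complex 1 s) (1 / Complex 1 t)"
    unfolding F_def[abs_def] using zb
    by (intro contour_integrable_continuous_linepath continuous_on_integrand_chord p fc(1)) auto
  then have "norm (contour_integral (linepath (1 / Complex 1 s) (1 / Complex 1 t)) F) \<le>
     ?f1 * ?f2 * (?P * ?e) * ?Q * norm (1 / Complex 1 t - 1 / Complex 1 s)"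
  proof (rule contour_integral_bound_linepath)
    fix z assume "z \<in> closed_segment (1 / Complex 1 s) (1 / Complex 1 t)"
    note z = zb[OF this]
    have "norm (F z) \<le> exp (\<delta> * lnf (exp (- 2 * pi * Re (1 / z) / real p))) * exp (\<delta> * lnf (exp (- 2 * pi * Re (1 / z)))) *
      (real p powr (\<delta> / 2) * exp (- (pi * (real p - 1) * \<delta> / (12 * real p)) * Re (1 / z)
       + pi * excess p \<delta> n / (12 * (real k)\<^sup>2) * Re z))"
      unfolding F_def by (rule norm_integrand_not_dvd[OF p fc(1,3) z(1) \<delta>])
    also have "\<dots> \<le> ?f1 * ?f2 * (?P * exp (- (pi * (real p - 1) * \<delta> / (12 * real p)) * 1
       + excess p \<delta> n * pi / (6 * (real M)\<^sup>2)))"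
    proof (intro mult_mono)
      have e: "exp (- 2 * pi * Re (1 / z) / real p) \<le> exp (- 2 * pi / real p)" "exp (- 2 * pi * Re (1 / z)) \<le> exp (- 2 * pi)"
        using z(3) p by (auto simp: divide_right_mono)
      show "exp (\<delta> * lnf (exp (- 2 * pi * Re (1 / z) / real p))) \<le> ?f1"
        using e p \<delta> by (simp only: exp_le_cancel_iff, intro mult_left_mono lnf_mono) auto
      show "exp (\<delta> * lnf (exp (- 2 * pi * Re (1 / z)))) \<le> ?f2"
        using e p \<delta> by (simp only: exp_le_cancel_iff, intro mult_left_mono lnf_mono) auto
      have c: "0 \<le> pi * (real p - 1) * \<delta> / (12 * real p)" using p \<delta> by (intro divide_nonneg_nonneg mult_nonneg_nonneg) auto
      have "- (pi * (real p - 1) * \<delta> / (12 * real p)) * Re (1 / z) \<le> - (pi * (real p - 1) * \<delta> / (12 * real p)) * 1"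
        using mult_left_mono[OF z(3) c] by simp
      moreover have "pi * excess p \<delta> n / (12 * (real k)\<^sup>2) * Re z \<le> excess p \<delta> n * pi / (6 * (real M)\<^sup>2)"
        using n by (intro weight_exponent_le fc(1) M z(2)) simp
      ultimately show "exp (- (pi * (real p - 1) * \<delta> / (12 * real p)) * Re (1 / z)
       + pi * excess p \<delta> n / (12 * (real k)\<^sup>2) * Re z)
       \<le> exp (- (pi * (real p - 1) * \<delta> / (12 * real p)) * 1 + excess p \<delta> n * pi / (6 * (real M)\<^sup>2))"
        unfolding exp_le_cancel_iff by (rule add_mono)
    qed auto
    also have "\<dots> = ?f1 * ?f2 * (?P * ?e) * ?Q" unfolding exp_add by simp
    finally show "norm (F z) \<le> ?f1 * ?f2 * (?P * ?e) * ?Q" .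
  qed auto
  also have "\<dots> \<le> ?f1 * ?f2 * (?P * ?e) * ?Q * chord M k"
    by (rule mult_left_mono[OF fc(8)]) auto
  finally have "norm (contour_integral (linepath (1 / Complex 1 s) (1 / Complex 1 t)) F) / (real k)\<^sup>2
      \<le> ?f1 * ?f2 * (?P * ?e) * ?Q * chord M k / (real k)\<^sup>2"
    by (rule divide_right_mono) simp
  then show ?thesis
    unfolding contour_integral_ford_chord[OF fc(1)] s_def[symmetric] t_def[symmetric] F_def[abs_def, symmetric]
    by (simp add: norm_mult norm_divide norm_power)
qed

text \<open>The subtracted term is the exact value that the unperturbed integrand would give on the
  full line Re(1/z) = 1. The two summands of the bound are the two missing arcs of that line and the
  contribution of G_p^\<delta> - 1 along the chord.\<close>

lemma major_arc_bound:
  assumes p: "p > 0" "p dvd k" and hk: "(h, k) \<in> farey M" and \<delta>: "\<delta> > 0"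
    and n: "(real p - 1) * \<delta> \<le> 24 * real n" and d24: "(real p - 1) * \<delta> \<le> 24"
  defines "a \<equiv> pi * \<delta> * (real p - 1) / 12" and "b \<equiv> pi * excess p \<delta> n / (12 * (real k)\<^sup>2)"
  shows "norm (contour_integral (linepath (ford_left M h k) (ford_right M h k)) (integrand p \<delta> n)
      - omega_ratio_power \<delta> p h k * exp (- (tpi * of_nat h * of_nat n / of_nat k))
        * of_real (2 * pi * a * bessel_sum (a * b) / (real k)\<^sup>2))
    \<le> exp a * exp (excess p \<delta> n * pi / (6 * (real M)\<^sup>2)) *
      ((pi * sqrt 2 * real k / real M + (exp (\<delta> * lnf (exp (- 2 * pi))) - 1) * chord M k) / (real k)\<^sup>2)"
    (is "norm (?I - ?W * ?m) \<le> exp a * ?Q * ((?arc + ?R * _) / _)")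
proof -
  define s where "s = - (real (farey_left M h k) / real k)"
  define t where "t = real (farey_right M h k) / real k"
  note fc = farey_chord[OF hk, folded s_def t_def]
  have M: "M > 0" using fc by simp
  obtain H where hH: "k dvd h * H + 1" using farey_right(3)[OF fc(3,1) order_refl] by blast
  define W where "W = ?W"
  have W: "norm W = 1"
    unfolding W_def omega_ratio_power_def log_omega_def norm_mult norm_exp_eq_Re by (simp add: Re_divide_of_nat)
  then have W0: "W \<noteq> 0" by auto
  have a0: "0 \<le> a" using p \<delta> by (simp add: a_def)
  have b0: "0 \<le> b" using n by (simp add: b_def)
  have a2: "a \<le> 2 * pi" using mult_left_mono[OF d24, of pi] by (simp add: a_def field_simps)
  define F where "F z = integrand p \<delta> n (farey_point h k z)" for z
  define E where "E z = exp (of_real a / z + of_real b * z)" for z :: complex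
  \<comment> \<open>E keeps the exponential of the transformed integrand and D equals (exp(\<delta>
    logG) - 1) E. Only E is moved to another path, so D needs no control off the chord.\<close>
  define D where "D z = F z / W - E z" for z
  define \<gamma> where "\<gamma> = linepath (1 / Complex 1 s) (1 / Complex 1 t)"
  note zb = chord_point_bounds[OF _ fc(6,7)]
  have contF: "continuous_on (closed_segment (1 / Complex 1 s) (1 / Complex 1 t)) F"
    unfolding F_def[abs_def] using zb by (intro continuous_on_integrand_chord p fc(1)) auto
  have contE: "continuous_on (closed_segment (1 / Complex 1 s) (1 / Complex 1 t)) E"
  proof -
    have "z \<noteq> 0" if "z \<in> closed_segment (1 / Complex 1 s) (1 / Complex 1 t)" for z
      using zb(1)[OF that] by auto
    then show ?thesis unfolding E_def[abs_def] by (intro continuous_intros) auto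
  qed
  have intE: "E contour_integrable_on \<gamma>" and intD: "D contour_integrable_on \<gamma>"
    unfolding \<gamma>_def D_def[abs_def] using W0
    by (intro contour_integrable_continuous_linepath continuous_intros contE contF; simp)+
  have "F = (\<lambda>z. W * (E z + D z))" using W0 by (simp add: D_def fun_eq_iff)
  then have "contour_integral \<gamma> F = W * (contour_integral \<gamma> E + contour_integral \<gamma> D)"
    using intE intD by (simp add: contour_integral_lmul contour_integral_add contour_integrable_add)
  then have I: "?I = \<i> / (of_nat k)\<^sup>2 * (W * (contour_integral \<gamma> E + contour_integral \<gamma> D))"
    unfolding contour_integral_ford_chord[OF fc(1)] s_def[symmetric] t_def[symmetric] F_def[abs_def, symmetric] \<gamma>_def[symmetric]
    by simp
  have Q: "b * (2 * (real k)\<^sup>2 / (real M)\<^sup>2) = excess p \<delta> n * pi / (6 * (real M)\<^sup>2)"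
    unfolding b_def using fc(1) M by (simp add: field_simps)
  \<comment> \<open>The sign is plus because inversion reverses the sign of the integral; together
    with the factor i/k^2 the main contribution becomes positive.\<close>
  have nE: "norm (contour_integral \<gamma> E + 2 * pi * \<i> * of_real (a * bessel_sum (a * b))) \<le> exp a * ?Q * ?arc"
  proof -
    have "contour_integral \<gamma> E = - contour_integral (linepath (Complex 1 s) (Complex 1 t)) (psi a b)"
      unfolding \<gamma>_def E_def[abs_def]
      by (subst contour_integral_inversion) (simp_all add: inverse_Complex_1 add_pos_nonneg)
    then have "norm (contour_integral \<gamma> E + 2 * pi * \<i> * of_real (a * bessel_sum (a * b))) =
       norm (contour_integral (linepath (Complex 1 (- (- s))) (Complex 1 t)) (psi a b) - 2 * pi * \<i> * of_real (a * bessel_sum (a * b)))"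
      by (simp add: norm_minus_commute)
    also have "\<dots> \<le> exp (a + b * (2 * (real k)\<^sup>2 / (real M)\<^sup>2)) * ((pi / 2 - arctan (- s)) + (pi / 2 - arctan t))"
      using psi_integral_approx[OF a0 b0, of "- s" t "2 * (real k)\<^sup>2 / (real M)\<^sup>2"] fc(4-7) by simp
    also have "\<dots> \<le> exp (a + b * (2 * (real k)\<^sup>2 / (real M)\<^sup>2)) * (pi / 2 * (sqrt 2 * real k / real M) + pi / 2 * (sqrt 2 * real k / real M))"
      by (intro mult_left_mono add_mono fc) simp
    also have "\<dots> = exp a * ?Q * ?arc" unfolding Q exp_add by (simp add: field_simps)
    finally show ?thesis .
  qed
  have nD: "norm (contour_integral \<gamma> D) \<le> exp a * ?Q * (?R * chord M k)"
  proof -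
    have "norm (contour_integral \<gamma> D) \<le> exp a * ?R * ?Q * norm (1 / Complex 1 t - 1 / Complex 1 s)"
      unfolding \<gamma>_def
    proof (rule contour_integral_bound_linepath[OF intD[unfolded \<gamma>_def]])
      have "0 \<le> lnf (exp (- 2 * pi))" by (rule lnf_nonneg) auto
      then show "0 \<le> exp a * ?R * ?Q" using \<delta> by simp
      fix z assume "z \<in> closed_segment (1 / Complex 1 s) (1 / Complex 1 t)"
      note z = zb[OF this]
      define q where "q = nome H k (of_nat k / z)"
      note tr = integrand_transform_dvd[OF p fc(1) hH z(1), folded q_def]
      have "F z = W * (exp (of_real \<delta> * logG p q) * E z)"
        unfolding F_def W_def E_def a_def b_def by (rule tr(1))
      then have D: "D z = (exp (of_real \<delta> * logG p q) - 1) * E z"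
        using W0 by (simp add: D_def algebra_simps)
      have q1: "norm q < 1" unfolding tr(2) using z(3) by simp
      have "norm (exp (of_real \<delta> * logG p q) - 1) \<le> exp (norm (of_real \<delta> * logG p q)) - 1"
        by (rule norm_exp_minus_1_le)
      also have "\<dots> \<le> exp (\<delta> * lnf (norm q)) - 1"
        using norm_logG_le[OF q1 p(1)] \<delta> by (simp add: norm_mult)
      finally have G: "norm (exp (of_real \<delta> * logG p q) - 1) \<le> exp (\<delta> * lnf (exp (- 2 * pi * Re (1 / z)))) - 1"
        unfolding tr(2) .
      have ReE: "Re (of_real a / z + of_real b * z) = a * Re (1 / z) + b * Re z"
        by (simp add: Re_divide)
      have "b * Re z \<le> excess p \<delta> n * pi / (6 * (real M)\<^sup>2)"
        unfolding b_def using n by (intro weight_exponent_le fc(1) M z(2)) simp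
      moreover have "norm (E z) = exp (a * Re (1 / z) + b * Re z)"
        unfolding E_def norm_exp_eq_Re ReE ..
      ultimately have "norm (E z) \<le> exp (a * Re (1 / z)) * ?Q"
        by (simp add: exp_add)
      then have "norm (D z) \<le> (exp (\<delta> * lnf (exp (- 2 * pi * Re (1 / z)))) - 1) * (exp (a * Re (1 / z)) * ?Q)"
        unfolding D norm_mult using order_trans[OF norm_ge_zero G] by (intro mult_mono G) auto
      also have "\<dots> = exp (a * Re (1 / z)) * (exp (\<delta> * lnf (exp (- 2 * pi * Re (1 / z)))) - 1) * ?Q" by simp
      also have "\<dots> \<le> exp a * ?R * ?Q"
        using \<delta> by (intro mult_right_mono tail_decay z(3) a2) auto
      finally show "norm (D z) \<le> exp a * ?R * ?Q" .
    qed
    also have "\<dots> \<le> exp a * ?R * ?Q * chord M k"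
    proof (rule mult_left_mono[OF fc(8)])
      have "0 \<le> lnf (exp (- 2 * pi))" by (rule lnf_nonneg) auto
      then show "0 \<le> exp a * ?R * ?Q" using \<delta> by simp
    qed
    finally show ?thesis by (simp add: mult_ac)
  qed
  have "?I - ?W * ?m = \<i> / (of_nat k)\<^sup>2 * W * ((contour_integral \<gamma> E + 2 * pi * \<i> * of_real (a * bessel_sum (a * b))) + contour_integral \<gamma> D)"
    unfolding I W_def[symmetric] using fc(1) by (simp add: field_simps)
  then have "norm (?I - ?W * ?m) = norm ((contour_integral \<gamma> E + 2 * pi * \<i> * of_real (a * bessel_sum (a * b))) + contour_integral \<gamma> D) / (real k)\<^sup>2"
    by (simp only: norm_mult norm_divide norm_power W) simp
  also have "\<dots> \<le> (exp a * ?Q * ?arc + exp a * ?Q * (?R * chord M k)) / (real k)\<^sup>2"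
    by (intro divide_right_mono norm_triangle_le add_mono nE nD) simp
  also have "\<dots> = exp a * ?Q * ((?arc + ?R * chord M k) / (real k)\<^sup>2)"
    by (simp add: algebra_simps add_divide_distrib)
  finally show ?thesis .
qed

section \<open>Summation over all denominators\<close>

lemma sum_farey:
  "(\<Sum>(h, k)\<in>farey M. f h k) = (\<Sum>k=1..M. \<Sum>h | h < k \<and> coprime h k. f h k)"
proof -
  have "(\<Sum>k=1..M. \<Sum>h | h < k \<and> coprime h k. f h k) = (\<Sum>(k, h)\<in>(SIGMA k:{1..M}. {h. h < k \<and> coprime h k}). f h k)"
    by (rule sum.Sigma) auto
  also have "\<dots> = (\<Sum>(h, k)\<in>farey M. f h k)"
    by (rule sum.reindex_bij_witness[of _ "\<lambda>(h, k). (k, h)" "\<lambda>(k, h). (h, k)"]) (auto simp: farey_def)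
  finally show ?thesis ..
qed

lemma card_coprime_le:
  assumes "k > (0::nat)"
  shows "card {h. h < k \<and> coprime h k} \<le> k"
  using card_mono[of "{..<k}" "{h. h < k \<and> coprime h k}"] by auto

text \<open>Discarding the j multiples of p below pj is enough. For the denominator k = pj this is
  the saving (p - 1)/p in the first error term.\<close>

lemma card_coprime_multiple_le:
  assumes p: "prime p" and j: "j > 0"
  shows "card {h. h < p * j \<and> coprime h (p * j)} \<le> (p - 1) * j"
proof -
  have "{h. h < p * j \<and> coprime h (p * j)} \<subseteq> {..<p * j} - (\<lambda>i. p * i) ` {..<j}"
  proof -
    have "\<not> coprime (p * i) (p * j)" for i
      using coprime_common_divisor[of "p * i" "p * j" p] prime_gt_1_nat[OF p] by auto
    then show ?thesis by blast
  qed
  then have "card {h. h < p * j \<and> coprime h (p * j)} \<le> card ({..<p * j} - (\<lambda>i. p * i) ` {..<j})"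
    by (intro card_mono) auto
  also have "\<dots> = p * j - j"
    using prime_gt_0_nat[OF p] by (subst card_Diff_subset) (auto simp: card_image inj_on_def)
  finally show ?thesis by (simp add: diff_mult_distrib)
qed

text \<open>a b is the square of half the argument of the Bessel function, so the square roots of
  \<delta> and of 24n/(p-1) - \<delta> combine with the prefactor and disappear. In the degenerate
  case a b = 0 and \<open>bessel_sum\<close> is 1, so one formula covers both cases.\<close>

lemma main_term_eq:
  assumes p: "p > 1" and \<delta>: "\<delta> > 0" and n: "(real p - 1) * \<delta> \<le> 24 * real n"
  shows "main_term p \<delta> N n = (\<Sum>k=1..N. \<Sum>h | h < p * k \<and> coprime h (p * k).
     omega_ratio_power \<delta> p h (p * k) * exp (- (tpi * of_nat h * of_nat n / of_nat (p * k)))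
     * of_real (2 * pi * (pi * \<delta> * (real p - 1) / 12) * bessel_sum ((pi * \<delta> * (real p - 1) / 12) *
         (pi * excess p \<delta> n / (12 * (real (p * k))\<^sup>2))) / (real (p * k))\<^sup>2))"
proof -
  define X where "X = 24 * real n / (real p - 1) - \<delta>"
  define a where "a = pi * \<delta> * (real p - 1) / 12"
  define b where "b k = pi * excess p \<delta> n / (12 * (real k)\<^sup>2)" for k
  have p1: "real p - 1 > 0" using p by simp
  have X0: "X \<ge> 0" using n p1 by (simp add: X_def field_simps)
  have Xn: "24 * real n - (real p - 1) * \<delta> = (real p - 1) * X" using p1 by (simp add: X_def field_simps)
  have B0: "bessel_sum 0 = 1" unfolding bessel_sum_def by (subst powser_zero) auto
  have ab: "a * b k = ((real p - 1) * pi / (6 * real k) * sqrt (\<delta> * X) / 2)\<^sup>2" for k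
    using X0 \<delta> unfolding a_def b_def Xn by (simp add: power_mult_distrib power_divide power2_eq_square mult_ac)
  have main: "main_term p \<delta> N n = (\<Sum>k=1..N. borwein_A p \<delta> (p * k) n * of_real (2 * pi * a * bessel_sum (a * b (p * k)) / real (p * k)))"
  proof (cases "X = 0")
    case True
    then have "main_term p \<delta> N n = (\<Sum>k = 1..N. borwein_A p \<delta> (p * k) n *
         of_real ((real p - 1) * pi\<^sup>2 * \<delta> / (6 * real p * real k)))"
      by (simp add: main_term_def X_def)
    also have "\<dots> = (\<Sum>k=1..N. borwein_A p \<delta> (p * k) n * of_real (2 * pi * a * bessel_sum (a * b (p * k)) / real (p * k)))"
    proof -
      have "a * b k = 0" for k using ab[of k] True by simp
      then have B1: "bessel_sum (a * b k) = 1" for k using B0 by (simp only:)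
      have "2 * pi * a * bessel_sum (a * b (p * k)) / real (p * k) = (real p - 1) * pi\<^sup>2 * \<delta> / (6 * real p * real k)" for k
        unfolding B1 unfolding a_def using p
        by (cases "k = 0") (simp_all add: field_simps power2_eq_square)
      then show ?thesis by simp
    qed
    finally show ?thesis .
  next
    case False
    then have X: "X > 0" using X0 by simp
    have I1: "2 * pi * sqrt \<delta> / sqrt X * bessel_I1 ((real p - 1) * pi / (6 * real p * real k) * sqrt (\<delta> * X))
       = 2 * pi * a * bessel_sum (a * b (p * k)) / real (p * k)" for k
    proof -
      have z: "(real p - 1) * pi / (6 * real p * real k) = (real p - 1) * pi / (6 * real (p * k))" by simp
      have "bessel_I1 ((real p - 1) * pi / (6 * real (p * k)) * sqrt (\<delta> * X)) =
         (real p - 1) * pi / (6 * real (p * k)) * sqrt (\<delta> * X) / 2 * bessel_sum (a * b (p * k))"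
        unfolding bessel_I1_factor bessel_sum_def[symmetric] ab ..
      also have "2 * pi * sqrt \<delta> / sqrt X * \<dots> = pi * (sqrt \<delta> * sqrt \<delta>) * ((real p - 1) * pi / (6 * real (p * k))) * bessel_sum (a * b (p * k)) * (sqrt X / sqrt X)"
      proof -
        have "2 * pi * u / v * (A * (u * v) / 2 * B) = pi * (u * u) * A * B * (v / v)" for u v A B :: real
          by simp
        then show ?thesis unfolding real_sqrt_mult .
      qed
      also have "\<dots> = 2 * pi * a * bessel_sum (a * b (p * k)) / real (p * k)"
        using X \<delta> by (simp add: a_def)
      finally show ?thesis unfolding z .
    qed
    have "main_term p \<delta> N n = of_real (2 * pi * sqrt \<delta> / sqrt X) *
           (\<Sum>k = 1..N. borwein_A p \<delta> (p * k) n *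
             of_real (bessel_I1 ((real p - 1) * pi / (6 * real p * real k) * sqrt (\<delta> * X))))"
      using False by (simp only: main_term_def X_def if_False)
    also have "\<dots> = (\<Sum>k = 1..N. borwein_A p \<delta> (p * k) n *
             of_real (2 * pi * sqrt \<delta> / sqrt X * bessel_I1 ((real p - 1) * pi / (6 * real p * real k) * sqrt (\<delta> * X))))"
      unfolding sum_distrib_left of_real_mult by (intro sum.cong refl) (simp only: mult_ac)
    finally show ?thesis unfolding I1 .
  qed
  show ?thesis
    unfolding main borwein_A_def sum_distrib_left sum_distrib_right a_def[symmetric] b_def[symmetric] coprime_iff_gcd_eq_1
    by (intro sum.cong refl) (simp add: power2_eq_square mult_ac)
qed

text \<open>The denominators split by divisibility by p into (p - 1)N and N numbers, and both
  classes are closed under k -> M - k. \<open>chord_sum\<close> then turns the sums over chords into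
  2(p - 1)/p and 2/p.\<close>

lemma borwein_coeff_main_term_diff:
  assumes p: "prime p" and \<delta>: "\<delta> > 0" and N: "N \<ge> 1"
    and n: "(real p - 1) * \<delta> \<le> 24 * real n" and d24: "(real p - 1) * \<delta> \<le> 24"
  shows "norm (borwein_coeff p \<delta> n - main_term p \<delta> N n) \<le>
    exp (excess p \<delta> n * pi / (6 * (real (p * N))\<^sup>2)) *
    ((real p - 1) * exp (pi * \<delta> * (real p - 1) / 12) / (real p)\<^sup>2 *
        (pi * sqrt 2 + 2 * (exp (\<delta> * lnf (exp (- 2 * pi))) - 1))
     + 2 * (real p - 1) / real p * (exp (\<delta> * lnf (exp (- 2 * pi / real p))) * exp (\<delta> * lnf (exp (- 2 * pi))) *
        (real p powr (\<delta> / 2) * exp (- (pi * (real p - 1) * \<delta> / (12 * real p))))))"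
    (is "_ \<le> ?Q * (?p1 * ?ea / _ * (_ + 2 * ?R) + _ * ?C)")
proof -
  have p1: "p > 1" "p > 0" using prime_gt_1_nat[OF p] by auto
  define M where "M = p * N"
  have M: "M > 0" using p1 N by (simp add: M_def)
  define Hs where "Hs k = {h. h < k \<and> coprime h k}" for k :: nat
  define I where "I h k = contour_integral (linepath (ford_left M h k) (ford_right M h k)) (integrand p \<delta> n)" for h k
  define m where "m h k = omega_ratio_power \<delta> p h k * exp (- (tpi * of_nat h * of_nat n / of_nat k))
     * of_real (2 * pi * (pi * \<delta> * (real p - 1) / 12) * bessel_sum ((pi * \<delta> * (real p - 1) / 12) *
         (pi * excess p \<delta> n / (12 * (real k)\<^sup>2))) / (real k)\<^sup>2)" for h k
  define K1 where "K1 = {k \<in> {1..M}. \<not> p dvd k}"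
  define K2 where "K2 = {k \<in> {1..M}. p dvd k}"
  have K: "{1..M} = K1 \<union> K2" "K1 \<inter> K2 = {}" "finite K1" "finite K2" by (auto simp: K1_def K2_def)
  have K2_img: "K2 = (\<lambda>j. p * j) ` {1..N}"
  proof (intro equalityI subsetI)
    fix k assume k: "k \<in> K2"
    then obtain j where "k = p * j" by (auto simp: K2_def)
    with k p1 show "k \<in> (\<lambda>j. p * j) ` {1..N}" by (auto simp: K2_def M_def)
  qed (use p1 in \<open>auto simp: K2_def M_def\<close>)
  have inj: "inj_on (\<lambda>j. p * j) {1..N}" using p1 by (auto simp: inj_on_def)
  have cardK2: "card K2 = N" unfolding K2_img card_image[OF inj] by simp
  have "card K1 + card K2 = M" using card_Un_disjoint[OF K(3,4,2)] by (simp add: K(1)[symmetric])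
  then have cardK1: "real (card K1) = (real p - 1) * real N"
    using cardK2 by (simp add: M_def algebra_simps flip: of_nat_mult of_nat_add)
  have "borwein_coeff p \<delta> n = (\<Sum>k\<in>{1..M}. \<Sum>h\<in>Hs k. I h k)"
    unfolding borwein_coeff_eq_sum[OF p1(2) M] sum_farey I_def Hs_def ..
  then have c: "borwein_coeff p \<delta> n = (\<Sum>k\<in>K1. \<Sum>h\<in>Hs k. I h k) + (\<Sum>k\<in>K2. \<Sum>h\<in>Hs k. I h k)"
    unfolding K(1) using K by (simp add: sum.union_disjoint)
  have mt: "main_term p \<delta> N n = (\<Sum>k\<in>K2. \<Sum>h\<in>Hs k. m h k)"
    unfolding main_term_eq[OF p1(1) \<delta> n] K2_img sum.reindex[OF inj] o_def m_def Hs_def ..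
  have diff: "borwein_coeff p \<delta> n - main_term p \<delta> N n =
      (\<Sum>k\<in>K1. \<Sum>h\<in>Hs k. I h k) + (\<Sum>k\<in>K2. \<Sum>h\<in>Hs k. I h k - m h k)"
    unfolding c mt by (simp add: sum_subtractf)
  have pM: "real M = real p * real N" by (simp add: M_def)
  have y: "0 \<le> lnf (exp (- 2 * pi))" by (rule lnf_nonneg) auto
  have R: "0 \<le> ?R" using y \<delta> by simp
  have b1: "norm (\<Sum>k\<in>K1. \<Sum>h\<in>Hs k. I h k) \<le> ?Q * (2 * ?p1 / real p * ?C)"
  proof -
    have "norm (\<Sum>k\<in>K1. \<Sum>h\<in>Hs k. I h k) \<le> (\<Sum>k\<in>K1. ?C * ?Q * (chord M k / real k))"
    proof (rule sum_norm_le)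
      fix k assume k: "k \<in> K1"
      then have cop: "coprime p k" using p by (simp add: K1_def prime_imp_coprime)
      have k0: "k > 0" using k by (simp add: K1_def)
      have "norm (\<Sum>h\<in>Hs k. I h k) \<le> (\<Sum>h\<in>Hs k. ?C * ?Q * (chord M k / (real k)\<^sup>2))"
      proof (rule sum_norm_le)
        fix h assume "h \<in> Hs k"
        then have "(h, k) \<in> farey M" using k by (auto simp: farey_def Hs_def K1_def)
        from minor_arc_bound[OF p1(2) cop this \<delta> n]
        show "norm (I h k) \<le> ?C * ?Q * (chord M k / (real k)\<^sup>2)" by (simp add: I_def M_def)
      qed
      also have "\<dots> = real (card (Hs k)) * (?C * ?Q * (chord M k / (real k)\<^sup>2))" by simp
      \<comment> \<open>There are at most k numerators, which leaves chord / k, the quantity that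
        \<open>chord_sum\<close> averages.\<close>
      also have "\<dots> \<le> real k * (?C * ?Q * (chord M k / (real k)\<^sup>2))"
        using card_coprime_le[OF k0] chord_nonneg[of M k]
        by (intro mult_right_mono mult_nonneg_nonneg divide_nonneg_nonneg) (auto simp: Hs_def)
      also have "\<dots> = ?C * ?Q * (chord M k / real k)" using k0 by (simp add: power2_eq_square)
      finally show "norm (\<Sum>h\<in>Hs k. I h k) \<le> ?C * ?Q * (chord M k / real k)" .
    qed
    also have "\<dots> = ?C * ?Q * (\<Sum>k\<in>K1. chord M k / real k)" by (simp only: sum_distrib_left)
    also have "\<dots> \<le> ?C * ?Q * (2 * real (card K1) / real M)"
    proof (rule mult_left_mono[OF chord_sum])
      show "M - k \<in> K1" if "k \<in> K1" "k < M" for k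
      proof -
        have "p dvd M" by (simp add: M_def)
        then have "\<not> p dvd M - k" using that dvd_diffD1[of p M k] by (auto simp: K1_def)
        then show ?thesis using that by (simp add: K1_def)
      qed
    qed (use M in \<open>auto simp: K1_def\<close>)
    also have "2 * real (card K1) / real M = 2 * ?p1 / real p"
      unfolding cardK1 pM using N by simp
    finally show ?thesis by (simp only: mult_ac)
  qed
  have b2: "norm (\<Sum>k\<in>K2. \<Sum>h\<in>Hs k. I h k - m h k) \<le> ?Q * (?p1 * ?ea / (real p)\<^sup>2 * (pi * sqrt 2 + 2 * ?R))"
  proof -
    have "norm (\<Sum>k\<in>K2. \<Sum>h\<in>Hs k. I h k - m h k) \<le> (\<Sum>k\<in>K2. ?p1 / real p * (?ea * ?Q) * (pi * sqrt 2 / real M + ?R * (chord M k / real k)))"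
    proof (rule sum_norm_le)
      fix k assume k: "k \<in> K2"
      then obtain j where j: "k = p * j" by (auto simp: K2_def)
      have k0: "k > 0" and dvd: "p dvd k" using k by (auto simp: K2_def)
      then have j0: "j > 0" using j by (auto intro: Nat.gr0I)
      define B where "B = ?ea * ?Q * ((pi * sqrt 2 * real k / real M + ?R * chord M k) / (real k)\<^sup>2)"
      have B: "0 \<le> B" unfolding B_def using R chord_nonneg[of M k]
        by (intro mult_nonneg_nonneg divide_nonneg_nonneg add_nonneg_nonneg) auto
      have "norm (\<Sum>h\<in>Hs k. I h k - m h k) \<le> (\<Sum>h\<in>Hs k. B)"
      proof (rule sum_norm_le)
        fix h assume "h \<in> Hs k"
        then have "(h, k) \<in> farey M" using k by (auto simp: farey_def Hs_def K2_def)
        from major_arc_bound[OF p1(2) dvd this \<delta> n d24]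
        show "norm (I h k - m h k) \<le> B" unfolding I_def m_def B_def by (simp only: M_def)
      qed
      also have "\<dots> = real (card (Hs k)) * B" by simp
      also have "\<dots> \<le> real ((p - 1) * j) * B"
        using card_coprime_multiple_le[OF p j0]
        by (intro mult_right_mono B) (simp only: Hs_def j of_nat_le_iff)
      \<comment> \<open>One power of k cancels: the arcs then contribute the same amount pi sqrt 2 /
        M for each k, and the chords again appear as chord / k.\<close>
      also have "real ((p - 1) * j) = ?p1 / real p * real k"
        using p1 by (simp add: j of_nat_diff)
      also have "?p1 / real p * real k * B = ?p1 / real p * (?ea * ?Q) * (pi * sqrt 2 / real M + ?R * (chord M k / real k))"
      proof -
        have "u * x * (e * ((S * x / y + R * c) / x\<^sup>2)) = u * e * (S / y + R * (c / x))"
          if "x > 0" for u x e S y R c :: real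
          using that by (simp add: add_divide_distrib power2_eq_square distrib_left)
        from this[of "real k"] show ?thesis unfolding B_def using k0 by (simp only: of_nat_0_less_iff)
      qed
      finally show "norm (\<Sum>h\<in>Hs k. I h k - m h k) \<le>
        ?p1 / real p * (?ea * ?Q) * (pi * sqrt 2 / real M + ?R * (chord M k / real k))" .
    qed
    also have "\<dots> = ?p1 / real p * (?ea * ?Q) * (real N * (pi * sqrt 2 / real M) + ?R * (\<Sum>k\<in>K2. chord M k / real k))"
      unfolding sum_distrib_left[symmetric] sum.distrib by (simp only: sum_distrib_left[symmetric] sum_constant cardK2)
    also have "\<dots> \<le> ?p1 / real p * (?ea * ?Q) * (real N * (pi * sqrt 2 / real M) + ?R * (2 * real (card K2) / real M))"
    proof (intro mult_left_mono add_left_mono chord_sum R)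
      show "M - k \<in> K2" if "k \<in> K2" "k < M" for k
        using that dvd_diff_nat[of p M k] by (simp add: K2_def M_def)
    qed (use M p1 in \<open>auto simp: K2_def\<close>)
    also have "\<dots> = ?Q * (?p1 * ?ea / (real p)\<^sup>2 * (pi * sqrt 2 + 2 * ?R))"
    proof -
      have "u / x * (e * Q) * (y * (S / (x * y)) + R * (2 * y / (x * y))) = Q * (u * e / x\<^sup>2 * (S + 2 * R))"
        if "x > 0" "y > 0" for u x y e Q S R :: real
        using that by (simp add: field_simps power2_eq_square)
      from this[of "real p" "real N"] show ?thesis
        unfolding cardK2 pM M_def[symmetric] using N p1 by (simp only: of_nat_0_less_iff)
    qed
    finally show ?thesis .
  qed
  show ?thesis
    unfolding diff distrib_left[of ?Q] using norm_triangle_mono[OF b1 b2] by (simp only: add.commute)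
qed

theorem theorem1p3:
  fixes p N :: nat and \<delta> :: real
  assumes "prime p"
    and "0 < \<delta>" and "\<delta> \<le> 24 / (real p - 1)"
    and "N \<ge> 1"
  shows "\<exists>E :: nat \<Rightarrow> complex. \<forall>n\<ge>1.
     borwein_coeff p \<delta> n =
       main_term p \<delta> N n
       + of_real (exp ((24 * real n - (real p - 1) * \<delta>) * pi / (6 * (real p)\<^sup>2 * (real N)\<^sup>2))) * E n
     \<and> norm (E n) \<le>
         (real p - 1) * exp ((real p - 1) * pi * \<delta> / 12) / (real p)\<^sup>2 *
           (pi * sqrt 2 - 2
            + 2 * partition_gf (exp (- 6 * pi)) powr \<delta> * partition_gf (exp (- 2 * pi)) powr \<delta>)
         + 2 * (real p - 1) * exp (- (pi * (real p - 1) * \<delta> / (12 * real p)))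
             / real p powr (1 - \<delta> / 2)
             * partition_gf (exp (- 2 * pi / real p)) powr \<delta> * partition_gf (exp (- 2 * pi)) powr \<delta>"
proof -
  have p: "real p > 1" using prime_gt_1_nat[OF assms(1)] by simp
  define f where "f x = exp (\<delta> * lnf (exp x))" for x
  have pf: "partition_gf (exp x) powr \<delta> = f x" if "x < 0" for x
    unfolding f_def using that by (intro partition_gf_powr) auto
  define Q where "Q n = exp ((24 * real n - (real p - 1) * \<delta>) * pi / (6 * (real p)\<^sup>2 * (real N)\<^sup>2))" for n
  \<comment> \<open>The positive factor Q is divided out of the difference, so the identity is
    immediate and only the bound has content.\<close>
  define E where "E n = (borwein_coeff p \<delta> n - main_term p \<delta> N n) / of_real (Q n)" for n
  show ?thesis
  proof (intro exI[of _ E] allI impI conjI)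
    fix n :: nat assume n: "n \<ge> 1"
    show "borwein_coeff p \<delta> n = main_term p \<delta> N n
       + of_real (exp ((24 * real n - (real p - 1) * \<delta>) * pi / (6 * (real p)\<^sup>2 * (real N)\<^sup>2))) * E n"
      unfolding E_def Q_def[symmetric] by (simp add: Q_def)
    have d24: "(real p - 1) * \<delta> \<le> 24" using assms(3) p by (simp add: field_simps)
    have d24n: "(real p - 1) * \<delta> \<le> 24 * real n" using d24 n by linarith
    have Q: "exp ((24 * real n - (real p - 1) * \<delta>) * pi / (6 * (real (p * N))\<^sup>2)) = Q n"
      by (simp add: Q_def power_mult_distrib)
    have "norm (E n) = norm (borwein_coeff p \<delta> n - main_term p \<delta> N n) / Q n"
      by (simp add: E_def norm_divide Q_def)
    also have "\<dots> \<le> (real p - 1) * exp (pi * \<delta> * (real p - 1) / 12) / (real p)\<^sup>2 * (pi * sqrt 2 + 2 * (f (- 2 * pi) - 1))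
     + 2 * (real p - 1) / real p * (f (- 2 * pi / real p) * f (- 2 * pi) *
        (real p powr (\<delta> / 2) * exp (- (pi * (real p - 1) * \<delta> / (12 * real p)))))"
      using borwein_coeff_main_term_diff[OF assms(1,2,4) d24n d24] unfolding Q f_def[symmetric]
      by (subst pos_divide_le_eq) (simp_all add: Q_def mult.commute)
    also have "\<dots> \<le> (real p - 1) * exp ((real p - 1) * pi * \<delta> / 12) / (real p)\<^sup>2 *
           (pi * sqrt 2 - 2 + 2 * f (- 6 * pi) * f (- 2 * pi))
         + 2 * (real p - 1) * exp (- (pi * (real p - 1) * \<delta> / (12 * real p)))
             / real p powr (1 - \<delta> / 2) * f (- 2 * pi / real p) * f (- 2 * pi)"
    proof (rule add_mono)
      \<comment> \<open>The bound obtained so far contains f(e^(-2 pi))^\<delta> only; since f \<ge>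
        1 on [0, 1), the factor f(e^(-6 pi))^\<delta> of the stated bound can be multiplied
        in.\<close>
      have "0 \<le> lnf (exp (- 6 * pi))" by (rule lnf_nonneg) auto
      then have "1 \<le> f (- 6 * pi)" using assms(2) by (simp add: f_def)
      then have "1 * f (- 2 * pi) \<le> f (- 6 * pi) * f (- 2 * pi)"
        by (rule mult_right_mono) (simp add: f_def)
      then have le: "pi * sqrt 2 + 2 * (f (- 2 * pi) - 1) \<le> pi * sqrt 2 - 2 + 2 * f (- 6 * pi) * f (- 2 * pi)"
        by simp
      have e: "exp (pi * \<delta> * (real p - 1) / 12) = exp ((real p - 1) * pi * \<delta> / 12)" by (simp add: mult_ac)
      show "(real p - 1) * exp (pi * \<delta> * (real p - 1) / 12) / (real p)\<^sup>2 * (pi * sqrt 2 + 2 * (f (- 2 * pi) - 1))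
        \<le> (real p - 1) * exp ((real p - 1) * pi * \<delta> / 12) / (real p)\<^sup>2 * (pi * sqrt 2 - 2 + 2 * f (- 6 * pi) * f (- 2 * pi))"
        unfolding e using p by (intro mult_left_mono le) auto
      have "real p powr (1 - \<delta> / 2) = real p / real p powr (\<delta> / 2)"
        using p by (simp add: powr_diff)
      then show "2 * (real p - 1) / real p * (f (- 2 * pi / real p) * f (- 2 * pi) *
        (real p powr (\<delta> / 2) * exp (- (pi * (real p - 1) * \<delta> / (12 * real p)))))
        \<le> 2 * (real p - 1) * exp (- (pi * (real p - 1) * \<delta> / (12 * real p)))
             / real p powr (1 - \<delta> / 2) * f (- 2 * pi / real p) * f (- 2 * pi)"
        by (simp add: mult_ac)
    qed
    finally show "norm (E n) \<le>
         (real p - 1) * exp ((real p - 1) * pi * \<delta> / 12) / (real p)\<^sup>2 *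
           (pi * sqrt 2 - 2
            + 2 * partition_gf (exp (- 6 * pi)) powr \<delta> * partition_gf (exp (- 2 * pi)) powr \<delta>)
         + 2 * (real p - 1) * exp (- (pi * (real p - 1) * \<delta> / (12 * real p)))
             / real p powr (1 - \<delta> / 2)
             * partition_gf (exp (- 2 * pi / real p)) powr \<delta> * partition_gf (exp (- 2 * pi)) powr \<delta>"
      using p by (simp add: pf)
  qed
qed

end
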